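(* Let $X$ be a separable Banach space and $T:X\to X$ a bounded linear operator. Suppose there exist a dense set $\mathcal D\subset X$ and maps $S_n:\mathcal D\to X$, $n\geq0$, such that for every $x\in\mathcal D$: (i) $\sum_{n\geq0}T^nx$ converges unconditionally; (ii) $\sum_{n\geq0}S_nx$ converges unconditionally; (iii) $T^nS_nx=x$ for all $n$ and $T^mS_nx=S_{n-m}x$ for all $n>m$. Then there exists a $T$-invariant Borel probability measure $\mu$ on $X$ with full support, with respect to which $T$ is strongly mixing, such that every continuous polynomial $X\to\mathbb R$ belongs to $L^2(X,\mathcal B,\mu)$. Suppose moreover that there exists $\alpha>1/2$ such that for every $x\in\mathcal D$, $\|T^nx\|=O(n^{-\alpha})$ and $\|S_nx\|=O(n^{-\alpha})$. Then (the measure can be chosen so that) for any polynomials $f,g$ there is $C_{f,g,\alpha}$ with, for all $n\geq1$, $|\mathrm{Cov}(f\circ T^n,g)|\leq C_{f,g,\alpha}n^{1-2\alpha}$ if $\alpha\in(1/2,1)$, $\leq C_{f,g,\alpha}\frac{\log(n+1)}n$ if $\alpha=1$, $\leq C_{f,g,\alpha}n^{-\alpha}$ if $\alpha>1$; and if $\alpha>1$, for every polynomial $f$ with $\int f\,d\mu=0$, $\frac1{\sqrt n}(f+f\circ T+\dots+f\circ T^{n-1})$ converges in distribution to a Gaussian random variable with zero mean and finite variance.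
   Context: A homogeneous polynomial of degree $d$ on $X$ is $x\mapsto Q(x,\dots,x)$ with $Q$ a bounded symmetric $d$-linear form on $X$; a polynomial is a finite sum of homogeneous polynomials. $T$-invariant: $\mu(T^{-1}A)=\mu(A)$; full support: $\mu(U)>0$ for nonempty open $U$; strongly mixing: $\mu(A\cap T^{-n}B)\to\mu(A)\mu(B)$ for Borel $A,B$. $\mathrm{Cov}(f,g)=\int fg\,d\mu-\int f\,d\mu\int g\,d\mu$. *)

theory Defs
  imports "HOL-Probability.Probability" "HOL-Library.Landau_Symbols"
begin

text \<open>A bounded symmetric d-linear form on X, represented as a function of an
argument family v :: nat => X, of which only v 0, ..., v (d-1) matter.\<close>
definition bounded_sym_multilinear :: "nat \<Rightarrow> ((nat \<Rightarrow> 'a::real_normed_vector) \<Rightarrow> real) \<Rightarrow> bool" where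
  "bounded_sym_multilinear d Q \<longleftrightarrow>
     (\<forall>v w. (\<forall>i<d. v i = w i) \<longrightarrow> Q v = Q w) \<and>
     (\<forall>i<d. \<forall>v. linear (\<lambda>y. Q (v(i := y)))) \<and>
     (\<forall>v p. p permutes {..<d} \<longrightarrow> Q (v \<circ> p) = Q v) \<and>
     (\<exists>C. \<forall>v. \<bar>Q v\<bar> \<le> C * (\<Prod>i<d. norm (v i)))"

definition homogeneous_polynomial :: "nat \<Rightarrow> ('a::real_normed_vector \<Rightarrow> real) \<Rightarrow> bool" where
  "homogeneous_polynomial d f \<longleftrightarrow>
     (\<exists>Q. bounded_sym_multilinear d Q \<and> f = (\<lambda>x. Q (\<lambda>_. x)))"

definition polynomial_on :: "('a::real_normed_vector \<Rightarrow> real) \<Rightarrow> bool" where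
  "polynomial_on f \<longleftrightarrow>
     (\<exists>(n::nat) (ds::nat \<Rightarrow> nat) (ps::nat \<Rightarrow> 'a \<Rightarrow> real).
        (\<forall>i<n. homogeneous_polynomial (ds i) (ps i)) \<and> f = (\<lambda>x. \<Sum>i<n. ps i x))"

definition Cov :: "'a measure \<Rightarrow> ('a \<Rightarrow> real) \<Rightarrow> ('a \<Rightarrow> real) \<Rightarrow> real" where
  "Cov \<mu> f g = (\<integral>x. f x * g x \<partial>\<mu>) - (\<integral>x. f x \<partial>\<mu>) * (\<integral>x. g x \<partial>\<mu>)"

definition good_measure :: "('a::{banach,second_countable_topology} \<Rightarrow> 'a) \<Rightarrow> 'a measure \<Rightarrow> bool" where
  "good_measure T \<mu> \<longleftrightarrow>
     sets \<mu> = sets borel \<and> prob_space \<mu> \<and>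
     (\<forall>A\<in>sets borel. emeasure \<mu> (T -` A) = emeasure \<mu> A) \<and>
     (\<forall>U. open U \<and> U \<noteq> {} \<longrightarrow> emeasure \<mu> U > 0) \<and>
     (\<forall>A\<in>sets borel. \<forall>B\<in>sets borel.
        (\<lambda>n. measure \<mu> (A \<inter> (T ^^ n) -` B)) \<longlonglongrightarrow> measure \<mu> A * measure \<mu> B) \<and>
     (\<forall>f. polynomial_on f \<and> continuous_on UNIV f \<longrightarrow>
        f \<in> borel_measurable \<mu> \<and> integrable \<mu> (\<lambda>x. (f x)\<^sup>2))"

end

theory Submission
  imports Defs
begin

text \<open>The measure is the law of a random series
  \<open>V = \<Sum>\<^sub>k \<Sum>\<^sub>j \<xi>\<^sub>j\<^sub>k y\<^sub>j\<^sub>k\<close>, where \<open>y\<^sub>j\<^sub>k\<close> is \<open>S\<^sub>j x\<^sub>k\<close> for \<open>j \<ge> 0\<close> and \<open>T\<^sup>-\<^sup>j x\<^sub>k\<close> for \<open>j < 0\<close>, the \<open>x\<^sub>k\<close> are dense,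
  and the \<open>\<xi>\<^sub>j\<^sub>k\<close> are independent with values in \<open>{0, 1}\<close> and mean \<open>p\<^sub>k\<close>. Since \<open>T y\<^sub>j\<^sub>k = y\<^sub>j\<^sub>-\<^sub>1\<^sub>k\<close>, the operator acts on
  \<open>V\<close> as a shift of the time index \<open>j\<close>. With \<open>{0, 1}\<close>-valued coefficients every partial series is a
  subseries of an unconditionally convergent one, and if \<open>p\<^sub>k\<close> decreases fast enough then
  almost surely only finitely many \<open>k\<close> contribute more than \<open>2\<^sup>-\<^sup>k\<close>, so that \<open>V\<close> has all moments.

  Replacing the coefficients of a single time \<open>j\<close> by an independent copy changes a polynomial of \<open>V\<close>
  by \<open>O((1 + \<bar>j\<bar>)\<^sup>-\<^sup>\<alpha>)\<close> in \<open>L\<^sup>2\<close>. Resampling one time after the other bounds the covariance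
  of \<open>f \<circ> T\<^sup>n\<close> and \<open>g\<close> by the convolution \<open>\<Sum>\<^sub>j (1 + \<bar>j - n\<bar>)\<^sup>-\<^sup>\<alpha> (1 + \<bar>j\<bar>)\<^sup>-\<^sup>\<alpha>\<close>, which has the
  claimed order. For \<open>\<alpha> > 1\<close> the influences are summable; then truncating \<open>V\<close> to the times \<open>\<bar>j\<bar> \<le> m\<close>
  changes the normalized Birkhoff sums little in \<open>L\<^sup>2\<close>, uniformly in their length, and Bernstein's
  blocks reduce the truncated sums to the classical central limit theorem.\<close>

section \<open>Unconditional summation and polynomials\<close>

text \<open>In a general Banach space the variances of the terms do not control a series with
  independent coefficients. The norm of \<open>V\<close> is therefore estimated pathwise: an almost
  surely finite random majorant bounds it together with its subseries, and the moments of the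
  majorant are computed without independence. Independence enters only in the resampling, the
  mixing, the blocks and the proof of full support. One measure has to serve polynomials of all
  degrees. Hence the probability of seeing the k-th vector in its time window is at most of order
  \<open>2^-k B^-k\<close>, where B is one plus the total size of the vectors up to k: the exponent
  grows with k and eventually beats every fixed power. As the means do not depend on the time, the
  shift preserves the law. The condition \<open>\<alpha> > 1/2\<close> is square summability of the
  influences and keeps the convolution finite. Its order has two sources: sites near 0 or n give
  n^-\<alpha> times a partial sum of i^-\<alpha> over i up to order n, distant sites give the tail
  n^(1-2\<alpha>).\<close>

lemma summable_on_iff_small_tails:
  fixes f :: "'i \<Rightarrow> 'a::banach"
  shows "f summable_on A \<longleftrightarrow>
    (\<forall>e>0. \<exists>F. finite F \<and> F \<subseteq> A \<and> (\<forall>G. finite G \<and> G \<subseteq> A \<and> G \<inter> F = {} \<longrightarrow> norm (sum f G) \<le> e))"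
proof (intro iffI allI impI)
  fix e :: real assume "f summable_on A" "0 < e"
  then obtain S where S: "(sum f \<longlongrightarrow> S) (finite_subsets_at_top A)"
    by (auto simp: summable_on_def has_sum_def)
  have "0 < e/2" using \<open>0 < e\<close> by simp
  from tendstoD[OF S this] obtain F where F: "finite F" "F \<subseteq> A"
    and *: "\<And>F'. finite F' \<Longrightarrow> F \<subseteq> F' \<Longrightarrow> F' \<subseteq> A \<Longrightarrow> dist (sum f F') S < e/2"
    by (auto simp: eventually_finite_subsets_at_top)
  have "norm (sum f G) \<le> e" if G: "finite G" "G \<subseteq> A" "G \<inter> F = {}" for G
  proof -
    have "sum f G = sum f (F \<union> G) - sum f F"
      using G F by (subst sum.union_disjoint) auto
    moreover have "dist (sum f (F \<union> G)) S < e/2" "dist (sum f F) S < e/2"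
      using *[of "F \<union> G"] *[of F] G F by auto
    ultimately show ?thesis
      using dist_triangle2[of "sum f (F \<union> G)" "sum f F" S] by (simp add: dist_norm)
  qed
  with F show "\<exists>F. finite F \<and> F \<subseteq> A \<and> (\<forall>G. finite G \<and> G \<subseteq> A \<and> G \<inter> F = {} \<longrightarrow> norm (sum f G) \<le> e)"
    by (intro exI[of _ F]) simp
next
  assume tails: "\<forall>e>0. \<exists>F. finite F \<and> F \<subseteq> A \<and>
    (\<forall>G. finite G \<and> G \<subseteq> A \<and> G \<inter> F = {} \<longrightarrow> norm (sum f G) \<le> e)"
  have "\<exists>P. eventually P (finite_subsets_at_top A) \<and>
      (\<forall>F F'. P F \<and> P F' \<longrightarrow> dist (sum f F) (sum f F') < e)" if "e > 0" for e
  proof -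
    from that have "0 < e/3" by simp
    with tails obtain F0 where F0: "finite F0" "F0 \<subseteq> A"
      and *: "\<And>G. finite G \<Longrightarrow> G \<subseteq> A \<Longrightarrow> G \<inter> F0 = {} \<Longrightarrow> norm (sum f G) \<le> e/3" by meson
    have near: "norm (sum f F - sum f F0) \<le> e/3" if "finite F" "F0 \<subseteq> F" "F \<subseteq> A" for F
    proof -
      have "sum f F - sum f F0 = sum f (F - F0)" using that by (simp add: sum_diff)
      moreover have "norm (sum f (F - F0)) \<le> e/3" using that by (intro *) auto
      ultimately show ?thesis by simp
    qed
    show ?thesis
    proof (intro exI[of _ "\<lambda>F. finite F \<and> F0 \<subseteq> F \<and> F \<subseteq> A"] conjI allI impI)
      show "\<forall>\<^sub>F F in finite_subsets_at_top A. finite F \<and> F0 \<subseteq> F \<and> F \<subseteq> A"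
        using F0 by (auto simp: eventually_finite_subsets_at_top)
      fix F F' assume "(finite F \<and> F0 \<subseteq> F \<and> F \<subseteq> A) \<and> finite F' \<and> F0 \<subseteq> F' \<and> F' \<subseteq> A"
      then have "norm (sum f F - sum f F0) \<le> e/3" "norm (sum f F' - sum f F0) \<le> e/3"
        using near by auto
      then show "dist (sum f F) (sum f F') < e"
        using norm_triangle_ineq4[of "sum f F - sum f F0" "sum f F' - sum f F0"] \<open>e > 0\<close>
        by (simp add: dist_norm)
    qed
  qed
  then have "cauchy_filter (filtermap (sum f) (finite_subsets_at_top A))"
    by (simp add: cauchy_filter_metric_filtermap)
  then obtain L where "filtermap (sum f) (finite_subsets_at_top A) \<le> nhds L"
    using cauchy_filter_complete_converges[of "filtermap (sum f) (finite_subsets_at_top A)" UNIV] complete_UNIV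
    by (auto simp: filtermap_bot_iff)
  then have "(sum f \<longlongrightarrow> L) (finite_subsets_at_top A)"
    by (simp add: filterlim_def)
  then show "f summable_on A"
    using has_sum_def summable_on_def by blast
qed

lemma norm_infsum_le_bound:
  fixes f :: "'i \<Rightarrow> 'a::banach"
  assumes "\<And>G. finite G \<Longrightarrow> G \<subseteq> B \<Longrightarrow> norm (sum f G) \<le> e"
  shows "norm (infsum f B) \<le> e"
proof (cases "f summable_on B")
  case True
  then have "((\<lambda>F. norm (sum f F)) \<longlongrightarrow> norm (infsum f B)) (finite_subsets_at_top B)"
    using infsum_tendsto tendsto_norm by blast
  moreover have "\<forall>\<^sub>F F in finite_subsets_at_top B. norm (sum f F) \<le> e"
    using assms by (auto intro!: eventually_finite_subsets_at_top_weakI)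
  ultimately show ?thesis
    by (rule tendsto_upperbound) simp
next
  case False
  \<comment> \<open>\<open>infsum\<close> of a family that is not summable is 0; the empty partial
    sum gives \<open>0 \<le> e\<close>.\<close>
  then show ?thesis using assms[of "{}"] by (simp add: infsum_not_exists)
qed

text \<open>Once \<open>W n\<close> contains the finite set \<open>F\<close> outside of which all
  finite sums are small, the remainder over \<open>A - W n\<close> is small, whatever else
  \<open>W n\<close> contains.\<close>

lemma infsum_tendsto_exhaustion:
  fixes f :: "'i \<Rightarrow> 'a::banach"
  assumes f: "f summable_on A" and W: "\<And>n. W n \<subseteq> A"
    and ev: "\<And>a. a \<in> A \<Longrightarrow> eventually (\<lambda>n. a \<in> W n) sequentially"
  shows "(\<lambda>n. infsum f (W n)) \<longlonglongrightarrow> infsum f A"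
proof (rule tendstoI)
  fix e :: real assume "e > 0"
  then have "e/2 > 0" by simp
  then obtain F where F: "finite F" "F \<subseteq> A"
    and *: "\<And>G. finite G \<Longrightarrow> G \<subseteq> A \<Longrightarrow> G \<inter> F = {} \<Longrightarrow> norm (sum f G) \<le> e/2"
    using f unfolding summable_on_iff_small_tails by meson
  have "\<forall>\<^sub>F n in sequentially. \<forall>a\<in>F. a \<in> W n"
    using F ev by (subst eventually_ball_finite_distrib) auto
  then show "\<forall>\<^sub>F n in sequentially. dist (infsum f (W n)) (infsum f A) < e"
  proof eventually_elim
    case (elim n)
    have "infsum f A = infsum f (W n) + infsum f (A - W n)"
      using infsum_Un_disjoint[of f "W n" "A - W n"] W[of n] summable_on_subset_banach[OF f W, of n]
        summable_on_subset_banach[OF f Diff_subset, of "W n"] by (simp add: Un_absorb1)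
    moreover have "norm (infsum f (A - W n)) \<le> e/2"
    proof (rule norm_infsum_le_bound)
      fix G assume "finite G" "G \<subseteq> A - W n"
      then show "norm (sum f G) \<le> e/2" using *[of G] elim by auto
    qed
    ultimately show ?case using \<open>e > 0\<close> by (simp add: dist_norm norm_minus_commute)
  qed
qed

text \<open>Here a row fixes \<open>k\<close> and lets \<open>j\<close> run. Off \<open>C\<close>
  row \<open>k\<close> adds at most \<open>e k\<close>; the late rows are small together because
  \<open>e\<close> is summable, and each of the finitely many early rows has small tails by its own
  convergence.\<close>

lemma summable_on_rows:
  fixes Y :: "'j \<times> nat \<Rightarrow> 'a::banach"
  assumes row: "\<And>k. (\<lambda>j. Y (j, k)) summable_on UNIV"
    and tail: "\<And>k G. finite G \<Longrightarrow> (\<And>j. j \<in> G \<Longrightarrow> (j, k) \<notin> C) \<Longrightarrow> norm (\<Sum>j\<in>G. Y (j, k)) \<le> e k"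
    and e: "summable e" and W: "W \<inter> C = {}"
  shows "Y summable_on W" and "norm (infsum Y W) \<le> suminf e"
proof -
  have e0: "0 \<le> e k" for k using tail[of "{}" k] by simp
  have split: "norm (sum Y G) \<le> (\<Sum>k\<in>snd ` G. norm (\<Sum>j\<in>{j. (j, k) \<in> G}. Y (j, k)))" if "finite G" for G
  proof -
    have "sum Y G = (\<Sum>k\<in>snd ` G. \<Sum>x\<in>{x\<in>G. snd x = k}. Y x)"
      using that by (simp add: sum.group)
    also have "\<dots> = (\<Sum>k\<in>snd ` G. \<Sum>j\<in>{j. (j, k) \<in> G}. Y (j, k))"
    proof (rule sum.cong[OF refl])
      fix k show "(\<Sum>x\<in>{x\<in>G. snd x = k}. Y x) = (\<Sum>j\<in>{j. (j, k) \<in> G}. Y (j, k))"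
        by (rule sum.reindex_bij_witness[of _ "\<lambda>j. (j, k)" fst]) auto
    qed
    finally show ?thesis by (simp add: norm_sum)
  qed
  have fin: "finite {j. (j, k) \<in> G}" if "finite G" for k and G :: "('j \<times> nat) set"
    using finite_imageI[OF that, of fst] by (rule finite_subset[rotated]) force
  have bound: "norm (\<Sum>j\<in>{j. (j, k) \<in> G}. Y (j, k)) \<le> e k" if "finite G" "G \<subseteq> W" for k G
    by (rule tail) (use that W fin in auto)
  show "norm (infsum Y W) \<le> suminf e"
  proof (rule norm_infsum_le_bound)
    fix G assume G: "finite G" "G \<subseteq> W"
    have "norm (sum Y G) \<le> (\<Sum>k\<in>snd ` G. e k)"
      by (rule order_trans[OF split[OF G(1)] sum_mono[OF bound[OF G]]])
    also have "\<dots> \<le> suminf e" using G e e0 by (intro sum_le_suminf) auto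
    finally show "norm (sum Y G) \<le> suminf e" .
  qed
  show "Y summable_on W"
    unfolding summable_on_iff_small_tails
  proof (intro allI impI)
    fix \<epsilon> :: real assume "\<epsilon> > 0"
    \<comment> \<open>The rows from \<open>K\<close> on share \<epsilon>/2 and the \<open>K\<close>
      early ones the other half; \<open>K + 1\<close> in the denominator covers
      \<open>K = 0\<close>.\<close>
    obtain K where K: "\<And>n. n \<ge> K \<Longrightarrow> norm (suminf (\<lambda>i. e (i + n))) < \<epsilon>/2"
      using suminf_exist_split[OF _ e, of "\<epsilon>/2"] \<open>\<epsilon> > 0\<close> by auto
    have "\<exists>F. finite F \<and> (\<forall>G. finite G \<and> G \<inter> F = {} \<longrightarrow> norm (\<Sum>j\<in>G. Y (j, k)) \<le> \<epsilon> / (2 * (real K + 1)))" for k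
    proof -
      have "0 < \<epsilon> / (2 * (real K + 1))" using \<open>\<epsilon> > 0\<close> by simp
      from row[of k, unfolded summable_on_iff_small_tails, THEN spec, THEN mp, OF this] show ?thesis
        by simp
    qed
    then have "\<forall>k. \<exists>F. finite F \<and> (\<forall>G. finite G \<and> G \<inter> F = {} \<longrightarrow> norm (\<Sum>j\<in>G. Y (j, k)) \<le> \<epsilon> / (2 * (real K + 1)))" ..
    from choice[OF this] obtain F where F: "\<And>k. finite (F k)"
      and F': "\<And>k G. finite G \<Longrightarrow> G \<inter> F k = {} \<Longrightarrow> norm (\<Sum>j\<in>G. Y (j, k)) \<le> \<epsilon> / (2 * (real K + 1))"
      by blast
    let ?F = "(\<Union>k<K. (\<lambda>j. (j, k)) ` F k) \<inter> W"
    show "\<exists>F. finite F \<and> F \<subseteq> W \<and> (\<forall>G. finite G \<and> G \<subseteq> W \<and> G \<inter> F = {} \<longrightarrow> norm (sum Y G) \<le> \<epsilon>)"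
    proof (intro exI[of _ ?F] conjI allI impI)
      show "finite ?F" using F by auto
      show "?F \<subseteq> W" by auto
      fix G assume "finite G \<and> G \<subseteq> W \<and> G \<inter> ?F = {}"
      then have G: "finite G" "G \<subseteq> W" "G \<inter> ?F = {}" by auto
      let ?n = "\<lambda>k. norm (\<Sum>j\<in>{j. (j, k) \<in> G}. Y (j, k))"
      have small: "?n k \<le> \<epsilon> / (2 * (real K + 1))" if "k < K" for k
        by (rule F') (use G that fin in auto)
      have "norm (sum Y G) \<le> (\<Sum>k\<in>snd ` G. ?n k)" by (rule split[OF G(1)])
      also have "\<dots> = (\<Sum>k\<in>snd ` G \<inter> {..<K}. ?n k) + (\<Sum>k\<in>snd ` G - {..<K}. ?n k)"
        using G(1) by (subst sum.Int_Diff[of _ _ "{..<K}"]) auto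
      also have "(\<Sum>k\<in>snd ` G \<inter> {..<K}. ?n k) \<le> (\<Sum>k<K. \<epsilon> / (2 * (real K + 1)))"
      proof (rule order_trans)
        show "(\<Sum>k\<in>snd ` G \<inter> {..<K}. ?n k) \<le> (\<Sum>k\<in>snd ` G \<inter> {..<K}. \<epsilon> / (2 * (real K + 1)))"
          using small by (intro sum_mono) auto
        show "(\<Sum>k\<in>snd ` G \<inter> {..<K}. \<epsilon> / (2 * (real K + 1))) \<le> (\<Sum>k<K. \<epsilon> / (2 * (real K + 1)))"
          using \<open>\<epsilon> > 0\<close> by (intro sum_mono2) auto
      qed
      also have "\<dots> \<le> \<epsilon>/2" using \<open>\<epsilon> > 0\<close> by (simp add: field_simps)
      also have "(\<Sum>k\<in>snd ` G - {..<K}. ?n k) \<le> (\<Sum>k\<in>snd ` G - {..<K}. e k)"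
        using bound[OF G(1,2)] by (intro sum_mono)
      also have "\<dots> = (\<Sum>i\<in>(\<lambda>k. k - K) ` (snd ` G - {..<K}). e (i + K))"
        by (subst sum.reindex) (auto simp: inj_on_def)
      also have "\<dots> \<le> suminf (\<lambda>i. e (i + K))"
        using G(1) e e0 by (intro sum_le_suminf) (auto simp: summable_iff_shift)
      also have "\<dots> \<le> \<epsilon>/2" using K[of K] by simp
      finally show "norm (sum Y G) \<le> \<epsilon>" by simp
    qed
  qed
qed

section \<open>Growth of polynomial increments\<close>

lemma homogeneous_polynomial_diff_bound:
  assumes "homogeneous_polynomial d f"
  shows "\<exists>C\<ge>0. \<forall>x h. \<bar>f (x + h) - f x\<bar> \<le> C * norm h * (1 + norm x + norm h) ^ d"
proof -
  obtain Q where Q: "bounded_sym_multilinear d Q" and f: "f = (\<lambda>x. Q (\<lambda>_. x))"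
    using assms by (auto simp: homogeneous_polynomial_def)
  have dep: "\<And>v w. (\<And>i. i < d \<Longrightarrow> v i = w i) \<Longrightarrow> Q v = Q w"
    and lin: "\<And>i v. i < d \<Longrightarrow> linear (\<lambda>y. Q (v(i := y)))"
    using Q by (simp_all add: bounded_sym_multilinear_def)
  obtain C where C: "\<And>v. \<bar>Q v\<bar> \<le> C * (\<Prod>i<d. norm (v i))"
    using Q by (auto simp: bounded_sym_multilinear_def)
  have "\<bar>f (x + h) - f x\<bar> \<le> (real d * \<bar>C\<bar>) * norm h * (1 + norm x + norm h) ^ d" for x h
  proof -
    let ?R = "1 + norm x + norm h"
    \<comment> \<open>Hybrid arguments between the constant families \<open>x\<close> and
      \<open>x + h\<close>: consecutive ones differ in a single slot, where linearity leaves a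
      factor \<open>h\<close>.\<close>
    define v where "v i = (\<lambda>j. if j < i then x + h else x)" for i :: nat
    have step: "\<bar>Q (v (Suc i)) - Q (v i)\<bar> \<le> \<bar>C\<bar> * norm h * ?R ^ d" if i: "i < d" for i
    proof -
      have "v (Suc i) = (v i)(i := x + h)" "v i = (v i)(i := x)"
        by (auto simp: v_def fun_eq_iff less_Suc_eq)
      then have "Q (v (Suc i)) - Q (v i) = Q ((v i)(i := h))"
        using linear_add[OF lin[OF i], of "v i" x h] by simp
      also have "\<bar>\<dots>\<bar> \<le> C * (\<Prod>j<d. norm (((v i)(i := h)) j))" by (rule C)
      also have "\<dots> \<le> \<bar>C\<bar> * (\<Prod>j<d. norm (((v i)(i := h)) j))"
        by (intro mult_right_mono prod_nonneg) auto
      also have "(\<Prod>j<d. norm (((v i)(i := h)) j)) = norm h * (\<Prod>j\<in>{..<d} - {i}. norm (v i j))"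
        using i by (subst prod.remove[of _ i]) (auto intro!: prod.cong)
      also have "(\<Prod>j\<in>{..<d} - {i}. norm (v i j)) \<le> (\<Prod>j\<in>{..<d} - {i}. ?R)"
        by (intro prod_mono) (auto simp: v_def intro: norm_triangle_le)
      also have "\<dots> = ?R ^ (d - 1)" using i by simp
      also have "\<dots> \<le> ?R ^ d" by (intro power_increasing) auto
      finally show ?thesis by (simp add: mult_left_mono mult.assoc)
    qed
    have "f (x + h) - f x = Q (v d) - Q (v 0)"
      unfolding f by (intro arg_cong2[where f="(-)"] dep) (auto simp: v_def)
    also have "\<dots> = (\<Sum>i<d. Q (v (Suc i)) - Q (v i))" using sum_lessThan_telescope[of "\<lambda>i. Q (v i)"] by simp
    also have "\<bar>\<dots>\<bar> \<le> (\<Sum>i<d. \<bar>C\<bar> * norm h * ?R ^ d)"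
      by (rule order_trans[OF sum_abs sum_mono[OF step]]) auto
    finally show ?thesis by (simp add: mult.assoc)
  qed
  then show ?thesis by (intro exI[of _ "real d * \<bar>C\<bar>"]) auto
qed

lemma polynomial_on_diff_bound:
  assumes "polynomial_on f"
  shows "\<exists>C d. 0 \<le> C \<and> (\<forall>x h. \<bar>f (x + h) - f x\<bar> \<le> C * norm h * (1 + norm x + norm h) ^ d)"
proof -
  obtain n :: nat and ds ps where ps: "\<And>i. i < n \<Longrightarrow> homogeneous_polynomial (ds i) (ps i)"
    and f: "f = (\<lambda>x. \<Sum>i<n. ps i x)"
    using assms by (auto simp: polynomial_on_def)
  have "\<forall>i. \<exists>c. i < n \<longrightarrow> 0 \<le> c \<and> (\<forall>x h. \<bar>ps i (x + h) - ps i x\<bar> \<le> c * norm h * (1 + norm x + norm h) ^ ds i)"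
    using homogeneous_polynomial_diff_bound[OF ps] by auto
  from choice[OF this] obtain c where c: "\<And>i. i < n \<Longrightarrow> 0 \<le> c i"
    "\<And>i x h. i < n \<Longrightarrow> \<bar>ps i (x + h) - ps i x\<bar> \<le> c i * norm h * (1 + norm x + norm h) ^ ds i" by blast
  \<comment> \<open>A common exponent for all homogeneous parts: the base is at least 1, so powers
    may be raised.\<close>
  let ?d = "\<Sum>i<n. ds i"
  have "\<bar>f (x + h) - f x\<bar> \<le> (\<Sum>i<n. c i) * norm h * (1 + norm x + norm h) ^ ?d" for x h
  proof -
    have "\<bar>f (x + h) - f x\<bar> \<le> (\<Sum>i<n. \<bar>ps i (x + h) - ps i x\<bar>)"
      unfolding f by (simp flip: sum_subtractf)
    also have "\<dots> \<le> (\<Sum>i<n. c i * norm h * (1 + norm x + norm h) ^ ?d)"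
    proof (rule sum_mono)
      fix i assume i: "i \<in> {..<n}"
      then have "ds i \<le> ?d" by (intro member_le_sum) auto
      then have "(1 + norm x + norm h) ^ ds i \<le> (1 + norm x + norm h) ^ ?d"
        by (intro power_increasing) auto
      with c(1)[of i] i show "\<bar>ps i (x + h) - ps i x\<bar> \<le> c i * norm h * (1 + norm x + norm h) ^ ?d"
        by (intro order_trans[OF c(2)] mult_left_mono) auto
    qed
    finally show ?thesis by (simp add: sum_distrib_right)
  qed
  moreover have "0 \<le> (\<Sum>i<n. c i)" using c(1) by (intro sum_nonneg) auto
  ultimately show ?thesis by blast
qed

text \<open>Measurability is obtained from the increment bound, so that the later estimates can be
  stated for any function with such a bound.\<close>

lemma continuous_on_of_diff_bound:
  fixes f :: "'a::real_normed_vector \<Rightarrow> real"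
  assumes "\<And>x h. \<bar>f (x + h) - f x\<bar> \<le> C * norm h * (1 + norm x + norm h) ^ d"
  shows "continuous_on UNIV f"
proof -
  have "isCont f x" for x
  proof -
    have nrm: "(norm \<longlongrightarrow> norm (0::'a)) (at (0::'a))"
      by (rule tendsto_norm[OF tendsto_ident_at])
    have "((\<lambda>h::'a. C * norm h * (1 + norm x + norm h) ^ d) \<longlongrightarrow> C * norm (0::'a) * (1 + norm x + norm (0::'a)) ^ d) (at 0)"
      by (intro tendsto_intros nrm)
    then have "((\<lambda>h. C * norm h * (1 + norm x + norm h) ^ d) \<longlongrightarrow> 0) (at (0::'a))" by simp
    then have "((\<lambda>h. f (x + h) - f x) \<longlongrightarrow> 0) (at 0)"
      by (rule Lim_null_comparison[rotated]) (simp add: assms always_eventually)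
    then have "((\<lambda>h. f (x + h)) \<longlongrightarrow> f x) (at 0)"
      by (rule LIM_zero_cancel)
    then show ?thesis by (simp add: isCont_iff)
  qed
  then show ?thesis by (simp add: continuous_at_imp_continuous_on)
qed

section \<open>Bernoulli fields\<close>

definition measure_preserving_map :: "'a measure \<Rightarrow> 'b measure \<Rightarrow> ('a \<Rightarrow> 'b) \<Rightarrow> bool" where
  "measure_preserving_map M N \<phi> \<longleftrightarrow> \<phi> \<in> measurable M N \<and> distr M N \<phi> = N"

lemma measure_preserving_mapD:
  assumes "measure_preserving_map M N \<phi>"
  shows "\<phi> \<in> measurable M N" and "distr M N \<phi> = N"
  using assms by (auto simp: measure_preserving_map_def)

lemma measure_preserving_map_integrable:
  fixes f :: "'b \<Rightarrow> real"
  assumes "measure_preserving_map M N \<phi>" "f \<in> borel_measurable N"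
  shows "integrable M (\<lambda>x. f (\<phi> x)) \<longleftrightarrow> integrable N f"
  using integrable_distr_eq[of \<phi> M N f] measure_preserving_mapD[OF assms(1)] assms(2) by simp

lemma measure_preserving_map_integral:
  fixes f :: "'b \<Rightarrow> real"
  assumes "measure_preserving_map M N \<phi>" "f \<in> borel_measurable N"
  shows "(\<integral>x. f (\<phi> x) \<partial>M) = integral\<^sup>L N f"
  using integral_distr[of \<phi> M N f] measure_preserving_mapD[OF assms(1)] assms(2) by simp

lemma measure_preserving_map_AE:
  assumes "measure_preserving_map M N \<phi>" "AE x in N. P x"
  shows "AE x in M. P (\<phi> x)"
proof (rule AE_distrD[of \<phi> M N P])
  show "\<phi> \<in> measurable M N" by (rule measure_preserving_mapD(1)[OF assms(1)])
  show "AE x in distr M N \<phi>. P x"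
    unfolding measure_preserving_mapD(2)[OF assms(1)] by (rule assms(2))
qed

lemma measure_preserving_map_measure:
  assumes "measure_preserving_map M N \<phi>" "A \<in> sets N"
  shows "measure M (\<phi> -` A \<inter> space M) = measure N A"
  using measure_distr[of \<phi> M N A] measure_preserving_mapD[OF assms(1)] assms(2) by simp

section \<open>Inequalities in L2\<close>

lemma product_integrable_of_squares:
  fixes f g :: "'a \<Rightarrow> real"
  assumes [measurable]: "f \<in> borel_measurable M" "g \<in> borel_measurable M"
    and sq: "integrable M (\<lambda>x. (f x)\<^sup>2)" "integrable M (\<lambda>x. (g x)\<^sup>2)"
  shows "integrable M (\<lambda>x. f x * g x)"
proof (rule Bochner_Integration.integrable_bound)
  show "integrable M (\<lambda>x. (f x)\<^sup>2 + (g x)\<^sup>2)" using sq by (rule Bochner_Integration.integrable_add)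
  show "AE x in M. norm (f x * g x) \<le> norm ((f x)\<^sup>2 + (g x)\<^sup>2)"
  proof (rule AE_I2)
    fix x
    have "2 * (\<bar>f x\<bar> * \<bar>g x\<bar>) \<le> (f x)\<^sup>2 + (g x)\<^sup>2"
      using sum_squares_bound[of "\<bar>f x\<bar>" "\<bar>g x\<bar>"] by simp
    moreover have "0 \<le> \<bar>f x\<bar> * \<bar>g x\<bar>" by simp
    ultimately have "\<bar>f x * g x\<bar> \<le> (f x)\<^sup>2 + (g x)\<^sup>2" unfolding abs_mult by linarith
    then show "norm (f x * g x) \<le> norm ((f x)\<^sup>2 + (g x)\<^sup>2)" by simp
  qed
qed measurable

lemma square_integrable_add:
  fixes f g :: "'a \<Rightarrow> real"
  assumes [measurable]: "f \<in> borel_measurable M" "g \<in> borel_measurable M"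
    and sq: "integrable M (\<lambda>x. (f x)\<^sup>2)" "integrable M (\<lambda>x. (g x)\<^sup>2)"
  shows "integrable M (\<lambda>x. (f x + g x)\<^sup>2)"
  using product_integrable_of_squares[OF assms] sq by (simp add: power2_sum mult.assoc)

lemma square_integrable_diff:
  fixes f g :: "'a \<Rightarrow> real"
  assumes [measurable]: "f \<in> borel_measurable M" "g \<in> borel_measurable M"
    and sq: "integrable M (\<lambda>x. (f x)\<^sup>2)" "integrable M (\<lambda>x. (g x)\<^sup>2)"
  shows "integrable M (\<lambda>x. (f x - g x)\<^sup>2)"
  using product_integrable_of_squares[OF assms] sq by (simp add: power2_diff mult.assoc)

text \<open>Integrate \<open>2 |f g| \<le> c f^2 + g^2 / c\<close> with \<open>c = b / a\<close>.
  Since \<open>a\<close> or \<open>b\<close> may be 0, this is done for larger positive bounds,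
  which then shrink to \<open>a\<close> and \<open>b\<close>. Bounds in place of norms fit the
  influence estimates.\<close>

lemma Cauchy_Schwarz_integral:
  fixes f g :: "'a \<Rightarrow> real"
  assumes [measurable]: "f \<in> borel_measurable M" "g \<in> borel_measurable M"
    and sq: "integrable M (\<lambda>x. (f x)\<^sup>2)" "integrable M (\<lambda>x. (g x)\<^sup>2)"
    and a: "(\<integral>x. (f x)\<^sup>2 \<partial>M) \<le> a\<^sup>2" "0 \<le> a" and b: "(\<integral>x. (g x)\<^sup>2 \<partial>M) \<le> b\<^sup>2" "0 \<le> b"
  shows "\<bar>\<integral>x. f x * g x \<partial>M\<bar> \<le> a * b"
proof (rule field_le_epsilon)
  have fg: "integrable M (\<lambda>x. f x * g x)" by (rule product_integrable_of_squares[OF assms(1-4)])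
  have main: "\<bar>\<integral>x. f x * g x \<partial>M\<bar> \<le> a' * b'" if a': "a \<le> a'" "0 < a'" and b': "b \<le> b'" "0 < b'" for a' b'
  proof -
    let ?c = "b' / a'"
    have "2 * \<bar>\<integral>x. f x * g x \<partial>M\<bar> \<le> 2 * (\<integral>x. \<bar>f x * g x\<bar> \<partial>M)"
      using integral_abs_bound[of M "\<lambda>x. f x * g x"] by simp
    also have "\<dots> = (\<integral>x. 2 * \<bar>f x * g x\<bar> \<partial>M)" by simp
    also have "\<dots> \<le> (\<integral>x. ?c * (f x)\<^sup>2 + (g x)\<^sup>2 / ?c \<partial>M)"
    proof (rule integral_mono)
      fix x
      have "0 \<le> (?c * \<bar>f x\<bar> - \<bar>g x\<bar>)\<^sup>2 / ?c" using a' b' by simp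
      also have "\<dots> = ?c * (f x)\<^sup>2 + (g x)\<^sup>2 / ?c - 2 * \<bar>f x * g x\<bar>"
        using a' b' by (simp add: power2_diff abs_mult field_simps power2_eq_square)
      finally show "2 * \<bar>f x * g x\<bar> \<le> ?c * (f x)\<^sup>2 + (g x)\<^sup>2 / ?c" by simp
    qed (use sq fg in auto)
    also have "\<dots> = ?c * (\<integral>x. (f x)\<^sup>2 \<partial>M) + (\<integral>x. (g x)\<^sup>2 \<partial>M) / ?c"
      using sq by simp
    also have "\<dots> \<le> ?c * a'\<^sup>2 + b'\<^sup>2 / ?c"
      using a' b' order_trans[OF a(1) power_mono[OF a'(1) a(2), of 2]]
        order_trans[OF b(1) power_mono[OF b'(1) b(2), of 2]]
      by (intro add_mono mult_left_mono divide_right_mono) auto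
    also have "\<dots> = 2 * (a' * b')" using a' b' by (simp add: power2_eq_square field_simps)
    finally show ?thesis by simp
  qed
  fix e :: real assume "0 < e"
  have "((\<lambda>d. (a + d) * (b + d)) \<longlongrightarrow> (a + 0) * (b + 0)) (at_right 0)"
    by (intro tendsto_intros)
  then have "\<forall>\<^sub>F d in at_right 0. (a + d) * (b + d) < a * b + e"
    using \<open>0 < e\<close> by (intro order_tendstoD(2)) auto
  moreover have "\<forall>\<^sub>F d in at_right (0::real). 0 < d" by (simp add: eventually_at_right_less)
  ultimately have "\<forall>\<^sub>F d in at_right (0::real). \<bar>\<integral>x. f x * g x \<partial>M\<bar> \<le> a * b + e"
  proof eventually_elim
    case (elim d)
    then show ?case using main[of "a + d" "b + d"] a b by simp
  qed
  then show "\<bar>\<integral>x. f x * g x \<partial>M\<bar> \<le> a * b + e"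
    by (simp add: trivial_limit_at_right_real eventually_const)
qed

section \<open>Products of Bernoulli measures\<close>

definition bernoulli_field :: "('i \<Rightarrow> real) \<Rightarrow> ('i \<Rightarrow> bool) measure" where
  "bernoulli_field p = PiM UNIV (\<lambda>i. measure_pmf (bernoulli_pmf (p i)))"

lemma space_bernoulli_field [simp]: "space (bernoulli_field p) = UNIV"
  by (simp add: bernoulli_field_def space_PiM)

lemma prob_space_bernoulli_field: "prob_space (bernoulli_field p)"
  unfolding bernoulli_field_def by (intro prob_space_PiM measure_pmf.prob_space_axioms)

lemma measurable_bernoulli_field_coord [measurable]: "Measurable.pred (bernoulli_field p) (\<lambda>\<omega>. \<omega> i)"
proof -
  have "(\<lambda>\<omega>. \<omega> i) \<in> measurable (bernoulli_field p) (measure_pmf (bernoulli_pmf (p i)))"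
    unfolding bernoulli_field_def by (rule measurable_component_singleton) simp
  then show ?thesis by simp
qed

lemma measurable_bernoulli_fieldI:
  assumes "\<And>i. Measurable.pred N (\<lambda>x. f x i)"
  shows "f \<in> measurable N (bernoulli_field p)"
  unfolding bernoulli_field_def
  using assms by (intro measurable_PiM_single') auto

text \<open>An injective renaming of indices keeps independence and carries the marginals along. The
  time shift, the choice between two copies and the exchange of two copies in one row are all of
  this form.\<close>

lemma bernoulli_field_reindex:
  assumes "inj t" "q = p \<circ> t"
  shows "measure_preserving_map (bernoulli_field p) (bernoulli_field q) (\<lambda>\<omega> i. \<omega> (t i))"
  unfolding measure_preserving_map_def
proof
  show "(\<lambda>\<omega> i. \<omega> (t i)) \<in> measurable (bernoulli_field p) (bernoulli_field q)"
    by (rule measurable_bernoulli_fieldI) simp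
  show "distr (bernoulli_field p) (bernoulli_field q) (\<lambda>\<omega> i. \<omega> (t i)) = bernoulli_field q"
    using distr_PiM_reindex[of UNIV "\<lambda>i. measure_pmf (bernoulli_pmf (p i))" t UNIV] assms
    by (simp add: bernoulli_field_def measure_pmf.prob_space_axioms o_def restrict_UNIV)
qed

lemma bernoulli_field_coord_distr:
  "distr (bernoulli_field p) (measure_pmf (bernoulli_pmf (p i))) (\<lambda>\<omega>. \<omega> i) = measure_pmf (bernoulli_pmf (p i))"
  unfolding bernoulli_field_def
  using distr_PiM_component[of UNIV "\<lambda>i. measure_pmf (bernoulli_pmf (p i))" i]
  by (simp add: measure_pmf.prob_space_axioms)

lemma prob_bernoulli_field_coord:
  assumes "0 \<le> p i" "p i \<le> 1"
  shows "measure (bernoulli_field p) {\<omega>. \<omega> i} = p i"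
proof -
  have "measure (bernoulli_field p) {\<omega>. \<omega> i}
      = measure (distr (bernoulli_field p) (measure_pmf (bernoulli_pmf (p i))) (\<lambda>\<omega>. \<omega> i)) {True}"
    by (subst measure_distr) (auto simp: vimage_def)
  also have "\<dots> = p i"
    unfolding bernoulli_field_coord_distr using assms by (simp add: measure_pmf_single)
  finally show ?thesis .
qed

lemma bernoulli_field_indep_coords:
  "prob_space.indep_vars (bernoulli_field p) (\<lambda>i. measure_pmf (bernoulli_pmf (p i))) (\<lambda>i \<omega>. \<omega> i) UNIV"
proof -
  interpret prob_space "bernoulli_field p" by (rule prob_space_bernoulli_field)
  show ?thesis
  proof (subst indep_vars_iff_distr_eq_PiM')
    show "random_variable (measure_pmf (bernoulli_pmf (p i))) (\<lambda>\<omega>. \<omega> i)" for i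
      by (simp add: measurable_bernoulli_field_coord)
    have "distr (bernoulli_field p) (bernoulli_field p) (\<lambda>x. x) = bernoulli_field p" by simp
    then show "distr (bernoulli_field p) (\<Pi>\<^sub>M i\<in>UNIV. measure_pmf (bernoulli_pmf (p i))) (\<lambda>x. \<lambda>i\<in>UNIV. x i)
        = (\<Pi>\<^sub>M i\<in>UNIV. distr (bernoulli_field p) (measure_pmf (bernoulli_pmf (p i))) (\<lambda>\<omega>. \<omega> i))"
      by (simp add: bernoulli_field_coord_distr restrict_UNIV flip: bernoulli_field_def)
  qed simp
qed

text \<open>Dependence on a block is expressed as invariance under changes outside it, which is easy
  to check for functions of a random series; an explicit factorization through the block would not
  be.\<close>

lemma bernoulli_field_indep_blocks:
  assumes f: "\<And>l. l \<in> L \<Longrightarrow> f l \<in> measurable (bernoulli_field p) (N l)"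
    and dep: "\<And>l \<omega> \<omega>'. l \<in> L \<Longrightarrow> (\<And>i. i \<in> K l \<Longrightarrow> \<omega> i = \<omega>' i) \<Longrightarrow> f l \<omega> = f l \<omega>'"
    and K: "disjoint_family_on K L"
  shows "prob_space.indep_vars (bernoulli_field p) N f L"
proof -
  interpret prob_space "bernoulli_field p" by (rule prob_space_bernoulli_field)
  let ?M = "\<lambda>i. measure_pmf (bernoulli_pmf (p i))"
  \<comment> \<open>Coordinates outside the block are filled with the default \<open>False\<close>;
    by \<open>dep\<close> this does not change \<open>f l\<close>.\<close>
  let ?g = "\<lambda>l x i. if i \<in> K l then x i else False"
  have "indep_vars (\<lambda>l. PiM (K l) ?M) (\<lambda>l \<omega>. restrict (\<lambda>i. \<omega> i) (K l)) L"
    by (rule indep_vars_restrict[OF bernoulli_field_indep_coords]) (use K in auto)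
  then have "indep_vars N (\<lambda>l \<omega>. f l (?g l (restrict (\<lambda>i. \<omega> i) (K l)))) L"
  proof (rule indep_vars_compose2)
    fix l assume l: "l \<in> L"
    have "?g l \<in> measurable (PiM (K l) ?M) (bernoulli_field p)"
    proof (rule measurable_bernoulli_fieldI)
      fix i
      show "Measurable.pred (PiM (K l) ?M) (\<lambda>x. ?g l x i)"
      proof (cases "i \<in> K l")
        case True
        then have "(\<lambda>x. x i) \<in> measurable (PiM (K l) ?M) (?M i)" by (rule measurable_component_singleton)
        then show ?thesis using True by simp
      qed simp
    qed
    then show "(\<lambda>x. f l (?g l x)) \<in> measurable (PiM (K l) ?M) (N l)"
      using f[OF l] by (rule measurable_compose)
  qed
  moreover have "f l (?g l (restrict (\<lambda>i. \<omega> i) (K l))) = f l \<omega>" if "l \<in> L" for l \<omega>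
    by (rule dep[OF that]) simp
  ultimately show ?thesis by (simp cong: indep_vars_cong)
qed

lemma bernoulli_field_indep_pair:
  assumes "f \<in> measurable (bernoulli_field p) N" "g \<in> measurable (bernoulli_field p) N'"
    and "\<And>\<omega> \<omega>'. (\<And>i. i \<in> A \<Longrightarrow> \<omega> i = \<omega>' i) \<Longrightarrow> f \<omega> = f \<omega>'"
    and "\<And>\<omega> \<omega>'. (\<And>i. i \<in> B \<Longrightarrow> \<omega> i = \<omega>' i) \<Longrightarrow> g \<omega> = g \<omega>'"
    and "A \<inter> B = {}"
  shows "prob_space.indep_var (bernoulli_field p) N f N' g"
proof -
  interpret prob_space "bernoulli_field p" by (rule prob_space_bernoulli_field)
  have "indep_vars (case_bool N N') (case_bool f g) UNIV"
  proof (rule bernoulli_field_indep_blocks[where K = "case_bool A B"])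
    show "disjoint_family_on (case_bool A B) UNIV"
      using assms(5) by (auto simp: disjoint_family_on_def split: bool.splits)
    show "case_bool f g l \<in> measurable (bernoulli_field p) (case_bool N N' l)" for l
      using assms(1,2) by (cases l) simp_all
    show "case_bool f g l \<omega> = case_bool f g l \<omega>'"
      if "\<And>i. i \<in> case_bool A B l \<Longrightarrow> \<omega> i = \<omega>' i" for l \<omega> \<omega>'
      using assms(3,4)[of \<omega> \<omega>'] that by (cases l) simp_all
  qed
  then show ?thesis by (simp add: indep_var_def)
qed

section \<open>Covariances and mixing for row fields\<close>

text \<open>The other rows are silenced by \<open>False\<close> instead of being dropped, so the
  result is a point of the same space, at which every function of the field can be evaluated. The
  influence of row \<open>j\<close> on \<open>F\<close> is the L2 distance between \<open>F\<close>
  and \<open>F\<close> at \<open>keep (- {j})\<close>.\<close>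

definition keep :: "'r set \<Rightarrow> ('r \<times> 'k \<Rightarrow> bool) \<Rightarrow> 'r \<times> 'k \<Rightarrow> bool" where
  "keep A \<omega> = (\<lambda>(j, k). j \<in> A \<and> \<omega> (j, k))"

text \<open>The boolean component of the index separates two independent copies of a field: rows in
  \<open>J\<close> are read from copy \<open>True\<close>, all others from copy
  \<open>False\<close>. Thus \<open>mix {}\<close> and \<open>mix UNIV\<close> are the two copies
  themselves.\<close>

definition mix :: "'r set \<Rightarrow> (bool \<times> 'r \<times> 'k \<Rightarrow> bool) \<Rightarrow> 'r \<times> 'k \<Rightarrow> bool" where
  "mix J \<omega> = (\<lambda>(j, k). \<omega> (j \<in> J, j, k))"

abbreviation row_field :: "('k \<Rightarrow> real) \<Rightarrow> ('r \<times> 'k \<Rightarrow> bool) measure" where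
  "row_field p \<equiv> bernoulli_field (\<lambda>i. p (snd i))"

abbreviation double_field :: "('k \<Rightarrow> real) \<Rightarrow> (bool \<times> 'r \<times> 'k \<Rightarrow> bool) measure" where
  "double_field p \<equiv> bernoulli_field (\<lambda>i. p (snd (snd i)))"

lemma measurable_keep [measurable]: "keep A \<in> measurable (bernoulli_field p) (bernoulli_field q)"
  unfolding keep_def by (rule measurable_bernoulli_fieldI) (simp add: case_prod_beta)

lemma measure_preserving_mix: "measure_preserving_map (double_field p) (row_field p) (mix J)"
  using bernoulli_field_reindex[of "\<lambda>(j, k). (j \<in> J, j, k)" "\<lambda>i. p (snd i)" "\<lambda>i. p (snd (snd i))"]
  by (simp add: mix_def[abs_def] case_prod_beta' inj_def o_def)

lemma measurable_mix [measurable]: "mix J \<in> measurable (double_field p) (row_field p)"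
  by (rule measure_preserving_mapD(1)[OF measure_preserving_mix])

lemmas mix_integrable = measure_preserving_map_integrable[OF measure_preserving_mix]
lemmas mix_integral = measure_preserving_map_integral[OF measure_preserving_mix]

lemma keep_mix_insert: "keep (- {j}) (mix (insert j J) \<omega>) = keep (- {j}) (mix J \<omega>)"
  by (auto simp: keep_def mix_def fun_eq_iff)

text \<open>Resampling one row at a time: exchanging row \<open>j\<close> of the field with its independent copy
  swaps the two interpolations, so only the part of \<open>F\<close> that depends on row \<open>j\<close> contributes.\<close>
lemma interpolation_bound:
  fixes F G :: "('r \<times> 'k \<Rightarrow> bool) \<Rightarrow> real"
  assumes [measurable]: "F \<in> borel_measurable (row_field p)" "G \<in> borel_measurable (row_field p)"
    and F2: "integrable (row_field p) (\<lambda>\<omega>. (F \<omega>)\<^sup>2)" and G2: "integrable (row_field p) (\<lambda>\<omega>. (G \<omega>)\<^sup>2)"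
    and F_int: "\<And>j. integrable (row_field p) (\<lambda>\<omega>. (F \<omega> - F (keep (- {j}) \<omega>))\<^sup>2)"
    and F_inf: "\<And>j. (\<integral>\<omega>. (F \<omega> - F (keep (- {j}) \<omega>))\<^sup>2 \<partial>row_field p) \<le> (a j)\<^sup>2"
    and G_int: "\<And>j. integrable (row_field p) (\<lambda>\<omega>. (G \<omega> - G (keep (- {j}) \<omega>))\<^sup>2)"
    and G_inf: "\<And>j. (\<integral>\<omega>. (G \<omega> - G (keep (- {j}) \<omega>))\<^sup>2 \<partial>row_field p) \<le> (b j)\<^sup>2"
    and a: "\<And>j. 0 \<le> a j" and b: "\<And>j. 0 \<le> b j" and J: "finite J"
  shows "\<bar>(\<integral>\<omega>. F \<omega> * G \<omega> \<partial>row_field p) - (\<integral>\<omega>. F (mix {} \<omega>) * G (mix J \<omega>) \<partial>double_field p)\<bar>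
    \<le> 2 * (\<Sum>j\<in>J. a j * b j)"
  using J
proof (induction J rule: finite_induct)
  case empty
  have "(\<integral>\<omega>. F (mix {} \<omega>) * G (mix {} \<omega>) \<partial>double_field p) = (\<integral>\<omega>. F \<omega> * G \<omega> \<partial>row_field p)"
    by (rule measure_preserving_map_integral[OF measure_preserving_mix]) measurable
  then show ?case by simp
next
  case (insert j J)
  let ?P = "row_field p :: ('r \<times> 'k \<Rightarrow> bool) measure" and ?P2 = "double_field p :: (bool \<times> 'r \<times> 'k \<Rightarrow> bool) measure"
  let ?k = "keep (- {j}) :: ('r \<times> 'k \<Rightarrow> bool) \<Rightarrow> 'r \<times> 'k \<Rightarrow> bool"
  let ?J = "Set.insert j J"
  note tr = mix_integrable mix_integral
  have F'2: "integrable ?P2 (\<lambda>\<omega>. (F (mix I \<omega>))\<^sup>2)" for I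
    by (subst tr(1)[of "\<lambda>x. (F x)\<^sup>2"]) (use F2 in auto)
  have G'2: "integrable ?P2 (\<lambda>\<omega>. (G (mix I \<omega>))\<^sup>2)" for I
    by (subst tr(1)[of "\<lambda>x. (G x)\<^sup>2"]) (use G2 in auto)
  have Fd: "integrable ?P2 (\<lambda>\<omega>. (F (mix I \<omega>) - F (?k (mix I \<omega>)))\<^sup>2)"
    "(\<integral>\<omega>. (F (mix I \<omega>) - F (?k (mix I \<omega>)))\<^sup>2 \<partial>?P2) \<le> (a j)\<^sup>2" for I
    using F_int[of j] F_inf[of j] tr[of "\<lambda>x. (F x - F (?k x))\<^sup>2" p I] by auto
  have Gd: "integrable ?P2 (\<lambda>\<omega>. (G (mix I \<omega>) - G (?k (mix I \<omega>)))\<^sup>2)"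
    "(\<integral>\<omega>. (G (mix I \<omega>) - G (?k (mix I \<omega>)))\<^sup>2 \<partial>?P2) \<le> (b j)\<^sup>2" for I
    using G_int[of j] G_inf[of j] tr[of "\<lambda>x. (G x - G (?k x))\<^sup>2" p I] by auto
  define D where "D \<omega> = G (mix J \<omega>) - G (mix ?J \<omega>)" for \<omega>
  define H where "H \<omega> = F (?k (mix {} \<omega>))" for \<omega>
  have [measurable]: "D \<in> borel_measurable ?P2" "H \<in> borel_measurable ?P2"
    unfolding D_def H_def by measurable
  have D2: "integrable ?P2 (\<lambda>\<omega>. (D \<omega>)\<^sup>2)"
    unfolding D_def by (rule square_integrable_diff) (use G'2 in auto)
  have H2: "integrable ?P2 (\<lambda>\<omega>. (H \<omega>)\<^sup>2)"
  proof -
    have "integrable ?P2 (\<lambda>\<omega>. (F (mix {} \<omega>) - (F (mix {} \<omega>) - F (?k (mix {} \<omega>))))\<^sup>2)"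
      by (rule square_integrable_diff) (use F'2 Fd(1) in auto)
    then show ?thesis by (simp add: H_def)
  qed
  \<comment> \<open>With row \<open>j\<close> silenced both interpolations of \<open>G\<close>
    agree. Passing through this common value bounds the L2 norm of \<open>D\<close> by
    \<open>2 * b j\<close>, the origin of the factor 2 in the conclusion.\<close>
  have "(\<integral>\<omega>. (D \<omega>)\<^sup>2 \<partial>?P2) \<le> (\<integral>\<omega>. 2 * (G (mix J \<omega>) - G (?k (mix J \<omega>)))\<^sup>2
      + 2 * (G (mix ?J \<omega>) - G (?k (mix ?J \<omega>)))\<^sup>2 \<partial>?P2)"
  proof (rule integral_mono)
    fix \<omega>
    have "(x - y)\<^sup>2 \<le> 2 * (x - z)\<^sup>2 + 2 * (y - z)\<^sup>2" for x y z :: real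
    proof -
      have "0 \<le> ((x - z) + (y - z))\<^sup>2" by simp
      then show ?thesis by (simp add: power2_eq_square algebra_simps)
    qed
    then show "(D \<omega>)\<^sup>2 \<le> 2 * (G (mix J \<omega>) - G (?k (mix J \<omega>)))\<^sup>2 + 2 * (G (mix ?J \<omega>) - G (?k (mix ?J \<omega>)))\<^sup>2"
      unfolding D_def keep_mix_insert .
  qed (use D2 Gd(1) in auto)
  also have "\<dots> \<le> 2 * (b j)\<^sup>2 + 2 * (b j)\<^sup>2"
    using Gd(1) Gd(2)[of J] Gd(2)[of ?J] by simp
  finally have D_le: "(\<integral>\<omega>. (D \<omega>)\<^sup>2 \<partial>?P2) \<le> (2 * b j)\<^sup>2" by (simp add: power_mult_distrib)
  \<comment> \<open>This index map exchanges the copies in row \<open>j\<close> only. As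
    \<open>j\<close> is not in \<open>J\<close>, it turns \<open>D\<close> into \<open>- D\<close>
    and fixes \<open>H\<close>, so the mean of \<open>H * D\<close> equals its own negative.\<close>
  let ?s = "\<lambda>(c, i, k). (if i = j then \<not> c else c, i, k)"
  let ?swap = "\<lambda>(\<omega> :: bool \<times> 'r \<times> 'k \<Rightarrow> bool) i. \<omega> (?s i)"
  have swap: "measure_preserving_map ?P2 ?P2 ?swap"
    by (rule bernoulli_field_reindex) (auto simp: inj_def fun_eq_iff split: if_splits)
  have "mix J (?swap \<omega>) = mix ?J \<omega>" "mix ?J (?swap \<omega>) = mix J \<omega>"
    "?k (mix {} (?swap \<omega>)) = ?k (mix {} \<omega>)" for \<omega>
    using insert.hyps(2) by (auto simp: mix_def keep_def fun_eq_iff)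
  then have "H (?swap \<omega>) * D (?swap \<omega>) = - (H \<omega> * D \<omega>)" for \<omega>
    unfolding H_def D_def by (simp only:) (simp add: algebra_simps)
  moreover have "(\<integral>\<omega>. H (?swap \<omega>) * D (?swap \<omega>) \<partial>?P2) = (\<integral>\<omega>. H \<omega> * D \<omega> \<partial>?P2)"
    by (rule measure_preserving_map_integral[OF swap, of "\<lambda>\<omega>. H \<omega> * D \<omega>"]) measurable
  ultimately have HD: "(\<integral>\<omega>. H \<omega> * D \<omega> \<partial>?P2) = 0" by simp
  have "(\<integral>\<omega>. F (mix {} \<omega>) * G (mix J \<omega>) \<partial>?P2) - (\<integral>\<omega>. F (mix {} \<omega>) * G (mix ?J \<omega>) \<partial>?P2)
      = (\<integral>\<omega>. F (mix {} \<omega>) * D \<omega> \<partial>?P2)"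
    using product_integrable_of_squares[OF _ _ F'2 G'2, of "{}"]
    by (subst Bochner_Integration.integral_diff[symmetric]) (auto simp: D_def algebra_simps)
  also have "\<dots> = (\<integral>\<omega>. (F (mix {} \<omega>) - H \<omega>) * D \<omega> \<partial>?P2) + (\<integral>\<omega>. H \<omega> * D \<omega> \<partial>?P2)"
    by (subst Bochner_Integration.integral_add[symmetric])
      (auto intro!: product_integrable_of_squares square_integrable_diff simp: F'2 H2 D2 algebra_simps)
  also have "\<bar>\<dots>\<bar> \<le> a j * (2 * b j)"
    unfolding HD using Cauchy_Schwarz_integral[of "\<lambda>\<omega>. F (mix {} \<omega>) - H \<omega>" ?P2 D "a j" "2 * b j"]
      Fd[of "{}"] D2 D_le a[of j] b[of j] by (simp add: H_def)
  finally show ?case using insert.IH insert.hyps by simp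
qed

text \<open>The product mean is carried to that of an independent pair, since \<open>mix {}\<close>
  and \<open>mix UNIV\<close> read disjoint coordinates. Induction resamples finitely many rows
  only; \<open>dom\<close> and \<open>lim\<close> give the passage to all rows. The conclusion keeps
  finite sums and an error \<open>e\<close>, so that callers merely bound partial sums.\<close>

lemma covariance_bound:
  fixes F G :: "('r \<times> 'k \<Rightarrow> bool) \<Rightarrow> real"
  assumes [measurable]: "F \<in> borel_measurable (row_field p)" "G \<in> borel_measurable (row_field p)"
    and F2: "integrable (row_field p) (\<lambda>\<omega>. (F \<omega>)\<^sup>2)" and G2: "integrable (row_field p) (\<lambda>\<omega>. (G \<omega>)\<^sup>2)"
    and F_int: "\<And>j. integrable (row_field p) (\<lambda>\<omega>. (F \<omega> - F (keep (- {j}) \<omega>))\<^sup>2)"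
    and F_inf: "\<And>j. (\<integral>\<omega>. (F \<omega> - F (keep (- {j}) \<omega>))\<^sup>2 \<partial>row_field p) \<le> (a j)\<^sup>2"
    and G_int: "\<And>j. integrable (row_field p) (\<lambda>\<omega>. (G \<omega> - G (keep (- {j}) \<omega>))\<^sup>2)"
    and G_inf: "\<And>j. (\<integral>\<omega>. (G \<omega> - G (keep (- {j}) \<omega>))\<^sup>2 \<partial>row_field p) \<le> (b j)\<^sup>2"
    and a: "\<And>j. 0 \<le> a j" and b: "\<And>j. 0 \<le> b j"
    and J: "\<And>N :: nat. finite (J N)"
    and [measurable]: "D \<in> borel_measurable (row_field p)"
    and D2: "integrable (row_field p) (\<lambda>\<omega>. (D \<omega>)\<^sup>2)"
    and dom: "\<And>N. AE \<omega> in double_field p. \<bar>G (mix (J N) \<omega>)\<bar> \<le> D (mix {} \<omega>) + D (mix UNIV \<omega>)"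
    and lim: "AE \<omega> in double_field p. (\<lambda>N. G (mix (J N) \<omega>)) \<longlonglongrightarrow> G (mix UNIV \<omega>)"
    and e: "0 < e"
  shows "\<forall>\<^sub>F N in sequentially. \<bar>Cov (row_field p) F G\<bar> \<le> 2 * (\<Sum>j\<in>J N. a j * b j) + e"
proof -
  let ?P = "row_field p :: ('r \<times> 'k \<Rightarrow> bool) measure" and ?P2 = "double_field p :: (bool \<times> 'r \<times> 'k \<Rightarrow> bool) measure"
  interpret P: prob_space ?P by (rule prob_space_bernoulli_field)
  interpret P2: prob_space ?P2 by (rule prob_space_bernoulli_field)
  note tr = mix_integrable mix_integral
  have F1: "integrable ?P F" and G1: "integrable ?P G"
    by (rule P.square_integrable_imp_integrable[OF _ F2] P.square_integrable_imp_integrable[OF _ G2]; simp)+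
  have "P2.indep_var borel (\<lambda>\<omega>. F (mix {} \<omega>)) borel (\<lambda>\<omega>. G (mix UNIV \<omega>))"
  proof (rule bernoulli_field_indep_pair)
    show "F (mix {} \<omega>) = F (mix {} \<omega>')" if "\<And>i. i \<in> {False} \<times> UNIV \<Longrightarrow> \<omega> i = \<omega>' i" for \<omega> \<omega>'
      using that by (intro arg_cong[of _ _ F]) (auto simp: mix_def)
    show "G (mix UNIV \<omega>) = G (mix UNIV \<omega>')" if "\<And>i. i \<in> {True} \<times> UNIV \<Longrightarrow> \<omega> i = \<omega>' i" for \<omega> \<omega>'
      using that by (intro arg_cong[of _ _ G]) (auto simp: mix_def)
  qed auto
  then have ind: "(\<integral>\<omega>. F (mix {} \<omega>) * G (mix UNIV \<omega>) \<partial>?P2) = integral\<^sup>L ?P F * integral\<^sup>L ?P G"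
    using P2.indep_var_lebesgue_integral[of "\<lambda>\<omega>. F (mix {} \<omega>)" "\<lambda>\<omega>. G (mix UNIV \<omega>)"] F1 G1
    by (simp add: tr)
  have "(\<lambda>N. \<integral>\<omega>. F (mix {} \<omega>) * G (mix (J N) \<omega>) \<partial>?P2) \<longlonglongrightarrow> (\<integral>\<omega>. F (mix {} \<omega>) * G (mix UNIV \<omega>) \<partial>?P2)"
  proof (rule integral_dominated_convergence[where w = "\<lambda>\<omega>. \<bar>F (mix {} \<omega>) * (D (mix {} \<omega>) + D (mix UNIV \<omega>))\<bar>"])
    have "integrable ?P2 (\<lambda>\<omega>. F (mix {} \<omega>) * (D (mix {} \<omega>) + D (mix UNIV \<omega>)))"
      using F2 D2 tr(1)[of "\<lambda>x. (F x)\<^sup>2"] tr(1)[of "\<lambda>x. (D x)\<^sup>2"]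
      by (intro product_integrable_of_squares square_integrable_add) auto
    then show "integrable ?P2 (\<lambda>\<omega>. \<bar>F (mix {} \<omega>) * (D (mix {} \<omega>) + D (mix UNIV \<omega>))\<bar>)" by simp
    show "AE \<omega> in ?P2. (\<lambda>N. F (mix {} \<omega>) * G (mix (J N) \<omega>)) \<longlonglongrightarrow> F (mix {} \<omega>) * G (mix UNIV \<omega>)"
      using lim by eventually_elim (rule tendsto_mult_left)
    show "AE \<omega> in ?P2. norm (F (mix {} \<omega>) * G (mix (J N) \<omega>)) \<le> \<bar>F (mix {} \<omega>) * (D (mix {} \<omega>) + D (mix UNIV \<omega>))\<bar>" for N
      using dom[of N] by eventually_elim (auto simp: abs_mult intro!: mult_left_mono)
  qed measurable
  then have "(\<lambda>N. \<integral>\<omega>. F (mix {} \<omega>) * G (mix (J N) \<omega>) \<partial>?P2) \<longlonglongrightarrow> integral\<^sup>L ?P F * integral\<^sup>L ?P G"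
    by (simp only: ind)
  from tendstoD[OF this e] show ?thesis
  proof eventually_elim
    case (elim N)
    with interpolation_bound[OF assms(1-10) J[of N]] show ?case
      by (simp add: Cov_def dist_real_def)
  qed
qed

section \<open>Mixing tested on a generator\<close>

lemma convergence_on_generator:
  fixes m :: "nat \<Rightarrow> 'a set \<Rightarrow> real"
  assumes "prob_space M" and G: "Int_stable G" "G \<subseteq> Pow (space M)" "sets M = sigma_sets (space M) G"
    and m_nonneg: "\<And>n X. X \<in> sets M \<Longrightarrow> 0 \<le> m n X"
    and m_le: "\<And>n X. X \<in> sets M \<Longrightarrow> m n X \<le> measure M X"
    and m_sums: "\<And>n X. disjoint_family X \<Longrightarrow> range X \<subseteq> sets M \<Longrightarrow> (\<lambda>i :: nat. m n (X i)) sums m n (\<Union>i. X i)"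
    and m_compl: "\<And>n X. X \<in> sets M \<Longrightarrow> m n (space M - X) = m n (space M) - m n X"
    and m_space: "(\<lambda>n. m n (space M)) \<longlonglongrightarrow> c"
    and base: "\<And>X. X \<in> G \<Longrightarrow> (\<lambda>n. m n X) \<longlonglongrightarrow> c * measure M X"
    and X: "X \<in> sets M"
  shows "(\<lambda>n. m n X) \<longlonglongrightarrow> c * measure M X"
proof -
  interpret prob_space M by fact
  from X have "X \<in> sigma_sets (space M) G" by (simp add: G)
  with G(1,2) show ?thesis
  proof (induction X rule: sigma_sets_induct_disjoint)
    case (basic A)
    then show ?case by (rule base)
  next
    case empty
    have "m n {} = 0" for n using m_nonneg[of "{}" n] m_le[of "{}" n] by simp
    then show ?case by simp
  next
    case (compl A)
    then have A: "A \<in> sets M" by (simp add: G)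
    have "(\<lambda>n. m n (space M) - m n A) \<longlonglongrightarrow> c - c * measure M A"
      by (intro tendsto_diff m_space compl)
    then show ?case using A by (simp add: m_compl prob_compl right_diff_distrib)
  next
    case (union A)
    then have A: "range A \<subseteq> sets M" by (simp add: G)
    have s: "(\<lambda>i. measure M (A i)) sums measure M (\<Union>i. A i)"
      by (rule finite_measure_UNION[OF A union(1)])
    \<comment> \<open>Exchanging the limit with the countable sum is Tannery's theorem with majorant
      \<open>measure M (A i)\<close>; this is the purpose of the domination of \<open>m n\<close> by
      \<open>M\<close>.\<close>
    have "(\<lambda>n. \<Sum>i. m n (A i)) \<longlonglongrightarrow> (\<Sum>i. c * measure M (A i))"
    proof (rule tannerys_theorem[THEN conjunct2, THEN conjunct2])
      show "((\<lambda>n. m n (A i)) \<longlonglongrightarrow> c * measure M (A i))" for i by (rule union(3))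
      show "\<forall>\<^sub>F (k, n) in at_top \<times>\<^sub>F sequentially. norm (m n (A k)) \<le> measure M (A k)"
        using A m_le m_nonneg by (intro always_eventually) (auto simp: subset_eq)
      show "summable (\<lambda>i. measure M (A i))" using s by (rule sums_summable)
    qed simp
    moreover have "(\<Sum>i. m n (A i)) = m n (\<Union>i. A i)" for n
      using m_sums[OF union(1) A] by (simp add: sums_iff)
    moreover have "(\<Sum>i. c * measure M (A i)) = c * measure M (\<Union>i. A i)"
      using sums_mult[OF s, of c] by (simp add: sums_iff)
    ultimately show ?case by simp
  qed
qed

text \<open>One set is generalized at a time. First \<open>B\<close> stays in the generator and the
  other set is arbitrary, with limiting total mass \<open>measure M B\<close>. Then \<open>A\<close>
  is fixed and arbitrary, and the preimages of \<open>Y\<close> are dominated by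
  \<open>measure M Y\<close> because \<open>\<tau> n\<close> preserves \<open>M\<close>.\<close>

lemma mixing_on_generator:
  assumes "prob_space M" and G: "Int_stable G" "G \<subseteq> Pow (space M)" "sets M = sigma_sets (space M) G"
    and \<tau>: "\<And>n :: nat. measure_preserving_map M M (\<tau> n)"
    and base: "\<And>A B. A \<in> G \<Longrightarrow> B \<in> G \<Longrightarrow>
      (\<lambda>n. measure M (A \<inter> (\<tau> n -` B \<inter> space M))) \<longlonglongrightarrow> measure M A * measure M B"
    and A: "A \<in> sets M" and B: "B \<in> sets M"
  shows "(\<lambda>n. measure M (A \<inter> (\<tau> n -` B \<inter> space M))) \<longlonglongrightarrow> measure M A * measure M B"
proof -
  interpret prob_space M by fact
  have [measurable]: "\<tau> n \<in> measurable M M" for n by (rule measure_preserving_mapD(1)[OF \<tau>])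
  have mp: "measure M (\<tau> n -` X \<inter> space M) = measure M X" if "X \<in> sets M" for n X
    by (rule measure_preserving_map_measure[OF \<tau> that])
  have disj: "(\<lambda>i. measure M (X i)) sums measure M (\<Union>i. X i)"
    if "disjoint_family X" "\<And>i :: nat. X i \<in> sets M" for X
    using that by (intro finite_measure_UNION) auto
  have step1: "(\<lambda>n. measure M (X \<inter> (\<tau> n -` B \<inter> space M))) \<longlonglongrightarrow> measure M B * measure M X"
    if B: "B \<in> G" and X: "X \<in> sets M" for X B
  proof (rule convergence_on_generator[where G = G])
    have [measurable]: "B \<in> sets M" using B G(3) by auto
    show "measure M (Y \<inter> (\<tau> n -` B \<inter> space M)) \<le> measure M Y" if "Y \<in> sets M" for Y n
      using that by (intro finite_measure_mono) auto
    show "(\<lambda>i. measure M (Y i \<inter> (\<tau> n -` B \<inter> space M))) sums measure M ((\<Union>i. Y i) \<inter> (\<tau> n -` B \<inter> space M))"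
      if "disjoint_family Y" "range Y \<subseteq> sets M" for Y :: "nat \<Rightarrow> _" and n
      using disj[of "\<lambda>i. Y i \<inter> (\<tau> n -` B \<inter> space M)"] that
      by (auto simp: disjoint_family_on_def Int_UN_distrib2 subset_eq)
    show "measure M ((space M - Y) \<inter> (\<tau> n -` B \<inter> space M))
        = measure M (space M \<inter> (\<tau> n -` B \<inter> space M)) - measure M (Y \<inter> (\<tau> n -` B \<inter> space M))"
      if [measurable]: "Y \<in> sets M" for Y n
      by (subst finite_measure_Diff[symmetric]) (auto intro!: arg_cong[of _ _ "measure M"])
    show "(\<lambda>n. measure M (space M \<inter> (\<tau> n -` B \<inter> space M))) \<longlonglongrightarrow> measure M B"
      by (simp add: mp Int_absorb1)
    show "(\<lambda>n. measure M (Y \<inter> (\<tau> n -` B \<inter> space M))) \<longlonglongrightarrow> measure M B * measure M Y" if "Y \<in> G" for Y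
      using base[OF that B] by (simp add: mult.commute)
  qed (use X G assms(1) in auto)
  show ?thesis
  proof (rule convergence_on_generator[where G = G])
    note [measurable] = A
    show "measure M (A \<inter> (\<tau> n -` Y \<inter> space M)) \<le> measure M Y" if [measurable]: "Y \<in> sets M" for Y n
    proof -
      have "measure M (A \<inter> (\<tau> n -` Y \<inter> space M)) \<le> measure M (\<tau> n -` Y \<inter> space M)"
        by (intro finite_measure_mono) auto
      then show ?thesis by (simp add: mp)
    qed
    show "(\<lambda>i. measure M (A \<inter> (\<tau> n -` Y i \<inter> space M))) sums measure M (A \<inter> (\<tau> n -` (\<Union>i. Y i) \<inter> space M))"
      if Y: "disjoint_family Y" "range Y \<subseteq> sets M" for Y :: "nat \<Rightarrow> _" and n
    proof -
      have "(\<lambda>i. measure M (A \<inter> (\<tau> n -` Y i \<inter> space M))) sums measure M (\<Union>i. A \<inter> (\<tau> n -` Y i \<inter> space M))"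
      proof (rule disj)
        show "disjoint_family (\<lambda>i. A \<inter> (\<tau> n -` Y i \<inter> space M))"
          using Y(1) by (auto simp: disjoint_family_on_def)
        have [measurable]: "Y i \<in> sets M" for i using Y(2) by auto
        show "A \<inter> (\<tau> n -` Y i \<inter> space M) \<in> sets M" for i by measurable
      qed
      moreover have "(\<Union>i. A \<inter> (\<tau> n -` Y i \<inter> space M)) = A \<inter> (\<tau> n -` (\<Union>i. Y i) \<inter> space M)" by auto
      ultimately show ?thesis by simp
    qed
    show "measure M (A \<inter> (\<tau> n -` (space M - Y) \<inter> space M))
        = measure M (A \<inter> (\<tau> n -` space M \<inter> space M)) - measure M (A \<inter> (\<tau> n -` Y \<inter> space M))"
      if [measurable]: "Y \<in> sets M" for Y n
    proof (subst finite_measure_Diff[symmetric])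
      show "measure M (A \<inter> (\<tau> n -` (space M - Y) \<inter> space M))
        = measure M (A \<inter> (\<tau> n -` space M \<inter> space M) - A \<inter> (\<tau> n -` Y \<inter> space M))"
        by (intro arg_cong[of _ _ "measure M"]) auto
    qed (use sets.sets_into_space[OF that] in auto)
    have "A \<inter> (\<tau> n -` space M \<inter> space M) = A" for n
      using measurable_space[of "\<tau> n" M M] sets.sets_into_space[OF A] by auto
    then show "(\<lambda>n. measure M (A \<inter> (\<tau> n -` space M \<inter> space M))) \<longlonglongrightarrow> measure M A" by simp
    show "(\<lambda>n. measure M (A \<inter> (\<tau> n -` Y \<inter> space M))) \<longlonglongrightarrow> measure M A * measure M Y" if "Y \<in> G" for Y
      using step1[OF that A] by (simp add: mult.commute)
  qed (use B G assms(1) in auto)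
qed

text \<open>\<open>shift n\<close> moves the content of row \<open>j\<close> to row
  \<open>j - n\<close>; for \<open>n = 1\<close> this is the direction in which \<open>T\<close>
  moves the vectors \<open>Y (j, k)\<close>.\<close>

definition shift :: "int \<Rightarrow> (int \<times> 'k \<Rightarrow> bool) \<Rightarrow> int \<times> 'k \<Rightarrow> bool" where
  "shift n \<omega> = (\<lambda>(j, k). \<omega> (j + n, k))"

lemma measure_preserving_shift: "measure_preserving_map (row_field p) (row_field p) (shift n)"
  using bernoulli_field_reindex[of "\<lambda>(j, k). (j + n, k)" "\<lambda>i. p (snd i)" "\<lambda>i. p (snd i)"]
  by (simp add: shift_def[abs_def] case_prod_beta' inj_def o_def)

lemma measurable_shift [measurable]: "shift n \<in> measurable (row_field p) (row_field p)"
  by (rule measure_preserving_mapD(1)[OF measure_preserving_shift])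

lemmas shift_integrable = measure_preserving_map_integrable[OF measure_preserving_shift]
lemmas shift_integral = measure_preserving_map_integral[OF measure_preserving_shift]

lemma shift_shift: "shift m (shift n \<omega>) = shift (m + n) \<omega>"
  by (simp add: shift_def fun_eq_iff ac_simps)

lemma shift_mixing:
  fixes A B :: "(int \<times> 'k \<Rightarrow> bool) set"
  assumes "A \<in> sets (row_field p)" "B \<in> sets (row_field p)"
  shows "(\<lambda>n. measure (row_field p) (A \<inter> (shift (int n) -` B)))
    \<longlonglongrightarrow> measure (row_field p) A * measure (row_field p) B"
proof -
  let ?P = "row_field p :: (int \<times> 'k \<Rightarrow> bool) measure"
  let ?M = "\<lambda>i :: int \<times> 'k. measure_pmf (bernoulli_pmf (p (snd i)))"
  interpret P: prob_space ?P by (rule prob_space_bernoulli_field)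
  have "(\<lambda>n. measure ?P (A \<inter> (shift (int n) -` B \<inter> space ?P))) \<longlonglongrightarrow> measure ?P A * measure ?P B"
  proof (rule mixing_on_generator[where G = "prod_algebra UNIV ?M"])
    show "prob_space ?P" by (rule prob_space_bernoulli_field)
    show "Int_stable (prod_algebra UNIV ?M)" by (rule Int_stable_prod_algebra)
    show "prod_algebra UNIV ?M \<subseteq> Pow (space ?P)" by simp
    show "sets ?P = sigma_sets (space ?P) (prod_algebra UNIV ?M)"
      by (simp add: bernoulli_field_def sets_PiM space_PiM)
    fix A B assume AB: "A \<in> prod_algebra UNIV ?M" "B \<in> prod_algebra UNIV ?M"
    have sets: "X \<in> sets ?P" if "X \<in> prod_algebra UNIV ?M" for X
      using that by (simp add: bernoulli_field_def sets_PiM sigma_sets.Basic)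
    obtain I E where A: "A = prod_emb UNIV ?M I (Pi\<^sub>E I E)" "finite I"
      using AB(1) by (rule prod_algebraE)
    obtain J E' where B: "B = prod_emb UNIV ?M J (Pi\<^sub>E J E')" "finite J"
      using AB(2) by (rule prod_algebraE)
    have A': "\<omega> \<in> A \<longleftrightarrow> (\<forall>i\<in>I. \<omega> i \<in> E i)" for \<omega>
      by (auto simp: A prod_emb_def PiE_iff)
    have B': "\<omega> \<in> B \<longleftrightarrow> (\<forall>i\<in>J. \<omega> i \<in> E' i)" for \<omega>
      by (auto simp: B prod_emb_def PiE_iff)
    \<comment> \<open>All coordinates of both cylinders lie in rows at distance at most
      \<open>K\<close> from 0; a shift by more than \<open>2 * K\<close> makes the two coordinate
      sets disjoint.\<close>
    define K where "K = Max ((\<lambda>i. \<bar>fst i\<bar>) ` (I \<union> J))"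
    have K: "\<bar>fst i\<bar> \<le> K" if "i \<in> I \<union> J" for i
      unfolding K_def using A(2) B(2) that by (intro Max_ge) auto
    have "measure ?P (A \<inter> (shift (int n) -` B)) = measure ?P A * measure ?P B" if n: "n > nat (2 * K)" for n
    proof -
      have "P.indep_var (count_space UNIV) (\<lambda>\<omega>. \<omega> \<in> A) (count_space UNIV) (\<lambda>\<omega>. shift (int n) \<omega> \<in> B)"
      proof (rule bernoulli_field_indep_pair)
        show "Measurable.pred ?P (\<lambda>\<omega>. \<omega> \<in> A)" using sets[OF AB(1)] by measurable
        show "Measurable.pred ?P (\<lambda>\<omega>. shift (int n) \<omega> \<in> B)" using sets[OF AB(2)] by measurable
        show "(\<omega> \<in> A) = (\<omega>' \<in> A)" if "\<And>i. i \<in> I \<Longrightarrow> \<omega> i = \<omega>' i" for \<omega> \<omega>'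
          using that by (simp add: A')
        show "(shift (int n) \<omega> \<in> B) = (shift (int n) \<omega>' \<in> B)"
          if "\<And>i. i \<in> (\<lambda>(j, k). (j + int n, k)) ` J \<Longrightarrow> \<omega> i = \<omega>' i" for \<omega> \<omega>'
          unfolding B' shift_def using that by (intro ball_cong refl) (force split: prod.splits)
        show "I \<inter> (\<lambda>(j, k). (j + int n, k)) ` J = {}"
        proof (rule equals0I, clarify)
          fix j k assume "(j + int n, k) \<in> I" "(j, k) \<in> J"
          then have "\<bar>j + int n\<bar> \<le> K" "\<bar>j\<bar> \<le> K" using K by force+
          then show False using n by linarith
        qed
      qed
      from P.indep_varD[OF this, of "{True}" "{True}"]
      have "measure ?P (A \<inter> (shift (int n) -` B)) = measure ?P A * measure ?P (shift (int n) -` B)"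
        by (simp add: vimage_def Int_def)
      then show ?thesis
        using measure_preserving_map_measure[OF measure_preserving_shift sets[OF AB(2)]] by simp
    qed
    then have "\<forall>\<^sub>F n in sequentially. measure ?P (A \<inter> (shift (int n) -` B \<inter> space ?P)) = measure ?P A * measure ?P B"
      by (intro eventually_sequentiallyI[of "Suc (nat (2 * K))"]) auto
    then show "(\<lambda>n. measure ?P (A \<inter> (shift (int n) -` B \<inter> space ?P))) \<longlonglongrightarrow> measure ?P A * measure ?P B"
      by (rule tendsto_eventually)
  qed (use assms measure_preserving_shift in auto)
  then show ?thesis by simp
qed

section \<open>A central limit theorem for row fields\<close>

lemma norm_iexp_diff_le: "norm (iexp x - iexp y) \<le> \<bar>x - y\<bar>"
proof -
  have "iexp x - iexp y = iexp y * (iexp (x - y) - 1)"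
    by (simp add: algebra_simps flip: exp_add)
  then have "norm (iexp x - iexp y) = norm (iexp (x - y) - 1)"
    by (simp add: norm_mult)
  also have "\<dots> \<le> \<bar>x - y\<bar>" using iexp_approx1[of "x - y" 0] by simp
  finally show ?thesis .
qed

lemma char_distr_scale:
  assumes "f \<in> borel_measurable M"
  shows "char (distr M borel (\<lambda>x. c * f x)) t = char (distr M borel f) (c * t)"
  using assms by (simp add: char_def integral_distr mult.assoc mult.left_commute)

lemma char_scaled_std_normal:
  "char (distr std_normal_distribution borel (\<lambda>t. \<sigma> * t)) t = complex_of_real (exp (- (\<sigma> * t)\<^sup>2 / 2))"
proof -
  have "char (distr std_normal_distribution borel (\<lambda>t. \<sigma> * t)) t
      = char (distr std_normal_distribution borel (\<lambda>t. t)) (\<sigma> * t)"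
    by (rule char_distr_scale) simp
  also have "distr std_normal_distribution borel (\<lambda>t. t) = std_normal_distribution"
    by (rule distr_id2) simp
  finally show ?thesis by (simp add: char_std_normal_distribution)
qed

text \<open>Characteristic functions are Lipschitz in L1, and on a probability space L1 is dominated
  by L2; so approximations only have to be good in L2.\<close>

lemma char_distr_diff_le:
  assumes "prob_space M" and [measurable]: "X \<in> borel_measurable M" "W \<in> borel_measurable M"
    and int: "integrable M (\<lambda>x. (X x - W x)\<^sup>2)" and le: "(\<integral>x. (X x - W x)\<^sup>2 \<partial>M) \<le> e\<^sup>2" and e: "0 \<le> e"
  shows "norm (char (distr M borel X) t - char (distr M borel W) t) \<le> \<bar>t\<bar> * e"
proof -
  interpret prob_space M by fact
  have i: "integrable M (\<lambda>x. iexp (t * f x))" if "f \<in> borel_measurable M" for f :: "_ \<Rightarrow> real"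
    by (rule integrable_iexp) (use that in auto)
  have d: "integrable M (\<lambda>x. X x - W x)"
    by (rule square_integrable_imp_integrable) (use int in auto)
  have "char (distr M borel X) t - char (distr M borel W) t = (\<integral>x. iexp (t * X x) - iexp (t * W x) \<partial>M)"
    by (subst Bochner_Integration.integral_diff) (auto simp: i char_def integral_distr simp del: of_real_mult)
  also have "norm \<dots> \<le> (\<integral>x. norm (iexp (t * X x) - iexp (t * W x)) \<partial>M)"
    by (rule integral_norm_bound)
  also have "\<dots> \<le> (\<integral>x. \<bar>t\<bar> * \<bar>X x - W x\<bar> \<partial>M)"
  proof (rule integral_mono)
    show "norm (iexp (t * X x) - iexp (t * W x)) \<le> \<bar>t\<bar> * \<bar>X x - W x\<bar>" for x
      using norm_iexp_diff_le[of "t * X x" "t * W x"] by (simp add: abs_mult flip: right_diff_distrib)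
    show "integrable M (\<lambda>x. norm (iexp (t * X x) - iexp (t * W x)))"
      by (intro integrable_norm Bochner_Integration.integrable_diff i) auto
  qed (use d in auto)
  also have "\<dots> = \<bar>t\<bar> * (\<integral>x. \<bar>X x - W x\<bar> * 1 \<partial>M)" by simp
  also have "(\<integral>x. \<bar>X x - W x\<bar> * 1 \<partial>M) \<le> e"
    using Cauchy_Schwarz_integral[of "\<lambda>x. \<bar>X x - W x\<bar>" M "\<lambda>_. 1" e 1] int le e by (simp add: prob_space)
  finally show ?thesis by (simp add: mult_left_mono)
qed

text \<open>The limiting deviation is found by compactness: the deviations \<open>s\<close> of the
  approximations lie in \<open>{0..K}\<close>, and a cluster point serves as \<sigma>. Convergence
  of the full sequence follows because each approximation is close to \<open>X n\<close> for all
  large \<open>n\<close>.\<close>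

lemma weak_conv_normal_of_approximations:
  fixes X :: "nat \<Rightarrow> 'a \<Rightarrow> real"
  assumes "prob_space M" and [measurable]: "\<And>n. X n \<in> borel_measurable M"
    and approx: "\<And>e. 0 < e \<Longrightarrow> \<exists>W s. 0 \<le> s \<and> s \<le> K \<and> (\<forall>n. W n \<in> borel_measurable M) \<and>
      (\<forall>t. (\<lambda>n. char (distr M borel (W n)) t) \<longlonglongrightarrow> complex_of_real (exp (- (s * t)\<^sup>2 / 2))) \<and>
      (\<forall>\<^sub>F n in sequentially. integrable M (\<lambda>x. (X n x - W n x)\<^sup>2) \<and> (\<integral>x. (X n x - W n x)\<^sup>2 \<partial>M) \<le> e\<^sup>2)"
  shows "\<exists>\<sigma>\<ge>0. weak_conv_m (\<lambda>n. distr M borel (X n)) (distr std_normal_distribution borel (\<lambda>t. \<sigma> * t))"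
proof -
  interpret prob_space M by fact
  have "\<forall>i :: nat. \<exists>W s. 0 \<le> s \<and> s \<le> K \<and> (\<forall>n. W n \<in> borel_measurable M) \<and>
      (\<forall>t. (\<lambda>n. char (distr M borel (W n)) t) \<longlonglongrightarrow> complex_of_real (exp (- (s * t)\<^sup>2 / 2))) \<and>
      (\<forall>\<^sub>F n in sequentially. integrable M (\<lambda>x. (X n x - W n x)\<^sup>2) \<and> (\<integral>x. (X n x - W n x)\<^sup>2 \<partial>M) \<le> (1 / Suc i)\<^sup>2)"
    by (intro allI approx) simp
  from choice[OF this] obtain W where "\<forall>i. \<exists>s. 0 \<le> s \<and> s \<le> K \<and> (\<forall>n. W i n \<in> borel_measurable M) \<and>
      (\<forall>t. (\<lambda>n. char (distr M borel (W i n)) t) \<longlonglongrightarrow> complex_of_real (exp (- (s * t)\<^sup>2 / 2))) \<and>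
      (\<forall>\<^sub>F n in sequentially. integrable M (\<lambda>x. (X n x - W i n x)\<^sup>2) \<and> (\<integral>x. (X n x - W i n x)\<^sup>2 \<partial>M) \<le> (1 / Suc i)\<^sup>2)" ..
  from choice[OF this] obtain s where s: "\<And>i. 0 \<le> s i" "\<And>i. s i \<le> K"
    and [measurable]: "\<And>i n. W i n \<in> borel_measurable M"
    and lim: "\<And>i t. (\<lambda>n. char (distr M borel (W i n)) t) \<longlonglongrightarrow> complex_of_real (exp (- (s i * t)\<^sup>2 / 2))"
    and near: "\<And>i. \<forall>\<^sub>F n in sequentially. integrable M (\<lambda>x. (X n x - W i n x)\<^sup>2) \<and>
      (\<integral>x. (X n x - W i n x)\<^sup>2 \<partial>M) \<le> (1 / Suc i)\<^sup>2"
    by auto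
  have "\<forall>i. s i \<in> {0..K}" using s by auto
  with compact_Icc[of 0 K] obtain \<sigma> r where \<sigma>: "\<sigma> \<in> {0..K}" and r: "strict_mono r" "(s \<circ> r) \<longlonglongrightarrow> \<sigma>"
    unfolding compact_def by blast
  have "weak_conv_m (\<lambda>n. distr M borel (X n)) (distr std_normal_distribution borel (\<lambda>t. \<sigma> * t))"
  proof (rule levy_continuity)
    show "real_distribution (distr M borel (X n))" for n by (rule real_distribution_distr) simp
    interpret N: prob_space std_normal_distribution
      using real_dist_normal_dist by (simp add: real_distribution_def)
    show "real_distribution (distr std_normal_distribution borel (\<lambda>t. \<sigma> * t))"
      by (rule N.real_distribution_distr) simp
    fix t
    let ?\<phi> = "\<lambda>s. complex_of_real (exp (- (s * t)\<^sup>2 / 2))"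
    show "(\<lambda>n. char (distr M borel (X n)) t) \<longlonglongrightarrow> char (distr std_normal_distribution borel (\<lambda>t. \<sigma> * t)) t"
      unfolding char_scaled_std_normal
    proof (rule tendstoI)
      fix \<epsilon> :: real assume "0 < \<epsilon>"
      then have e3: "0 < \<epsilon> / 3" by simp
      have "(\<lambda>i. ?\<phi> ((s \<circ> r) i)) \<longlonglongrightarrow> ?\<phi> \<sigma>"
        using r(2) by (intro tendsto_intros) (auto simp: o_def)
      then have ev1: "\<forall>\<^sub>F i in sequentially. dist (?\<phi> (s (r i))) (?\<phi> \<sigma>) < \<epsilon> / 3"
        using tendstoD[OF _ e3] by fastforce
      have "(\<lambda>i. \<bar>t\<bar> * (1 / real (Suc i))) \<longlonglongrightarrow> \<bar>t\<bar> * 0"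
        by (intro tendsto_intros LIMSEQ_Suc[OF lim_1_over_n])
      then have "\<forall>\<^sub>F i in sequentially. \<bar>t\<bar> * (1 / real (Suc i)) < \<epsilon> / 3"
        using e3 by (intro order_tendstoD(2)) auto
      then have ev2: "\<forall>\<^sub>F i in sequentially. \<bar>t\<bar> * (1 / real (Suc (r i))) < \<epsilon> / 3"
        using eventually_compose_filterlim[OF _ filterlim_subseq[OF r(1)]] by fast
      \<comment> \<open>The approximation is fixed before \<open>n\<close>: its deviation is close
        to \<sigma>, and its L2 error is small for all large \<open>n\<close>.\<close>
      obtain i where i: "dist (?\<phi> (s (r i))) (?\<phi> \<sigma>) < \<epsilon> / 3" "\<bar>t\<bar> * (1 / real (Suc (r i))) < \<epsilon> / 3"
        using eventually_happens[OF eventually_conj[OF ev1 ev2]] by auto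
      from tendstoD[OF lim[of "r i" t] e3] near[of "r i"]
      show "\<forall>\<^sub>F n in sequentially. dist (char (distr M borel (X n)) t) (?\<phi> \<sigma>) < \<epsilon>"
      proof eventually_elim
        case (elim n)
        have "norm (char (distr M borel (X n)) t - char (distr M borel (W (r i) n)) t) \<le> \<bar>t\<bar> * (1 / real (Suc (r i)))"
          by (rule char_distr_diff_le) (use elim assms(1) in auto)
        then have "dist (char (distr M borel (X n)) t) (char (distr M borel (W (r i) n)) t) < \<epsilon> / 3"
          unfolding dist_norm using i(2) by (rule le_less_trans)
        with elim(1) i(1) show ?case
          using dist_triangle[of "char (distr M borel (X n)) t" "?\<phi> \<sigma>" "char (distr M borel (W (r i) n)) t"]
            dist_triangle[of "char (distr M borel (W (r i) n)) t" "?\<phi> \<sigma>" "?\<phi> (s (r i))"] by linarith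
      qed
    qed
  qed
  with \<sigma> show ?thesis by auto
qed

lemma filterlim_div_at_top:
  assumes "0 < (L :: nat)"
  shows "filterlim (\<lambda>n. n div L) at_top sequentially"
  unfolding filterlim_at_top
proof
  fix Z :: nat
  show "\<forall>\<^sub>F n in sequentially. Z \<le> n div L"
    using assms by (intro eventually_sequentiallyI[of "Z * L"]) (simp add: less_eq_div_iff_mult_less_eq)
qed

text \<open>Bernstein's blocks: blocks of length \<open>q\<close> separated by gaps of length \<open>2m + 1\<close> are independent
  because \<open>G\<close> only looks at the rows in \<open>{-m..m}\<close>; the gaps are negligible when \<open>q\<close> is large.\<close>
lemma clt_finite_range:
  fixes G :: "(int \<times> 'k \<Rightarrow> bool) \<Rightarrow> real" and K e :: real
  assumes G[measurable]: "G \<in> borel_measurable (row_field p)"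
    and G2: "integrable (row_field p) (\<lambda>\<omega>. (G \<omega>)\<^sup>2)" and G0: "(\<integral>\<omega>. G \<omega> \<partial>row_field p) = 0"
    and loc: "\<forall>\<omega> \<omega>'. (\<forall>j k. \<bar>j\<bar> \<le> int m \<longrightarrow> \<omega> (j, k) = \<omega>' (j, k)) \<longrightarrow> G \<omega> = G \<omega>'"
    and var: "\<forall>I :: nat set. finite I \<longrightarrow> (\<integral>\<omega>. (\<Sum>i\<in>I. G (shift (int i) \<omega>))\<^sup>2 \<partial>row_field p) \<le> K * card I"
    and e: "0 < e"
  shows "\<exists>W s. 0 \<le> s \<and> s\<^sup>2 \<le> K \<and> (\<forall>n. W n \<in> borel_measurable (row_field p)) \<and>
      (\<forall>t. (\<lambda>n. char (distr (row_field p) borel (W n)) t) \<longlonglongrightarrow> complex_of_real (exp (- (s * t)\<^sup>2 / 2))) \<and>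
      (\<forall>\<^sub>F n in sequentially.
        integrable (row_field p) (\<lambda>\<omega>. ((\<Sum>i<n. G (shift (int i) \<omega>)) / sqrt n - W n \<omega>)\<^sup>2) \<and>
        (\<integral>\<omega>. ((\<Sum>i<n. G (shift (int i) \<omega>)) / sqrt n - W n \<omega>)\<^sup>2 \<partial>row_field p) \<le> e\<^sup>2)"
proof -
  let ?P = "row_field p :: (int \<times> 'k \<Rightarrow> bool) measure"
  interpret prob_space ?P by (rule prob_space_bernoulli_field)
  note tr = shift_integrable shift_integral
  define S where "S I \<omega> = (\<Sum>i\<in>I. G (shift (int i) \<omega>))" for I :: "nat set" and \<omega>
  have S[measurable]: "S I \<in> borel_measurable ?P" for I unfolding S_def by measurable
  have G1: "integrable ?P G" by (rule square_integrable_imp_integrable[OF _ G2]) simp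
  have S2: "integrable ?P (\<lambda>\<omega>. (S I \<omega>)\<^sup>2)" if "finite I" for I
    using that
  proof (induction I rule: finite_induct)
    case empty then show ?case by (simp add: S_def)
  next
    case (insert i I)
    have "integrable ?P (\<lambda>\<omega>. (G (shift (int i) \<omega>) + S I \<omega>)\<^sup>2)"
      using tr(1)[of "\<lambda>x. (G x)\<^sup>2"] G2 insert by (intro square_integrable_add) auto
    then show ?case using insert by (simp add: S_def)
  qed
  have S0: "(\<integral>\<omega>. S I \<omega> \<partial>?P) = 0" for I
    unfolding S_def using tr[OF G] G1 G0 by (subst Bochner_Integration.integral_sum) auto
  have varS: "(\<integral>\<omega>. (S I \<omega>)\<^sup>2 \<partial>?P) \<le> K * card I" if "finite I" for I
    unfolding S_def using var that by simp
  have K: "0 \<le> K"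
  proof -
    have "0 \<le> (\<integral>\<omega>. (S {0} \<omega>)\<^sup>2 \<partial>?P)" by simp
    from order_trans[OF this varS[of "{0}"]] show ?thesis by simp
  qed
  \<comment> \<open>The gaps occupy a share \<open>(2 * m + 1) / L\<close> of the times;
    \<open>q\<close> is so large that their part of the squared error takes at most a third of
    \<open>e\<^sup>2\<close>.\<close>
  obtain q :: nat where q: "6 * K * (2 * m + 1) / e\<^sup>2 < real q" using reals_Archimedean2 by blast
  \<comment> \<open>A block of \<open>q\<close> times reads \<open>q + 2 * m\<close> consecutive
    rows, fewer than the period \<open>L\<close>; hence the row windows of different blocks are
    disjoint.\<close>
  define L where "L = q + 2 * m + 1"
  have L: "0 < L" by (simp add: L_def)
  have Le: "2 * K * (2 * m + 1) / L \<le> e\<^sup>2 / 3"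
  proof -
    have "6 * K * (2 * m + 1) < real q * e\<^sup>2" using q e by (simp add: field_simps)
    also have "\<dots> \<le> L * e\<^sup>2" by (intro mult_right_mono) (auto simp: L_def)
    finally show ?thesis using L by (simp add: field_simps)
  qed
  define blk where "blk b = {b * L..<b * L + q}" for b :: nat
  have fin_blk[simp]: "finite (blk b)" "card (blk b) = q" for b by (auto simp: blk_def)
  have blk_disj: "b = b'" if "i \<in> blk b" "i \<in> blk b'" for i b b'
  proof -
    have "i div L = b" if "i \<in> blk b" for b
      using that by (intro div_nat_eqI) (auto simp: blk_def L_def algebra_simps)
    with that show ?thesis by metis
  qed
  define B where "B b = S (blk b)" for b
  have B[measurable]: "B b \<in> borel_measurable ?P" for b unfolding B_def by simp
  have B_shift: "B b \<omega> = B 0 (shift (int (b * L)) \<omega>)" for b \<omega>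
    unfolding B_def S_def shift_shift
    by (rule sum.reindex_bij_witness[of _ "\<lambda>i. i + b * L" "\<lambda>i. i - b * L"]) (auto simp: blk_def)
  have indep: "indep_vars (\<lambda>_. borel) B UNIV"
  proof (rule bernoulli_field_indep_blocks)
    let ?R = "\<lambda>b. {int (b * L) - int m..<int (b * L) + int q + int m} \<times> (UNIV :: 'k set)"
    show "B b \<omega> = B b \<omega>'" if eq: "\<And>i. i \<in> ?R b \<Longrightarrow> \<omega> i = \<omega>' i" for b \<omega> \<omega>'
      unfolding B_def S_def
    proof (intro sum.cong refl loc[rule_format])
      fix i j k assume "i \<in> blk b" "\<bar>j\<bar> \<le> int m"
      then have "b * L \<le> i" "i < b * L + q" by (auto simp: blk_def)
      then have "int (b * L) \<le> int i" "int i < int (b * L) + int q" by linarith+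
      with \<open>\<bar>j\<bar> \<le> int m\<close> have "(j + int i, k) \<in> ?R b"
        unfolding mem_Times_iff fst_conv snd_conv atLeastLessThan_iff by (intro conjI UNIV_I; linarith)
      from eq[OF this] show "shift (int i) \<omega> (j, k) = shift (int i) \<omega>' (j, k)"
        by (simp add: shift_def)
    qed
    have "b = b'" if x: "x \<in> ?R b" "x \<in> ?R b'" for x b b'
    proof -
      have "(fst x + int m) div int L = int b" if "x \<in> ?R b" for b
        using that by (intro int_div_pos_eq[of _ _ _ "fst x + int m - int b * int L"])
          (auto simp: L_def algebra_simps)
      with x show ?thesis by (metis of_nat_eq_iff)
    qed
    then show "disjoint_family_on ?R UNIV" unfolding disjoint_family_on_def by blast
  qed simp
  define v where "v = (\<integral>\<omega>. (B 0 \<omega>)\<^sup>2 \<partial>?P)"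
  have v: "0 \<le> v" "v \<le> K * q" unfolding v_def using varS[of "blk 0"] by (auto simp: B_def)
  have B2: "integrable ?P (\<lambda>\<omega>. (B b \<omega>)\<^sup>2)" for b unfolding B_def by (rule S2) simp
  have Bv: "(\<integral>\<omega>. (B b \<omega>)\<^sup>2 \<partial>?P) = v" for b
    unfolding B_shift[of b] v_def by (rule tr(2)) simp
  \<comment> \<open>\<open>v\<close> is the variance of one block and a block accounts for
    \<open>L\<close> times, so \<open>v / L\<close> is the variance per unit of time.\<close>
  define s where "s = sqrt (v / L)"
  have s: "0 \<le> s" "s\<^sup>2 \<le> K"
  proof -
    show "0 \<le> s" using v by (simp add: s_def)
    have "v \<le> K * L" using v(2) K by (elim order_trans) (auto simp: L_def intro!: mult_left_mono)
    then show "s\<^sup>2 \<le> K" using v L by (simp add: s_def field_simps)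
  qed
  define N where "N n = n div L" for n
  have N: "filterlim N at_top sequentially" unfolding N_def by (rule filterlim_div_at_top[OF L])
  define W where "W n \<omega> = (\<Sum>b<N n. B b \<omega>) / sqrt (N n * L)" for n \<omega>
  have W[measurable]: "W n \<in> borel_measurable ?P" for n unfolding W_def by measurable
  have charW: "(\<lambda>n. char (distr ?P borel (W n)) t) \<longlonglongrightarrow> complex_of_real (exp (- (s * t)\<^sup>2 / 2))" for t
  proof (cases "v = 0")
    \<comment> \<open>The classical theorem demands a positive variance. Here the block sums vanish
      almost surely and the limit is degenerate.\<close>
    case True
    have "AE \<omega> in ?P. B b \<omega> = 0" for b
      using integral_nonneg_eq_0_iff_AE[OF B2[of b]] Bv[of b] True by simp
    then have "AE \<omega> in ?P. \<forall>b. B b \<omega> = 0" by (simp add: AE_all_countable)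
    then have "AE \<omega> in ?P. iexp (t * W n \<omega>) = 1" for n
      by eventually_elim (simp add: W_def)
    then have "(\<integral>\<omega>. iexp (t * W n \<omega>) \<partial>?P) = (\<integral>\<omega>. 1 \<partial>?P)" for n
      by (intro integral_cong_AE) measurable
    moreover have "char (distr ?P borel (W n)) t = (\<integral>\<omega>. iexp (t * W n \<omega>) \<partial>?P)" for n
      unfolding char_def by (subst integral_distr) auto
    ultimately have "char (distr ?P borel (W n)) t = (\<integral>\<omega>. 1 \<partial>?P)" for n
      by (simp only:)
    then show ?thesis using True prob_space by (simp add: s_def)
  next
    case False
    then have v0: "0 < v" using v by simp
    have "weak_conv_m (\<lambda>n. distr ?P borel (\<lambda>\<omega>. (\<Sum>b<n. B b \<omega>) / sqrt (n * (sqrt v)\<^sup>2))) std_normal_distribution"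
    proof (rule central_limit_theorem_zero_mean[OF indep])
      show "expectation (B b) = 0" for b unfolding B_def by (rule S0)
      then show "variance (B b) = (sqrt v)\<^sup>2" for b using Bv v by simp
      show "0 < sqrt v" using v0 by simp
      show "distr ?P borel (B b) = distr ?P borel (B 0)" for b
      proof -
        have "B b = B 0 \<circ> shift (int (b * L))"
          using B_shift[of b] by (simp add: fun_eq_iff)
        then have "distr ?P borel (B b) = distr ?P borel (B 0 \<circ> shift (int (b * L)))" by (rule arg_cong)
        also have "\<dots> = distr (distr ?P ?P (shift (int (b * L)))) borel (B 0)"
          by (subst distr_distr) auto
        finally show ?thesis by (simp add: measure_preserving_mapD(2)[OF measure_preserving_shift])
      qed
    qed (rule B2)
    then have "(\<lambda>n. char (distr ?P borel (\<lambda>\<omega>. (\<Sum>b<n. B b \<omega>) / sqrt (n * (sqrt v)\<^sup>2))) (s * t))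
        \<longlonglongrightarrow> char std_normal_distribution (s * t)"
      by (intro levy_continuity1 real_distribution_distr real_dist_normal_dist) auto
    from filterlim_compose[OF this N]
    have lim: "(\<lambda>n. char (distr ?P borel (\<lambda>\<omega>. (\<Sum>b<N n. B b \<omega>) / sqrt (N n * (sqrt v)\<^sup>2))) (s * t))
        \<longlonglongrightarrow> complex_of_real (exp (- (s * t)\<^sup>2 / 2))"
      by (simp add: char_std_normal_distribution)
    have "W n = (\<lambda>\<omega>. s * ((\<Sum>b<N n. B b \<omega>) / sqrt (N n * (sqrt v)\<^sup>2)))" for n
      using v0 L by (auto simp: W_def s_def fun_eq_iff real_sqrt_mult real_sqrt_divide field_simps)
    then have "char (distr ?P borel (W n)) t = char (distr ?P borel (\<lambda>\<omega>. (\<Sum>b<N n. B b \<omega>) / sqrt (N n * (sqrt v)\<^sup>2))) (s * t)" for n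
      by (simp only:) (rule char_distr_scale, measurable)
    with lim show ?thesis by simp
  qed
  define BB where "BB n = (\<Union>b<N n. blk b)" for n
  have BB: "finite (BB n)" "card (BB n) = N n * q" "BB n \<subseteq> {..<n}" for n
  proof -
    show "finite (BB n)" by (simp add: BB_def)
    show "card (BB n) = N n * q" unfolding BB_def
      by (subst card_UN_disjoint) (use blk_disj in auto)
    show "BB n \<subseteq> {..<n}"
    proof
      fix i assume "i \<in> BB n"
      then obtain b where b: "b < N n" "i \<in> blk b" by (auto simp: BB_def)
      have "i < b * L + L" using b(2) by (auto simp: blk_def L_def)
      also have "\<dots> \<le> N n * L" using b(1) mult_le_mono1[of "Suc b" "N n" L] by simp
      also have "\<dots> \<le> n" by (simp add: N_def)
      finally show "i \<in> {..<n}" by simp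
    qed
  qed
  have sumB: "(\<Sum>b<N n. B b \<omega>) = S (BB n) \<omega>" for n \<omega>
    unfolding BB_def B_def S_def by (subst sum.UNION_disjoint) (use blk_disj in auto)
  let ?gap = "\<lambda>n. {..<n} - BB n"
  have Sn: "S {..<n} \<omega> = S (BB n) \<omega> + S (?gap n) \<omega>" for n \<omega>
    unfolding S_def using BB by (subst sum.subset_diff[of "BB n" "{..<n}"]) auto
  \<comment> \<open>Each complete period has \<open>2 * m + 1\<close> times outside its block, and
    the last, incomplete period has fewer than \<open>L\<close> times.\<close>
  have card_gap: "real (card (?gap n)) \<le> N n * (2 * m + 1) + L" for n
  proof -
    have "card (?gap n) = n - N n * q" using BB by (simp add: card_Diff_subset)
    also have "\<dots> \<le> N n * (2 * m + 1) + L"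
    proof -
      have "n = N n * L + n mod L" by (simp add: N_def)
      also have "\<dots> \<le> N n * L + L" using L by (simp add: less_imp_le)
      finally show ?thesis by (simp add: L_def algebra_simps)
    qed
    finally have "real (card (?gap n)) \<le> real (N n * (2 * m + 1) + L)" by (rule of_nat_mono)
    then show ?thesis by simp
  qed
  \<comment> \<open>\<open>W\<close> is normalized by the time \<open>N n * L\<close> of the
    complete periods instead of \<open>n\<close>; \<open>c n\<close> corrects for this and is
    negligible because \<open>N n * L / n\<close> tends to 1.\<close>
  define c where "c n = 1 / sqrt n - 1 / sqrt (N n * L)" for n
  have decomp: "S {..<n} \<omega> / sqrt n - W n \<omega> = S (?gap n) \<omega> / sqrt n + c n * S (BB n) \<omega>" for n \<omega>
    by (simp add: Sn W_def sumB c_def add_divide_distrib left_diff_distrib)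
  have int: "integrable ?P (\<lambda>\<omega>. (S {..<n} \<omega> / sqrt n - W n \<omega>)\<^sup>2)" for n
    unfolding decomp by (intro square_integrable_add) (auto simp: power_mult_distrib power_divide S2 BB(1))
  have bound: "(\<integral>\<omega>. (S {..<n} \<omega> / sqrt n - W n \<omega>)\<^sup>2 \<partial>?P)
      \<le> 2 * K * (2 * m + 1) / L + 2 * K * L / n + 2 * K * (sqrt (N n * L / n) - 1)\<^sup>2" if n: "n \<ge> L" for n
  proof -
    have n0: "0 < n" using n L by simp
    have N0: "0 < N n" using n L by (simp add: N_def div_greater_zero_iff)
    have "(\<integral>\<omega>. (S {..<n} \<omega> / sqrt n - W n \<omega>)\<^sup>2 \<partial>?P) \<le> (\<integral>\<omega>. 2 * ((S (?gap n) \<omega>)\<^sup>2 / n) + 2 * ((c n)\<^sup>2 * (S (BB n) \<omega>)\<^sup>2) \<partial>?P)"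
    proof (rule integral_mono)
      fix \<omega>
      have "(x + y)\<^sup>2 \<le> 2 * x\<^sup>2 + 2 * y\<^sup>2" for x y :: real
        using sum_squares_bound[of x y] by (simp add: power2_sum)
      from this[of "S (?gap n) \<omega> / sqrt n" "c n * S (BB n) \<omega>"]
      show "(S {..<n} \<omega> / sqrt n - W n \<omega>)\<^sup>2 \<le> 2 * ((S (?gap n) \<omega>)\<^sup>2 / n) + 2 * ((c n)\<^sup>2 * (S (BB n) \<omega>)\<^sup>2)"
        unfolding decomp by (simp add: power_mult_distrib power_divide)
    qed (use int S2 BB(1) in auto)
    also have "\<dots> = 2 * ((\<integral>\<omega>. (S (?gap n) \<omega>)\<^sup>2 \<partial>?P) / n) + 2 * ((c n)\<^sup>2 * (\<integral>\<omega>. (S (BB n) \<omega>)\<^sup>2 \<partial>?P))"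
      using S2 BB(1) by simp
    also have "\<dots> \<le> 2 * (K * (N n * (2 * m + 1) + L) / n) + 2 * ((c n)\<^sup>2 * (K * (N n * L)))"
    proof (intro add_mono mult_left_mono divide_right_mono)
      show "(\<integral>\<omega>. (S (?gap n) \<omega>)\<^sup>2 \<partial>?P) \<le> K * (N n * (2 * m + 1) + L)"
        by (rule order_trans[OF varS]) (use card_gap[of n] K in \<open>auto intro!: mult_left_mono\<close>)
      show "(\<integral>\<omega>. (S (BB n) \<omega>)\<^sup>2 \<partial>?P) \<le> K * (N n * L)"
      proof (rule order_trans[OF varS[OF BB(1)]])
        have "N n * q \<le> N n * L" by (intro mult_le_mono2) (simp add: L_def)
        from mult_left_mono[OF of_nat_mono[OF this] K]
        show "K * card (BB n) \<le> K * (N n * L)" unfolding BB(2) .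
      qed
    qed auto
    also have "(c n)\<^sup>2 * (K * (N n * L)) = K * (sqrt (N n * L / n) - 1)\<^sup>2"
    proof -
      have "sqrt (N n * L / n) - 1 = c n * sqrt (N n * L)"
        using N0 L n0 by (simp add: c_def left_diff_distrib real_sqrt_divide)
      then show ?thesis by (simp add: power_mult_distrib)
    qed
    also have "K * (N n * (2 * m + 1) + L) / n \<le> K * (2 * m + 1) / L + K * L / n"
    proof -
      have "N n * L \<le> n" by (simp add: N_def)
      then have "real (N n) * L \<le> n" by (metis of_nat_le_iff of_nat_mult)
      then have "real (N n) / n \<le> 1 / L" using n0 L by (simp add: field_simps)
      then have "K * (2 * m + 1) * (real (N n) / n) \<le> K * (2 * m + 1) * (1 / L)"
        using K by (intro mult_left_mono) auto
      then show ?thesis by (simp add: add_divide_distrib distrib_left mult.assoc mult.commute mult.left_commute)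
    qed
    finally show ?thesis by simp
  qed
  have lim1: "(\<lambda>n. real (N n * L) / n) \<longlonglongrightarrow> 1"
  proof (rule tendsto_sandwich[of "\<lambda>n. 1 - L / real n" _ _ "\<lambda>n. 1"])
    have "(\<lambda>n. 1 - real L * (1 / real n)) \<longlonglongrightarrow> 1 - real L * 0"
      by (intro tendsto_intros lim_1_over_n)
    then show "(\<lambda>n. 1 - L / real n) \<longlonglongrightarrow> 1" by simp
    have "real n - L \<le> N n * L \<and> N n * L \<le> real n" for n
    proof -
      have "real n = real (N n * L + n mod L)" by (simp add: N_def)
      moreover have "n mod L < L" using L by simp
      ultimately show ?thesis by auto
    qed
    then show "\<forall>\<^sub>F n in sequentially. 1 - L / real n \<le> real (N n * L) / n"
      "\<forall>\<^sub>F n in sequentially. real (N n * L) / n \<le> 1"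
      by (auto intro!: eventually_sequentiallyI[of 1] simp: field_simps)
  qed simp
  have "(\<lambda>n. 2 * K * L * (1 / n) + 2 * K * (sqrt (N n * L / n) - 1)\<^sup>2) \<longlonglongrightarrow> 2 * K * L * 0 + 2 * K * (sqrt 1 - 1)\<^sup>2"
    using lim1 by (intro tendsto_intros lim_1_over_n) simp
  then have "\<forall>\<^sub>F n in sequentially. 2 * K * L * (1 / n) + 2 * K * (sqrt (N n * L / n) - 1)\<^sup>2 < 2 * e\<^sup>2 / 3"
    using e by (intro order_tendstoD(2)) auto
  then have "\<forall>\<^sub>F n in sequentially. (\<integral>\<omega>. (S {..<n} \<omega> / sqrt n - W n \<omega>)\<^sup>2 \<partial>?P) \<le> e\<^sup>2"
    using eventually_ge_at_top[of L]
  proof eventually_elim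
    case (elim n)
    then show ?case using bound[of n] Le by simp
  qed
  then show ?thesis
    using s charW int W unfolding S_def by (intro exI[of _ W] exI[of _ s]) auto
qed

text \<open>\<open>K\<close> must not depend on \<open>e\<close>, since it confines the limiting
  deviations to a fixed compact interval. The variance bound on \<open>G\<close> is demanded for all
  finite sets of times because it is applied to the union of the blocks and to the union of the
  gaps.\<close>

theorem clt_row_field:
  fixes F :: "(int \<times> 'k \<Rightarrow> bool) \<Rightarrow> real" and K :: real
  assumes F[measurable]: "F \<in> borel_measurable (row_field p)"
    and F2: "integrable (row_field p) (\<lambda>\<omega>. (F \<omega>)\<^sup>2)"
    and approx: "\<And>e :: real. 0 < e \<Longrightarrow> \<exists>G m. G \<in> borel_measurable (row_field p) \<and>
      integrable (row_field p) (\<lambda>\<omega>. (G \<omega>)\<^sup>2) \<and> (\<integral>\<omega>. G \<omega> \<partial>row_field p) = 0 \<and>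
      (\<forall>\<omega> \<omega>'. (\<forall>j k. \<bar>j\<bar> \<le> int m \<longrightarrow> \<omega> (j, k) = \<omega>' (j, k)) \<longrightarrow> G \<omega> = G \<omega>') \<and>
      (\<forall>I :: nat set. finite I \<longrightarrow> (\<integral>\<omega>. (\<Sum>i\<in>I. G (shift (int i) \<omega>))\<^sup>2 \<partial>row_field p) \<le> K * card I) \<and>
      (\<forall>I :: nat set. finite I \<longrightarrow>
        (\<integral>\<omega>. (\<Sum>i\<in>I. F (shift (int i) \<omega>) - G (shift (int i) \<omega>))\<^sup>2 \<partial>row_field p) \<le> e * card I)"
  shows "\<exists>\<sigma>\<ge>0. weak_conv_m (\<lambda>n. distr (row_field p) borel (\<lambda>\<omega>. (\<Sum>i<n. F (shift (int i) \<omega>)) / sqrt n))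
      (distr std_normal_distribution borel (\<lambda>t. \<sigma> * t))"
proof (rule weak_conv_normal_of_approximations[where K = "sqrt K"])
  let ?P = "row_field p :: (int \<times> 'k \<Rightarrow> bool) measure"
  show "prob_space ?P" by (rule prob_space_bernoulli_field)
  show "(\<lambda>\<omega>. (\<Sum>i<n. F (shift (int i) \<omega>)) / sqrt n) \<in> borel_measurable ?P" for n by measurable
  fix e :: real assume "0 < e"
  \<comment> \<open>The truncation and the blocks may each cost \<open>e / 2\<close> in L2; by
    \<open>(x + y)^2 \<le> 2 x^2 + 2 y^2\<close> the total is at most \<open>e\<close>. After
    division by \<open>sqrt n\<close>, the first allowance is \<open>e\<^sup>2 / 4\<close> per
    time.\<close>
  then have e': "0 < e\<^sup>2 / 4" "0 < e / 2" by auto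
  obtain G m where G[measurable]: "G \<in> borel_measurable ?P"
    and G2: "integrable ?P (\<lambda>\<omega>. (G \<omega>)\<^sup>2)" and G0: "(\<integral>\<omega>. G \<omega> \<partial>?P) = 0"
    and loc: "\<forall>\<omega> \<omega>'. (\<forall>j k. \<bar>j\<bar> \<le> int m \<longrightarrow> \<omega> (j, k) = \<omega>' (j, k)) \<longrightarrow> G \<omega> = G \<omega>'"
    and varG: "\<forall>I :: nat set. finite I \<longrightarrow> (\<integral>\<omega>. (\<Sum>i\<in>I. G (shift (int i) \<omega>))\<^sup>2 \<partial>?P) \<le> K * card I"
    and varFG: "\<forall>I :: nat set. finite I \<longrightarrow>
        (\<integral>\<omega>. (\<Sum>i\<in>I. F (shift (int i) \<omega>) - G (shift (int i) \<omega>))\<^sup>2 \<partial>?P) \<le> e\<^sup>2 / 4 * card I"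
    using approx[OF e'(1)] by (elim exE conjE) (rule that)
  obtain W s where s: "0 \<le> s" "s\<^sup>2 \<le> K" and W: "\<forall>n. W n \<in> borel_measurable ?P"
    and charW: "\<forall>t. (\<lambda>n. char (distr ?P borel (W n)) t) \<longlonglongrightarrow> complex_of_real (exp (- (s * t)\<^sup>2 / 2))"
    and near: "\<forall>\<^sub>F n in sequentially.
        integrable ?P (\<lambda>\<omega>. ((\<Sum>i<n. G (shift (int i) \<omega>)) / sqrt n - W n \<omega>)\<^sup>2) \<and>
        (\<integral>\<omega>. ((\<Sum>i<n. G (shift (int i) \<omega>)) / sqrt n - W n \<omega>)\<^sup>2 \<partial>?P) \<le> (e / 2)\<^sup>2"
    using clt_finite_range[OF G G2 G0 loc varG e'(2)] by (elim exE conjE) (rule that)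
  have [measurable]: "W n \<in> borel_measurable ?P" for n using W by simp
  have FG2: "integrable ?P (\<lambda>\<omega>. (\<Sum>i\<in>I. F (shift (int i) \<omega>) - G (shift (int i) \<omega>))\<^sup>2)" if "finite I" for I
    using that
  proof (induction I rule: finite_induct)
    case (insert i I)
    have "integrable ?P (\<lambda>\<omega>. (f (shift (int i) \<omega>))\<^sup>2)" if "integrable ?P (\<lambda>\<omega>. (f \<omega>)\<^sup>2)" "f \<in> borel_measurable ?P" for f :: "_ \<Rightarrow> real"
      using measure_preserving_map_integrable[OF measure_preserving_shift[of p "int i"], of "\<lambda>\<omega>. (f \<omega>)\<^sup>2"] that by simp
    then show ?case
      using insert F2 G2 by (simp add: square_integrable_add square_integrable_diff)
  qed simp
  have "s \<le> sqrt K" using s real_le_rsqrt by blast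
  moreover have "\<forall>\<^sub>F n in sequentially.
      integrable ?P (\<lambda>\<omega>. ((\<Sum>i<n. F (shift (int i) \<omega>)) / sqrt n - W n \<omega>)\<^sup>2) \<and>
      (\<integral>\<omega>. ((\<Sum>i<n. F (shift (int i) \<omega>)) / sqrt n - W n \<omega>)\<^sup>2 \<partial>?P) \<le> e\<^sup>2"
    using near eventually_gt_at_top[of 0]
  proof eventually_elim
    case (elim n)
    let ?A = "\<lambda>\<omega>. (\<Sum>i<n. F (shift (int i) \<omega>) - G (shift (int i) \<omega>)) / sqrt n"
    let ?B = "\<lambda>\<omega>. (\<Sum>i<n. G (shift (int i) \<omega>)) / sqrt n - W n \<omega>"
    have eq: "(\<Sum>i<n. F (shift (int i) \<omega>)) / sqrt n - W n \<omega> = ?A \<omega> + ?B \<omega>" for \<omega>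
      by (simp add: sum_subtractf diff_divide_distrib)
    have A2: "integrable ?P (\<lambda>\<omega>. (?A \<omega>)\<^sup>2)" using FG2[of "{..<n}"] by (simp add: power_divide)
    have B2: "integrable ?P (\<lambda>\<omega>. (?B \<omega>)\<^sup>2)" using elim by simp
    have AB: "integrable ?P (\<lambda>\<omega>. (?A \<omega> + ?B \<omega>)\<^sup>2)"
      by (rule square_integrable_add[OF _ _ A2 B2]) measurable
    have "(\<integral>\<omega>. (?A \<omega> + ?B \<omega>)\<^sup>2 \<partial>?P) \<le> (\<integral>\<omega>. 2 * (?A \<omega>)\<^sup>2 + 2 * (?B \<omega>)\<^sup>2 \<partial>?P)"
    proof (rule integral_mono[OF AB])
      show "(?A \<omega> + ?B \<omega>)\<^sup>2 \<le> 2 * (?A \<omega>)\<^sup>2 + 2 * (?B \<omega>)\<^sup>2" for \<omega>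
        using sum_squares_bound[of "?A \<omega>" "?B \<omega>"] unfolding power2_sum by linarith
    qed (use A2 B2 in auto)
    also have "\<dots> = 2 * (\<integral>\<omega>. (?A \<omega>)\<^sup>2 \<partial>?P) + 2 * (\<integral>\<omega>. (?B \<omega>)\<^sup>2 \<partial>?P)"
      using A2 B2 by (subst Bochner_Integration.integral_add) auto
    also have "(\<integral>\<omega>. (?A \<omega>)\<^sup>2 \<partial>?P) \<le> e\<^sup>2 / 4"
      using varFG[rule_format, of "{..<n}"] elim by (simp add: power_divide field_simps)
    also have "(\<integral>\<omega>. (?B \<omega>)\<^sup>2 \<partial>?P) \<le> e\<^sup>2 / 4" using elim by (simp add: power_divide)
    finally show ?case using AB unfolding eq by simp
  qed
  ultimately show "\<exists>W s. 0 \<le> s \<and> s \<le> sqrt K \<and> (\<forall>n. W n \<in> borel_measurable ?P) \<and>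
      (\<forall>t. (\<lambda>n. char (distr ?P borel (W n)) t) \<longlonglongrightarrow> complex_of_real (exp (- (s * t)\<^sup>2 / 2))) \<and>
      (\<forall>\<^sub>F n in sequentially. integrable ?P (\<lambda>x. ((\<Sum>i<n. F (shift (int i) x)) / sqrt n - W n x)\<^sup>2) \<and>
        (\<integral>x. ((\<Sum>i<n. F (shift (int i) x)) / sqrt n - W n x)\<^sup>2 \<partial>?P) \<le> e\<^sup>2)"
    using s charW W by blast
qed

section \<open>Observables with summable influences\<close>

definition lacunary_sum :: "(nat \<Rightarrow> real) \<Rightarrow> (nat \<Rightarrow> 'a set) \<Rightarrow> 'a \<Rightarrow> real" where
  "lacunary_sum b E x = (\<Sum>k. b k * indicator (E k) x)"

text \<open>Bounds the n-th moment of \<open>1 + lacunary_sum b E\<close> when \<open>E k\<close>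
  has probability at most \<open>(1/2)^k / B^k\<close> with
  \<open>B = 1 + (\<Sum>i\<le>k. b i)\<close>. The k-th term pays for the points at which
  \<open>k\<close> is the last index to occur; from \<open>k \<ge> n\<close> on it is at most
  \<open>(1/2)^k\<close>.\<close>

definition lacunary_const :: "(nat \<Rightarrow> real) \<Rightarrow> nat \<Rightarrow> real" where
  "lacunary_const b n = 1 + (\<Sum>k. (1 + (\<Sum>i\<le>k. b i)) ^ n * ((1/2) ^ k / (1 + (\<Sum>i\<le>k. b i)) ^ k))"

lemma lacunary_sum_finite:
  assumes "finite {k. x \<in> E k}"
  shows "lacunary_sum b E x = (\<Sum>k\<in>{k. x \<in> E k}. b k)"
proof -
  have "lacunary_sum b E x = (\<Sum>k\<in>{k. x \<in> E k}. b k * indicator (E k) x)"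
    unfolding lacunary_sum_def by (rule suminf_finite[OF assms]) simp
  also have "\<dots> = (\<Sum>k\<in>{k. x \<in> E k}. b k)" by (rule sum.cong) auto
  finally show ?thesis .
qed

text \<open>The sum over the events that occur is at most \<open>b 0 + ... + b K\<close> for the last such index \<open>K\<close>;
  this bounds all moments without any independence.\<close>
lemma lacunary_moments:
  assumes "prob_space M" and [measurable]: "\<And>k. E k \<in> sets M" and b: "\<And>k. 0 \<le> b k"
    and small: "\<And>k. measure M (E k) * (1 + (\<Sum>i\<le>k. b i)) ^ k \<le> (1/2) ^ k"
  shows "AE x in M. finite {k. x \<in> E k}"
    and "lacunary_sum b E \<in> borel_measurable M"
    and "integrable M (\<lambda>x. (1 + lacunary_sum b E x) ^ n)"
    and "(\<integral>x. (1 + lacunary_sum b E x) ^ n \<partial>M) \<le> lacunary_const b n"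
proof -
  interpret prob_space M by fact
  define B where "B k = 1 + (\<Sum>i\<le>k. b i)" for k
  have B1: "1 \<le> B k" for k using b by (simp add: B_def sum_nonneg)
  have prob_le: "measure M (E k) \<le> (1/2) ^ k / B k ^ k" for k
    using small[of k] B1[of k] by (simp add: B_def[symmetric] pos_le_divide_eq)
  have prob_le': "measure M (E k) \<le> (1/2) ^ k" for k
  proof (rule order_trans[OF prob_le])
    show "(1/2) ^ k / B k ^ k \<le> (1/2) ^ k"
      using B1[of k] by (simp add: divide_le_eq one_le_power)
  qed
  have "AE x in M. eventually (\<lambda>n. x \<in> space M - E n) sequentially"
    by (rule borel_cantelli_AE1) (use prob_le' in \<open>auto simp: emeasure_eq_measure intro!: summable_comparison_test'[OF summable_geometric[of "1/2 :: real"]]\<close>)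
  then show fin: "AE x in M. finite {k. x \<in> E k}"
  proof eventually_elim
    case (elim x)
    then obtain N where "\<And>n. n \<ge> N \<Longrightarrow> x \<notin> E n" by (auto simp: eventually_sequentially)
    then have "{k. x \<in> E k} \<subseteq> {..N}" by (auto simp: not_le[symmetric]) (meson nle_le)
    then show ?case using finite_subset by blast
  qed
  show [measurable]: "lacunary_sum b E \<in> borel_measurable M"
    unfolding lacunary_sum_def[abs_def] by measurable
  let ?c = "\<lambda>k. B k ^ n * ((1/2) ^ k / B k ^ k)"
  have c_summable: "summable ?c"
  proof (rule summable_comparison_test'[OF summable_geometric[of "1/2 :: real"], of n])
    fix k assume "n \<le> k"
    then have "B k ^ n \<le> B k ^ k" using B1[of k] by (intro power_increasing) auto
    then have "B k ^ n / B k ^ k \<le> 1" using B1[of k] by (simp add: divide_le_eq_1)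
    then have "(1/2) ^ k * (B k ^ n / B k ^ k) \<le> (1/2) ^ k * 1" by (intro mult_left_mono) auto
    then show "norm (?c k) \<le> (1/2) ^ k" using B1[of k] by (simp add: mult.commute)
  qed simp
  have const: "lacunary_const b n = 1 + suminf ?c" by (simp add: lacunary_const_def B_def)
  let ?f = "\<lambda>k x. B k ^ n * indicator (E k) x :: real"
  have f_int: "integrable M (?f k)" for k
    by (intro integrable_mult_right integrable_real_indicator) (auto simp: emeasure_eq_measure)
  have f_sum: "AE x in M. summable (\<lambda>k. norm (?f k x))"
    using fin
  proof eventually_elim
    case (elim x)
    show ?case by (rule summable_finite[OF elim]) simp
  qed
  have f_norm: "(\<integral>x. norm (?f k x) \<partial>M) = B k ^ n * measure M (E k)" for k
    using B1[of k] by (simp add: abs_mult)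
  have f_norm_le: "B k ^ n * measure M (E k) \<le> ?c k" for k
    using prob_le B1[of k] by (intro mult_left_mono) auto
  have f_sums: "summable (\<lambda>k. \<integral>x. norm (?f k x) \<partial>M)"
    unfolding f_norm
  proof (rule summable_comparison_test'[OF c_summable, of 0])
    fix k
    have "0 \<le> B k ^ n" using B1[of k] by simp
    then show "norm (B k ^ n * measure M (E k)) \<le> ?c k" using f_norm_le[of k] by simp
  qed
  have g_int: "integrable M (\<lambda>x. 1 + (\<Sum>k. ?f k x))"
    using integrable_suminf[OF f_int f_sum f_sums] by simp
  have dom: "AE x in M. 0 \<le> 1 + lacunary_sum b E x \<and> (1 + lacunary_sum b E x) ^ n \<le> 1 + (\<Sum>k. ?f k x)"
    using fin
  proof eventually_elim
    case (elim x)
    let ?I = "{k. x \<in> E k}"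
    have f: "(\<Sum>k. ?f k x) = (\<Sum>k\<in>?I. B k ^ n)"
    proof -
      have "(\<Sum>k. ?f k x) = (\<Sum>k\<in>?I. ?f k x)" by (rule suminf_finite[OF elim]) simp
      also have "\<dots> = (\<Sum>k\<in>?I. B k ^ n)" by (rule sum.cong) auto
      finally show ?thesis .
    qed
    have nonneg: "0 \<le> 1 + (\<Sum>k\<in>?I. b k)" using b by (simp add: sum_nonneg add_nonneg_nonneg)
    have Bn: "0 \<le> B k ^ n" for k using B1[of k] by simp
    have "(1 + (\<Sum>k\<in>?I. b k)) ^ n \<le> 1 + (\<Sum>k\<in>?I. B k ^ n)"
    proof (cases "?I = {}")
      case False
      let ?K = "Max ?I"
      have "?K \<in> ?I" using elim False by (rule Max_in)
      have "(\<Sum>k\<in>?I. b k) \<le> (\<Sum>k\<le>?K. b k)"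
        using elim b by (intro sum_mono2) auto
      then have "(1 + (\<Sum>k\<in>?I. b k)) ^ n \<le> B ?K ^ n"
        unfolding B_def using nonneg by (intro power_mono) auto
      also have "\<dots> \<le> (\<Sum>k\<in>?I. B k ^ n)"
        using \<open>?K \<in> ?I\<close> elim Bn by (intro member_le_sum) auto
      finally show ?thesis by simp
    qed simp
    then show ?case using nonneg by (simp add: lacunary_sum_finite[OF elim] f)
  qed
  show int: "integrable M (\<lambda>x. (1 + lacunary_sum b E x) ^ n)"
  proof (rule Bochner_Integration.integrable_bound[OF g_int])
    show "AE x in M. norm ((1 + lacunary_sum b E x) ^ n) \<le> norm (1 + (\<Sum>k. ?f k x))"
      using dom by eventually_elim auto
  qed measurable
  have "(\<integral>x. (1 + lacunary_sum b E x) ^ n \<partial>M) \<le> (\<integral>x. 1 + (\<Sum>k. ?f k x) \<partial>M)"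
    by (rule integral_mono_AE[OF int g_int]) (use dom in eventually_elim, auto)
  also have "\<dots> = 1 + (\<Sum>k. \<integral>x. ?f k x \<partial>M)"
    using integrable_suminf[OF f_int f_sum f_sums] integral_suminf[OF f_int f_sum f_sums]
    by (simp add: prob_space)
  also have "(\<Sum>k. \<integral>x. ?f k x \<partial>M) \<le> suminf ?c"
    using f_norm_le c_summable summable_integral[OF f_int f_sum f_sums] by (intro suminf_le) auto
  finally show "(\<integral>x. (1 + lacunary_sum b E x) ^ n \<partial>M) \<le> lacunary_const b n"
    by (simp add: const)
qed

text \<open>The last two conditions allow one to pass to the limit when more and more rows are resampled.\<close>
definition observable :: "('k \<Rightarrow> real) \<Rightarrow> ((int \<times> 'k \<Rightarrow> bool) \<Rightarrow> real) \<Rightarrow> (int \<Rightarrow> real) \<Rightarrow> bool" where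
  "observable p F a \<longleftrightarrow> F \<in> borel_measurable (row_field p) \<and> integrable (row_field p) (\<lambda>\<omega>. (F \<omega>)\<^sup>2) \<and>
    (\<forall>j. 0 \<le> a j \<and> integrable (row_field p) (\<lambda>\<omega>. (F \<omega> - F (keep (- {j}) \<omega>))\<^sup>2) \<and>
      (\<integral>\<omega>. (F \<omega> - F (keep (- {j}) \<omega>))\<^sup>2 \<partial>row_field p) \<le> (a j)\<^sup>2) \<and>
    (\<exists>D. D \<in> borel_measurable (row_field p) \<and> integrable (row_field p) (\<lambda>\<omega>. (D \<omega>)\<^sup>2) \<and>
      (\<forall>J. AE \<omega> in double_field p. \<bar>F (mix J \<omega>)\<bar> \<le> D (mix {} \<omega>) + D (mix UNIV \<omega>))) \<and>
    (AE \<omega> in double_field p. (\<lambda>N. F (mix {- int N..int N} \<omega>)) \<longlonglongrightarrow> F (mix UNIV \<omega>))"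

lemma observableD:
  assumes "observable p F a"
  shows "F \<in> borel_measurable (row_field p)" "integrable (row_field p) (\<lambda>\<omega>. (F \<omega>)\<^sup>2)"
    "\<And>j. 0 \<le> a j" "\<And>j. integrable (row_field p) (\<lambda>\<omega>. (F \<omega> - F (keep (- {j}) \<omega>))\<^sup>2)"
    "\<And>j. (\<integral>\<omega>. (F \<omega> - F (keep (- {j}) \<omega>))\<^sup>2 \<partial>row_field p) \<le> (a j)\<^sup>2"
    "AE \<omega> in double_field p. (\<lambda>N. F (mix {- int N..int N} \<omega>)) \<longlonglongrightarrow> F (mix UNIV \<omega>)"
  using assms by (simp_all add: observable_def)

section \<open>Calculus of observables and the variance of Birkhoff sums\<close>

lemma keep_shift: "keep (- {j}) (shift n \<omega>) = shift n (keep (- {j + n}) \<omega>)"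
  by (auto simp: keep_def shift_def fun_eq_iff)

text \<open>Row \<open>j\<close> of the field is row \<open>j - n\<close> of the shifted field. So
  the influences of the shifted function are those of \<open>F\<close> translated by
  \<open>n\<close>, and a convolution appears.\<close>

lemma observable_covariance:
  assumes F: "observable p F a" and G: "observable p G b" and e: "0 < e"
  shows "\<forall>\<^sub>F N in sequentially.
    \<bar>Cov (row_field p) (\<lambda>\<omega>. F (shift n \<omega>)) G\<bar> \<le> 2 * (\<Sum>j\<in>{- int N..int N}. a (j - n) * b j) + e"
proof -
  let ?P = "row_field p"
  note [measurable] = observableD(1)[OF F] observableD(1)[OF G]
  obtain D where D: "D \<in> borel_measurable ?P" "integrable ?P (\<lambda>\<omega>. (D \<omega>)\<^sup>2)"
    "\<And>J. AE \<omega> in double_field p. \<bar>G (mix J \<omega>)\<bar> \<le> D (mix {} \<omega>) + D (mix UNIV \<omega>)"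
    using G unfolding observable_def by blast
  note tr = shift_integrable shift_integral
  have shift_keep: "shift n (keep (- {j}) \<omega>) = keep (- {j - n}) (shift n \<omega>)" for j \<omega>
    by (simp add: keep_shift)
  show ?thesis
  proof (rule covariance_bound[where D = D])
    show "integrable ?P (\<lambda>\<omega>. (F (shift n \<omega>))\<^sup>2)"
      using tr(1)[of "\<lambda>\<omega>. (F \<omega>)\<^sup>2"] observableD(2)[OF F] by simp
    show "integrable ?P (\<lambda>\<omega>. (F (shift n \<omega>) - F (shift n (keep (- {j}) \<omega>)))\<^sup>2)" for j
      unfolding shift_keep
      using tr(1)[of "\<lambda>\<omega>. (F \<omega> - F (keep (- {j - n}) \<omega>))\<^sup>2"] observableD(4)[OF F] by simp
    show "(\<integral>\<omega>. (F (shift n \<omega>) - F (shift n (keep (- {j}) \<omega>)))\<^sup>2 \<partial>?P) \<le> (a (j - n))\<^sup>2" for j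
      unfolding shift_keep
      using tr(2)[of "\<lambda>\<omega>. (F \<omega> - F (keep (- {j - n}) \<omega>))\<^sup>2"] observableD(5)[OF F, of "j - n"] by simp
  qed (use observableD[OF F] observableD[OF G] D e in auto)
qed

text \<open>The numbers \<open>a\<close> occur only in the influence bound, so a crude bound can be
  exchanged for a sharp one once the rest is verified: the original \<open>a\<close> after
  centering, the exact L2 norms for truncation errors.\<close>

lemma observable_refine:
  assumes "observable p F a" "\<And>j. 0 \<le> c j"
    "\<And>j. (\<integral>\<omega>. (F \<omega> - F (keep (- {j}) \<omega>))\<^sup>2 \<partial>row_field p) \<le> (c j)\<^sup>2"
  shows "observable p F c"
  using assms by (simp add: observable_def)

lemma observable_const: "observable p (\<lambda>_. c) (\<lambda>_. 0)"
proof -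
  interpret P: prob_space "row_field p" by (rule prob_space_bernoulli_field)
  show ?thesis unfolding observable_def
    by (auto intro!: exI[of _ "\<lambda>_. \<bar>c\<bar>"])
qed

lemma observable_diff:
  assumes F: "observable p F a" and G: "observable p G b"
  shows "observable p (\<lambda>\<omega>. F \<omega> - G \<omega>) (\<lambda>j. 2 * (a j + b j))"
proof -
  let ?P = "row_field p"
  note [measurable] = observableD(1)[OF F] observableD(1)[OF G]
  obtain D where D[measurable]: "D \<in> borel_measurable ?P" and D2: "integrable ?P (\<lambda>\<omega>. (D \<omega>)\<^sup>2)"
    and FD: "\<And>J. AE \<omega> in double_field p. \<bar>F (mix J \<omega>)\<bar> \<le> D (mix {} \<omega>) + D (mix UNIV \<omega>)"
    using F unfolding observable_def by blast
  obtain D' where D'[measurable]: "D' \<in> borel_measurable ?P" and D'2: "integrable ?P (\<lambda>\<omega>. (D' \<omega>)\<^sup>2)"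
    and GD: "\<And>J. AE \<omega> in double_field p. \<bar>G (mix J \<omega>)\<bar> \<le> D' (mix {} \<omega>) + D' (mix UNIV \<omega>)"
    using G unfolding observable_def by blast
  show ?thesis
    unfolding observable_def
  proof (intro conjI allI exI[of _ "\<lambda>\<omega>. D \<omega> + D' \<omega>"])
    show "integrable ?P (\<lambda>\<omega>. (F \<omega> - G \<omega>)\<^sup>2)"
      using observableD(2)[OF F] observableD(2)[OF G] by (intro square_integrable_diff) auto
    show "integrable ?P (\<lambda>\<omega>. (D \<omega> + D' \<omega>)\<^sup>2)"
      using D2 D'2 by (intro square_integrable_add) auto
    show "AE \<omega> in double_field p. \<bar>F (mix J \<omega>) - G (mix J \<omega>)\<bar>
        \<le> D (mix {} \<omega>) + D' (mix {} \<omega>) + (D (mix UNIV \<omega>) + D' (mix UNIV \<omega>))" for J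
      using FD[of J] GD[of J] by eventually_elim linarith
    show "AE \<omega> in double_field p. (\<lambda>N. F (mix {- int N..int N} \<omega>) - G (mix {- int N..int N} \<omega>))
        \<longlonglongrightarrow> F (mix UNIV \<omega>) - G (mix UNIV \<omega>)"
      using observableD(6)[OF F] observableD(6)[OF G] by eventually_elim (rule tendsto_diff)
    fix j
    let ?f = "\<lambda>\<omega>. F \<omega> - F (keep (- {j}) \<omega>)" and ?g = "\<lambda>\<omega>. G \<omega> - G (keep (- {j}) \<omega>)"
    have fg: "integrable ?P (\<lambda>\<omega>. (?f \<omega>)\<^sup>2)" "integrable ?P (\<lambda>\<omega>. (?g \<omega>)\<^sup>2)"
      by (rule observableD(4)[OF F] observableD(4)[OF G])+
    have eq: "F \<omega> - G \<omega> - (F (keep (- {j}) \<omega>) - G (keep (- {j}) \<omega>)) = ?f \<omega> - ?g \<omega>" for \<omega> by simp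
    have d: "integrable ?P (\<lambda>\<omega>. (?f \<omega> - ?g \<omega>)\<^sup>2)"
      by (rule square_integrable_diff[OF _ _ fg]) measurable
    then show "integrable ?P (\<lambda>\<omega>. (F \<omega> - G \<omega> - (F (keep (- {j}) \<omega>) - G (keep (- {j}) \<omega>)))\<^sup>2)"
      unfolding eq .
    show "0 \<le> 2 * (a j + b j)" using observableD(3)[OF F] observableD(3)[OF G] by simp
    have "(\<integral>\<omega>. (?f \<omega> - ?g \<omega>)\<^sup>2 \<partial>?P) \<le> (\<integral>\<omega>. 2 * (?f \<omega>)\<^sup>2 + 2 * (?g \<omega>)\<^sup>2 \<partial>?P)"
    proof (rule integral_mono[OF d])
      show "(?f \<omega> - ?g \<omega>)\<^sup>2 \<le> 2 * (?f \<omega>)\<^sup>2 + 2 * (?g \<omega>)\<^sup>2" for \<omega>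
      proof -
        have "(x - y)\<^sup>2 \<le> 2 * x\<^sup>2 + 2 * y\<^sup>2" for x y :: real
          using zero_le_power2[of "x + y"] by (simp add: power2_eq_square algebra_simps)
        then show ?thesis .
      qed
    qed (use fg in auto)
    also have "\<dots> = 2 * (\<integral>\<omega>. (?f \<omega>)\<^sup>2 \<partial>?P) + 2 * (\<integral>\<omega>. (?g \<omega>)\<^sup>2 \<partial>?P)"
      using fg by (subst Bochner_Integration.integral_add) auto
    also have "\<dots> \<le> 2 * (a j)\<^sup>2 + 2 * (b j)\<^sup>2"
      using observableD(5)[OF F, of j] observableD(5)[OF G, of j] by simp
    also have "\<dots> \<le> (2 * (a j + b j))\<^sup>2"
      using observableD(3)[OF F, of j] observableD(3)[OF G, of j]
      by (simp add: power2_eq_square algebra_simps)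
    finally show "(\<integral>\<omega>. (F \<omega> - G \<omega> - (F (keep (- {j}) \<omega>) - G (keep (- {j}) \<omega>)))\<^sup>2 \<partial>?P) \<le> (2 * (a j + b j))\<^sup>2"
      unfolding eq .
  qed measurable
qed

lemma observable_centered:
  assumes F: "observable p F a"
  shows "observable p (\<lambda>\<omega>. F \<omega> - c) a"
proof (rule observable_refine[OF observable_diff[OF F observable_const]])
  show "0 \<le> a j" for j by (rule observableD(3)[OF F])
  show "(\<integral>\<omega>. (F \<omega> - c - (F (keep (- {j}) \<omega>) - c))\<^sup>2 \<partial>row_field p) \<le> (a j)\<^sup>2" for j
    using observableD(5)[OF F, of j] by simp
qed

text \<open>Young's inequality for convolutions: the covariance at lag \<open>n\<close> is at most
  twice the correlation of \<eta> with its translate, and summing over lags gives at most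
  \<open>2 * E\<^sup>2\<close>. So each row of the covariance matrix has a bounded sum, whatever the
  set of times.\<close>

lemma observable_variance:
  assumes H: "observable p H \<eta>" and H0: "(\<integral>\<omega>. H \<omega> \<partial>row_field p) = 0"
    and E: "\<And>J. finite J \<Longrightarrow> sum \<eta> J \<le> E" and I: "finite (I :: nat set)"
  shows "(\<integral>\<omega>. (\<Sum>i\<in>I. H (shift (int i) \<omega>))\<^sup>2 \<partial>row_field p) \<le> 2 * E\<^sup>2 * card I"
proof -
  let ?P = "row_field p"
  interpret prob_space ?P by (rule prob_space_bernoulli_field)
  note [measurable] = observableD(1)[OF H]
  have E0: "0 \<le> E" using E[of "{}"] by simp
  note tr = shift_integrable shift_integral
  define c where "c n = Cov ?P (\<lambda>\<omega>. H (shift n \<omega>)) H" for n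
  have H2: "integrable ?P (\<lambda>\<omega>. (H (shift n \<omega>))\<^sup>2)" for n
    using tr(1)[of "\<lambda>\<omega>. (H \<omega>)\<^sup>2"] observableD(2)[OF H] by simp
  have prod_int: "integrable ?P (\<lambda>\<omega>. H (shift n \<omega>) * H (shift n' \<omega>))" for n n'
    by (rule product_integrable_of_squares[OF _ _ H2 H2]) measurable
  have prod: "(\<integral>\<omega>. H (shift n \<omega>) * H (shift n' \<omega>) \<partial>?P) = c (n - n')" for n n'
  proof -
    have "(\<integral>\<omega>. H (shift n \<omega>) * H (shift n' \<omega>) \<partial>?P)
        = (\<integral>\<omega>. (\<lambda>\<omega>. H (shift (n - n') \<omega>) * H \<omega>) (shift n' \<omega>) \<partial>?P)"
      by (simp add: shift_shift)
    also have "\<dots> = (\<integral>\<omega>. H (shift (n - n') \<omega>) * H \<omega> \<partial>?P)"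
      by (rule tr(2)) measurable
    finally show ?thesis by (simp add: c_def Cov_def H0)
  qed
  have row: "(\<Sum>i\<in>I. \<bar>c (int i - n)\<bar>) \<le> 2 * E\<^sup>2" for n
  proof (rule field_le_epsilon)
    fix e :: real assume "0 < e"
    \<comment> \<open>One error \<open>d\<close> for each of the \<open>card I\<close> covariances;
      together they stay below \<open>e\<close>.\<close>
    define d where "d = e / (card I + 1)"
    have d: "0 < d" using \<open>0 < e\<close> by (simp add: d_def)
    have "\<forall>\<^sub>F N in sequentially. \<forall>i\<in>I. \<bar>c (int i - n)\<bar> \<le> 2 * (\<Sum>j\<in>{- int N..int N}. \<eta> (j - (int i - n)) * \<eta> j) + d"
      unfolding c_def using observable_covariance[OF H H d] I by (simp add: eventually_ball_finite)
    then obtain N where N: "\<And>i. i \<in> I \<Longrightarrow> \<bar>c (int i - n)\<bar> \<le> 2 * (\<Sum>j\<in>{- int N..int N}. \<eta> (j - (int i - n)) * \<eta> j) + d"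
      using eventually_happens by force
    have "(\<Sum>i\<in>I. \<bar>c (int i - n)\<bar>) \<le> (\<Sum>i\<in>I. 2 * (\<Sum>j\<in>{- int N..int N}. \<eta> (j - (int i - n)) * \<eta> j) + d)"
      by (rule sum_mono[OF N])
    also have "\<dots> = 2 * (\<Sum>j\<in>{- int N..int N}. (\<Sum>i\<in>I. \<eta> (j - (int i - n))) * \<eta> j) + card I * d"
      by (simp add: sum.distrib sum_distrib_right sum_distrib_left sum.swap[of _ I])
    also have "\<dots> \<le> 2 * (\<Sum>j\<in>{- int N..int N}. E * \<eta> j) + card I * d"
    proof (intro add_mono mult_left_mono sum_mono mult_right_mono)
      fix j
      have "(\<Sum>i\<in>I. \<eta> (j - (int i - n))) = sum \<eta> ((\<lambda>i. j - (int i - n)) ` I)"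
        by (subst sum.reindex) (auto simp: inj_on_def)
      also have "\<dots> \<le> E" using I by (intro E) auto
      finally show "(\<Sum>i\<in>I. \<eta> (j - (int i - n))) \<le> E" .
    qed (use observableD(3)[OF H] in auto)
    also have "\<dots> \<le> 2 * (E * E) + e"
    proof (intro add_mono mult_left_mono)
      show "(\<Sum>j\<in>{- int N..int N}. E * \<eta> j) \<le> E * E"
        using E[of "{- int N..int N}"] E0 by (simp add: mult_left_mono flip: sum_distrib_left)
      show "card I * d \<le> e" using \<open>0 < e\<close> by (simp add: d_def field_simps)
    qed auto
    finally show "(\<Sum>i\<in>I. \<bar>c (int i - n)\<bar>) \<le> 2 * E\<^sup>2 + e" by (simp add: power2_eq_square)
  qed
  have "(\<integral>\<omega>. (\<Sum>i\<in>I. H (shift (int i) \<omega>))\<^sup>2 \<partial>?P)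
      = (\<integral>\<omega>. (\<Sum>i'\<in>I. \<Sum>i\<in>I. H (shift (int i) \<omega>) * H (shift (int i') \<omega>)) \<partial>?P)"
    by (simp add: power2_eq_square sum_product mult.commute)
  also have "\<dots> = (\<Sum>i'\<in>I. \<Sum>i\<in>I. c (int i - int i'))"
    by (simp add: prod_int prod)
  also have "\<dots> \<le> (\<Sum>i'\<in>I. \<Sum>i\<in>I. \<bar>c (int i - int i')\<bar>)"
    by (intro sum_mono) auto
  also have "\<dots> \<le> (\<Sum>i'\<in>I. 2 * E\<^sup>2)"
    by (intro sum_mono row)
  finally show ?thesis by (simp add: mult.commute)
qed

section \<open>The random vector\<close>

text \<open>A site \<open>(j, k)\<close> contributes the vector \<open>Y (j, k)\<close> with probability \<open>p k\<close>. Row \<open>j\<close> corresponds to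
  time, and \<open>k\<close> numbers the vectors of a dense set. The core \<open>{- N k..N k}\<close> is so large that
  the remaining sites with second component \<open>k\<close> always contribute at most \<open>2\<^sup>-\<^sup>k\<close>.\<close>
locale noise =
  fixes Y :: "int \<times> nat \<Rightarrow> 'a::{banach,second_countable_topology}"
    and N :: "nat \<Rightarrow> nat" and b p :: "nat \<Rightarrow> real" and w :: "int \<Rightarrow> real"
  assumes row_summable: "\<And>k. (\<lambda>j. Y (j, k)) summable_on UNIV"
    and tail: "\<And>k G. finite G \<Longrightarrow> (\<And>j. j \<in> G \<Longrightarrow> int (N k) < \<bar>j\<bar>) \<Longrightarrow> norm (\<Sum>j\<in>G. Y (j, k)) \<le> (1/2) ^ k"
    and b_core: "\<And>k. (\<Sum>j\<in>{- int (N k)..int (N k)}. norm (Y (j, k))) \<le> b k"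
    and N_ge: "\<And>k. k \<le> N k"
    and p_pos: "\<And>k. 0 < p k" and p_half: "\<And>k. p k \<le> 1/2"
    and p_small: "\<And>k. (2 * real (N k) + 1) * p k * (1 + (\<Sum>i\<le>k. b i)) ^ k \<le> (1/2) ^ (k + 1)"
    and w_nonneg: "\<And>j. 0 \<le> w j"
    and norm_Y: "\<And>j k. norm (Y (j, k)) \<le> b k * w j"
begin

abbreviation P :: "(int \<times> nat \<Rightarrow> bool) measure" where "P \<equiv> row_field p"

definition core :: "nat \<Rightarrow> int set" where "core k = {- int (N k)..int (N k)}"

definition hit :: "nat \<Rightarrow> (int \<times> nat \<Rightarrow> bool) set" where "hit k = {\<omega>. \<exists>j\<in>core k. \<omega> (j, k)}"

text \<open>Only finitely many core sites are active. The condition holds almost surely, survives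
  the removal of sites and passes from two copies to their mixtures, so the estimates can be made
  pathwise.\<close>

definition good :: "(int \<times> nat \<Rightarrow> bool) \<Rightarrow> bool" where "good \<omega> \<longleftrightarrow> finite {k. \<omega> \<in> hit k}"

text \<open>At good points \<open>2 + Z \<omega>\<close> majorizes the norm of
  \<open>V \<omega>\<close> and of its subseries, where 2 is the sum of the bounds
  \<open>(1/2)^k\<close> off the core; \<open>w j * Zrow j \<omega>\<close> majorizes the part of
  \<open>V \<omega>\<close> from row \<open>j\<close>.\<close>

definition Z :: "(int \<times> nat \<Rightarrow> bool) \<Rightarrow> real" where "Z = lacunary_sum b hit"

definition Zrow :: "int \<Rightarrow> (int \<times> nat \<Rightarrow> bool) \<Rightarrow> real" where
  "Zrow j = lacunary_sum b (\<lambda>k. {\<omega>. \<omega> (j, k)})"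

text \<open>As a limit of finite sums over growing boxes, \<open>V\<close> is measurable on the
  whole space; at good points it is the unordered sum over the active sites.\<close>

definition V :: "(int \<times> nat \<Rightarrow> bool) \<Rightarrow> 'a" where
  "V \<omega> = lim (\<lambda>n. \<Sum>i\<in>{- int n..int n} \<times> {..<n}. if \<omega> i then Y i else 0)"

lemma prob_space_P: "prob_space P"
  by (rule prob_space_bernoulli_field)

lemma finite_core [simp]: "finite (core k)"
  by (simp add: core_def)

lemma b_nonneg: "0 \<le> b k"
  by (rule order_trans[OF sum_nonneg b_core]) simp

lemma hit_sets [measurable]: "hit k \<in> sets P"
proof -
  have "hit k = {\<omega> \<in> space P. \<exists>j\<in>core k. \<omega> (j, k)}" by (simp add: hit_def)
  also have "\<dots> \<in> sets P" by measurable
  finally show ?thesis .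
qed

lemma row_sets [measurable]: "{\<omega>. \<omega> i} \<in> sets P"
proof -
  have "{\<omega> \<in> space P. \<omega> i} \<in> sets P" by measurable
  then show ?thesis by simp
qed

lemma prob_row: "measure P {\<omega>. \<omega> (j, k)} = p k"
  using prob_bernoulli_field_coord[of "\<lambda>i. p (snd i)" "(j, k)"] p_pos[of k] p_half[of k] by simp

text \<open>A union bound over the core sites, the origin of the factor \<open>2 * N k + 1\<close>
  in \<open>p_small\<close>.\<close>

lemma prob_hit: "measure P (hit k) \<le> (2 * real (N k) + 1) * p k"
proof -
  interpret prob_space P by (rule prob_space_P)
  have eq: "hit k = (\<Union>j\<in>core k. {\<omega>. \<omega> (j, k)})" by (auto simp: hit_def)
  have "(\<lambda>j. {\<omega>. \<omega> (j, k)}) ` core k \<subseteq> sets P" by (intro image_subsetI row_sets)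
  from finite_measure_subadditive_finite[OF finite_core this]
  have "measure P (hit k) \<le> (\<Sum>j\<in>core k. measure P {\<omega>. \<omega> (j, k)})"
    unfolding eq .
  also have "\<dots> = (2 * real (N k) + 1) * p k" by (simp add: prob_row core_def)
  finally show ?thesis .
qed

lemma one_plus_sum_b: "1 \<le> 1 + (\<Sum>i\<le>k. b i)"
  using b_nonneg by (simp add: sum_nonneg)

lemma prob_hit_le: "measure P (hit k) \<le> (1/2) ^ (k + 1)"
proof -
  have "measure P (hit k) * 1 \<le> (2 * real (N k) + 1) * p k * (1 + (\<Sum>i\<le>k. b i)) ^ k"
    using prob_hit[of k] one_plus_sum_b[of k] p_pos[of k] by (intro mult_mono) (auto intro: one_le_power)
  then show ?thesis using p_small[of k] by simp
qed

lemma hit_small: "measure P (hit k) * (1 + (\<Sum>i\<le>k. b i)) ^ k \<le> (1/2) ^ k"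
proof -
  have "measure P (hit k) * (1 + (\<Sum>i\<le>k. b i)) ^ k \<le> (2 * real (N k) + 1) * p k * (1 + (\<Sum>i\<le>k. b i)) ^ k"
    using prob_hit[of k] one_plus_sum_b[of k] by (intro mult_right_mono) auto
  also have "\<dots> \<le> (1/2) ^ (k + 1)" by (rule p_small)
  also have "\<dots> \<le> (1/2) ^ k" by simp
  finally show ?thesis .
qed

lemma row_small: "measure P {\<omega>. \<omega> (j, k)} * (1 + (\<Sum>i\<le>k. b i)) ^ k \<le> (1/2) ^ k"
proof -
  have "measure P {\<omega>. \<omega> (j, k)} * (1 + (\<Sum>i\<le>k. b i)) ^ k \<le> (2 * real (N k) + 1) * p k * (1 + (\<Sum>i\<le>k. b i)) ^ k"
    unfolding prob_row using p_pos[of k] one_plus_sum_b[of k] by (intro mult_right_mono) auto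
  also have "\<dots> \<le> (1/2) ^ (k + 1)" by (rule p_small)
  also have "\<dots> \<le> (1/2) ^ k" by simp
  finally show ?thesis .
qed

lemmas Z_moments = lacunary_moments[OF prob_space_P hit_sets b_nonneg hit_small, folded Z_def good_def]
lemmas Zrow_moments =
  lacunary_moments[where E = "\<lambda>k. {\<omega>. \<omega> (j, k)}" for j, OF prob_space_P row_sets b_nonneg row_small, folded Zrow_def]

lemma good_AE: "AE \<omega> in P. good \<omega>"
  by (rule Z_moments(1))

lemma Z_measurable [measurable]: "Z \<in> borel_measurable P"
  by (rule Z_moments(2))

lemma Zrow_measurable [measurable]: "Zrow j \<in> borel_measurable P"
  by (rule Zrow_moments(2))

lemma V_measurable [measurable]: "V \<in> borel_measurable P"
  unfolding V_def[abs_def] by measurable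

section \<open>Pathwise estimates at good points\<close>

lemma good_subset:
  assumes "good \<omega>" "\<And>i. \<omega>' i \<Longrightarrow> \<omega> i"
  shows "good \<omega>'"
  using assms(1) unfolding good_def
  by (rule rev_finite_subset) (use assms(2) in \<open>auto simp: hit_def\<close>)

lemma good_keep: "good \<omega> \<Longrightarrow> good (keep A \<omega>)"
  by (erule good_subset) (auto simp: keep_def)

lemma good_mix:
  assumes "good (mix {} \<omega>)" "good (mix UNIV \<omega>)"
  shows "good (mix J \<omega>)"
proof -
  have "{k. mix J \<omega> \<in> hit k} \<subseteq> {k. mix {} \<omega> \<in> hit k} \<union> {k. mix UNIV \<omega> \<in> hit k}"
    by (auto simp: hit_def mix_def) (metis (full_types))
  then show ?thesis using assms finite_subset unfolding good_def by blast
qed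

lemma Z_good: "good \<omega> \<Longrightarrow> Z \<omega> = (\<Sum>k\<in>{k. \<omega> \<in> hit k}. b k)"
  unfolding Z_def good_def by (rule lacunary_sum_finite)

lemma Z_nonneg: "good \<omega> \<Longrightarrow> 0 \<le> Z \<omega>"
  by (simp add: Z_good b_nonneg sum_nonneg)

text \<open>For \<open>k > |j|\<close> row \<open>j\<close> meets the core of \<open>k\<close>
  because \<open>N k \<ge> k\<close>, so an active site there is a hit, and a good point has
  finitely many hits.\<close>

lemma good_row_finite:
  assumes "good \<omega>"
  shows "finite {k. \<omega> (j, k)}"
proof -
  have "{k. \<omega> (j, k)} \<subseteq> {k. \<omega> \<in> hit k} \<union> {..nat \<bar>j\<bar>}"
  proof
    fix k assume "k \<in> {k. \<omega> (j, k)}"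
    then have "\<omega> \<in> hit k" if "nat \<bar>j\<bar> < k"
      using that N_ge[of k] by (force simp: hit_def core_def)
    then show "k \<in> {k. \<omega> \<in> hit k} \<union> {..nat \<bar>j\<bar>}" by (cases "nat \<bar>j\<bar> < k") auto
  qed
  then show ?thesis using assms finite_subset unfolding good_def by blast
qed

lemma Zrow_good: "good \<omega> \<Longrightarrow> Zrow j \<omega> = (\<Sum>k\<in>{k. \<omega> (j, k)}. b k)"
  unfolding Zrow_def using lacunary_sum_finite[of \<omega> "\<lambda>k. {\<omega>. \<omega> (j, k)}" b] good_row_finite[of \<omega> j] by simp

lemma Zrow_nonneg: "good \<omega> \<Longrightarrow> 0 \<le> Zrow j \<omega>"
  by (simp add: Zrow_good b_nonneg sum_nonneg)

text \<open>A hit in a mixture is a hit in one of the two copies. This dominates all interpolations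
  at once by functions of the single copies.\<close>

lemma Z_mix_le:
  assumes "good (mix {} \<omega>)" "good (mix UNIV \<omega>)"
  shows "Z (mix J \<omega>) \<le> Z (mix {} \<omega>) + Z (mix UNIV \<omega>)"
proof -
  let ?h = "\<lambda>\<omega>. {k. \<omega> \<in> hit k}"
  have fin: "finite (?h (mix {} \<omega>))" "finite (?h (mix UNIV \<omega>))" using assms by (auto simp: good_def)
  have sub: "?h (mix J \<omega>) \<subseteq> ?h (mix {} \<omega>) \<union> ?h (mix UNIV \<omega>)"
    by (auto simp: hit_def mix_def) (metis (full_types))
  have "Z (mix J \<omega>) \<le> (\<Sum>k\<in>?h (mix {} \<omega>) \<union> ?h (mix UNIV \<omega>). b k)"
    unfolding Z_good[OF good_mix[OF assms]] using fin sub b_nonneg by (intro sum_mono2) auto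
  also have "\<dots> \<le> (\<Sum>k\<in>?h (mix {} \<omega>). b k) + (\<Sum>k\<in>?h (mix UNIV \<omega>). b k)"
    using sum.union_inter[OF fin, of b] sum_nonneg[of "?h (mix {} \<omega>) \<inter> ?h (mix UNIV \<omega>)" b, OF b_nonneg] by linarith
  finally show ?thesis using assms by (simp add: Z_good)
qed

text \<open>The active core sites are finite in number and their norms add up to at most
  \<open>Z \<omega>\<close>. Off the core, finite partial sums with fixed \<open>k\<close> are at
  most \<open>(1/2)^k\<close> for every choice of sites, and these bounds sum to 2.\<close>

lemma good_summable:
  assumes "good \<omega>" "W \<subseteq> {i. \<omega> i}"
  shows "Y summable_on W" and "norm (infsum Y W) \<le> 2 + Z \<omega>"
proof -
  let ?C = "{(j, k). j \<in> core k}"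
  let ?h = "{k. \<omega> \<in> hit k}"
  let ?W = "Sigma ?h core"
  let ?B = "(\<lambda>(k, j). (j, k)) ` ?W"
  have fin: "finite ?h" using assms by (simp add: good_def)
  have sub: "W \<inter> ?C \<subseteq> ?B"
  proof
    fix i assume i: "i \<in> W \<inter> ?C"
    obtain j k where "i = (j, k)" by (cases i)
    with i assms(2) show "i \<in> ?B" by (auto simp: hit_def intro!: image_eqI[of _ _ "(k, j)"])
  qed
  have finB: "finite ?B" using fin by auto
  then have finC: "finite (W \<inter> ?C)" by (rule finite_subset[OF sub])
  have e: "(\<lambda>k. (1/2 :: real) ^ k) sums 2" using geometric_sums[of "1/2 :: real"] by simp
  have tail': "norm (\<Sum>j\<in>G. Y (j, k)) \<le> (1/2) ^ k" if "finite G" "\<And>j. j \<in> G \<Longrightarrow> (j, k) \<notin> ?C" for k G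
  proof (rule tail[OF that(1)])
    fix j assume "j \<in> G"
    then have "j \<notin> core k" using that(2) by auto
    then show "int (N k) < \<bar>j\<bar>" by (auto simp: core_def)
  qed
  have rest: "Y summable_on (W - ?C)" "norm (infsum Y (W - ?C)) \<le> 2"
  proof -
    note rows = summable_on_rows[where C = ?C and e = "\<lambda>k. (1/2) ^ k" and W = "W - ?C",
        OF row_summable _ sums_summable[OF e]]
    show "Y summable_on (W - ?C)" by (rule rows(1); (rule tail')?; blast)
    have "norm (infsum Y (W - ?C)) \<le> (\<Sum>k. (1/2) ^ k)" by (rule rows(2); (rule tail')?; blast)
    then show "norm (infsum Y (W - ?C)) \<le> 2" using sums_unique[OF e] by simp
  qed
  have "Y summable_on ((W \<inter> ?C) \<union> (W - ?C))"
    using rest(1) summable_on_finite[OF finC, of Y] by (intro summable_on_Un_disjoint) auto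
  then show "Y summable_on W" by (simp add: Int_Diff_Un)
  have "(W \<inter> ?C) \<inter> (W - ?C) = {}" by blast
  then have "infsum Y W = infsum Y (W \<inter> ?C) + infsum Y (W - ?C)"
    using infsum_Un_disjoint[of Y "W \<inter> ?C" "W - ?C"] rest(1) summable_on_finite[OF finC, of Y]
    by (simp add: Int_Diff_Un)
  moreover have "norm (infsum Y (W \<inter> ?C)) \<le> Z \<omega>"
  proof -
    have "norm (infsum Y (W \<inter> ?C)) \<le> (\<Sum>i\<in>W \<inter> ?C. norm (Y i))"
      using finC by (simp add: norm_sum)
    also have "\<dots> \<le> (\<Sum>i\<in>?B. norm (Y i))" using sub finB by (intro sum_mono2) auto
    also have "\<dots> = (\<Sum>i\<in>?W. norm (Y (snd i, fst i)))"
      by (subst sum.reindex) (auto simp: inj_on_def case_prod_beta)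
    also have "\<dots> = (\<Sum>k\<in>?h. \<Sum>j\<in>core k. norm (Y (j, k)))"
      using fin by (subst sum.Sigma) (auto simp: case_prod_beta)
    also have "\<dots> \<le> (\<Sum>k\<in>?h. b k)" using b_core by (intro sum_mono) (simp add: core_def)
    finally show ?thesis using assms by (simp add: Z_good)
  qed
  ultimately show "norm (infsum Y W) \<le> 2 + Z \<omega>"
    using rest(2) norm_triangle_ineq[of "infsum Y (W \<inter> ?C)" "infsum Y (W - ?C)"] by simp
qed

lemma V_good:
  assumes "good \<omega>"
  shows "V \<omega> = infsum Y {i. \<omega> i}"
proof -
  let ?box = "\<lambda>n. {- int n..int n} \<times> {..<n}"
  have "(\<lambda>n. infsum Y (?box n \<inter> {i. \<omega> i})) \<longlonglongrightarrow> infsum Y {i. \<omega> i}"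
  proof (rule infsum_tendsto_exhaustion[OF good_summable(1)[OF assms]])
    fix i :: "int \<times> nat" assume i: "i \<in> {i. \<omega> i}"
    obtain j k where jk: "i = (j, k)" by (cases i)
    show "\<forall>\<^sub>F n in sequentially. i \<in> ?box n \<inter> {i. \<omega> i}"
      using eventually_ge_at_top[of "max (nat \<bar>j\<bar>) (Suc k)"] by eventually_elim (use i jk in auto)
  qed auto
  moreover have "infsum Y (?box n \<inter> {i. \<omega> i}) = (\<Sum>i\<in>?box n. if \<omega> i then Y i else 0)" for n
    by (simp add: sum.inter_restrict)
  ultimately show ?thesis unfolding V_def by (simp add: limI)
qed

lemma V_keep:
  assumes "good \<omega>"
  shows "V (keep A \<omega>) = infsum Y {i. \<omega> i \<and> fst i \<in> A}"
  unfolding V_good[OF good_keep[OF assms]]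
  by (rule arg_cong[of _ _ "infsum Y"]) (auto simp: keep_def)

lemma norm_V_keep:
  assumes "good \<omega>"
  shows "norm (V (keep A \<omega>)) \<le> 2 + Z \<omega>"
  unfolding V_keep[OF assms] by (rule good_summable(2)[OF assms]) auto

lemma keep_UNIV [simp]: "keep UNIV \<omega> = \<omega>"
  by (simp add: keep_def)

lemma keep_keep [simp]: "keep A (keep B \<omega>) = keep (A \<inter> B) \<omega>"
  by (auto simp: keep_def fun_eq_iff)

lemma V_keep_Un:
  assumes "good \<omega>" "A \<inter> B = {}"
  shows "V (keep (A \<union> B) \<omega>) = V (keep A \<omega>) + V (keep B \<omega>)"
proof -
  have "infsum Y ({i. \<omega> i \<and> fst i \<in> A} \<union> {i. \<omega> i \<and> fst i \<in> B})
      = infsum Y {i. \<omega> i \<and> fst i \<in> A} + infsum Y {i. \<omega> i \<and> fst i \<in> B}"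
    by (rule infsum_Un_disjoint) (use assms in \<open>auto intro!: good_summable(1)\<close>)
  moreover have "{i. \<omega> i \<and> fst i \<in> A} \<union> {i. \<omega> i \<and> fst i \<in> B} = {i. \<omega> i \<and> fst i \<in> A \<union> B}" by auto
  ultimately show ?thesis using assms(1) by (simp only: V_keep)
qed

lemma norm_V_row:
  assumes "good \<omega>"
  shows "norm (V (keep {j} \<omega>)) \<le> w j * Zrow j \<omega>"
proof -
  let ?K = "{k. \<omega> (j, k)}"
  have fin: "finite ?K" by (rule good_row_finite[OF assms])
  have "{i. \<omega> i \<and> fst i \<in> {j}} = Pair j ` ?K" by auto
  then have "V (keep {j} \<omega>) = (\<Sum>k\<in>?K. Y (j, k))"
    using fin by (simp add: V_keep[OF assms] sum.reindex inj_on_def)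
  also have "norm \<dots> \<le> (\<Sum>k\<in>?K. b k * w j)" by (rule sum_norm_le) (rule norm_Y)
  finally show ?thesis using assms by (simp add: Zrow_good mult.commute sum_distrib_left)
qed

lemma V_keep_tendsto:
  assumes "good \<omega>"
  shows "(\<lambda>n. V (keep (A \<inter> {- int n..int n}) \<omega>)) \<longlonglongrightarrow> V (keep A \<omega>)"
  unfolding V_keep[OF assms]
proof (rule infsum_tendsto_exhaustion)
  show "Y summable_on {i. \<omega> i \<and> fst i \<in> A}" by (rule good_summable(1)[OF assms]) auto
  fix i assume i: "i \<in> {i. \<omega> i \<and> fst i \<in> A}"
  show "\<forall>\<^sub>F n in sequentially. i \<in> {i. \<omega> i \<and> fst i \<in> A \<inter> {- int n..int n}}"
    using eventually_ge_at_top[of "nat \<bar>fst i\<bar>"] by eventually_elim (use i in auto)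
qed auto

text \<open>Inside the window the mixture is the new copy, outside the old one; the part of the old
  copy outside the window is a vanishing tail of a convergent series.\<close>

lemma V_mix_tendsto:
  assumes l: "good (mix {} \<omega>)" and r: "good (mix UNIV \<omega>)"
  shows "(\<lambda>n. V (keep A (mix {- int n..int n} \<omega>))) \<longlonglongrightarrow> V (keep A (mix UNIV \<omega>))"
proof -
  let ?I = "\<lambda>n. {- int n..int n}"
  have "V (keep A (mix (?I n) \<omega>))
      = V (keep (A \<inter> ?I n) (mix UNIV \<omega>)) + (V (keep A (mix {} \<omega>)) - V (keep (A \<inter> ?I n) (mix {} \<omega>)))" for n
  proof -
    have "keep (A \<inter> ?I n) (mix (?I n) \<omega>) = keep (A \<inter> ?I n) (mix UNIV \<omega>)"
      "keep (A - ?I n) (mix (?I n) \<omega>) = keep (A - ?I n) (mix {} \<omega>)"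
      by (auto simp: keep_def mix_def fun_eq_iff)
    moreover have "V (keep A \<omega>') = V (keep (A \<inter> ?I n) \<omega>') + V (keep (A - ?I n) \<omega>')" if "good \<omega>'" for \<omega>'
      using V_keep_Un[OF that, of "A \<inter> ?I n" "A - ?I n"] by (simp add: Int_Diff_Un Int_Diff_disjoint)
    ultimately show ?thesis using good_mix[OF l r] l by simp
  qed
  moreover have "(\<lambda>n. V (keep (A \<inter> ?I n) (mix UNIV \<omega>)) + (V (keep A (mix {} \<omega>)) - V (keep (A \<inter> ?I n) (mix {} \<omega>))))
      \<longlonglongrightarrow> V (keep A (mix UNIV \<omega>)) + (V (keep A (mix {} \<omega>)) - V (keep A (mix {} \<omega>)))"
    by (intro tendsto_intros V_keep_tendsto l r)
  ultimately show ?thesis by simp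
qed

section \<open>Moments and influence constants\<close>

lemma lacunary_const_nonneg: "0 \<le> lacunary_const b (2 * n)"
proof -
  have "0 \<le> (\<integral>\<omega>. (1 + Z \<omega>) ^ (2 * n) \<partial>P)" by (intro integral_nonneg_AE) (simp add: zero_le_even_power)
  also have "\<dots> \<le> lacunary_const b (2 * n)" by (rule Z_moments(4))
  finally show ?thesis .
qed

text \<open>\<open>5 ^ d\<close> stems from
  \<open>1 + norm x + norm h \<le> 5 * (1 + Z \<omega>)\<close>, as both norms are at most
  \<open>2 + Z \<omega>\<close>; the root bounds the L2 norm of \<open>weight d j\<close>.\<close>

definition influence :: "real \<Rightarrow> nat \<Rightarrow> real" where
  "influence C d = C * 5 ^ d * sqrt (lacunary_const b 4 + lacunary_const b (4 * d))"

lemma influence_nonneg: "0 \<le> C \<Longrightarrow> 0 \<le> influence C d"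
  using lacunary_const_nonneg[of 2] lacunary_const_nonneg[of "2 * d"] by (simp add: influence_def)

abbreviation weight :: "nat \<Rightarrow> int \<Rightarrow> (int \<times> nat \<Rightarrow> bool) \<Rightarrow> real" where
  "weight d j \<omega> \<equiv> (1 + Zrow j \<omega>) * (1 + Z \<omega>) ^ d"

text \<open>\<open>Zrow j\<close> and \<open>Z\<close> are dependent, so the product is split by
  \<open>(x * y)^2 \<le> x^4 + y^4\<close> at the cost of higher moments. The bound is free of
  \<open>j\<close>, since all rows have the same law.\<close>

lemma weight_bound:
  "integrable P (\<lambda>\<omega>. (weight d j \<omega>)\<^sup>2)"
  "(\<integral>\<omega>. (weight d j \<omega>)\<^sup>2 \<partial>P) \<le> lacunary_const b 4 + lacunary_const b (4 * d)"
proof -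
  have dom_int: "integrable P (\<lambda>\<omega>. (1 + Zrow j \<omega>) ^ 4 + (1 + Z \<omega>) ^ (4 * d))"
    by (intro Bochner_Integration.integrable_add Z_moments(3) Zrow_moments(3))
  have le: "(weight d j \<omega>)\<^sup>2 \<le> (1 + Zrow j \<omega>) ^ 4 + (1 + Z \<omega>) ^ (4 * d)" for \<omega>
  proof -
    have "(x * y)\<^sup>2 \<le> x ^ 4 + y ^ 4" for x y :: real
    proof -
      have "2 * (x\<^sup>2 * y\<^sup>2) \<le> (x\<^sup>2)\<^sup>2 + (y\<^sup>2)\<^sup>2" using sum_squares_bound[of "x\<^sup>2" "y\<^sup>2"] by simp
      moreover have "0 \<le> x\<^sup>2 * y\<^sup>2" by simp
      ultimately have "x\<^sup>2 * y\<^sup>2 \<le> (x\<^sup>2)\<^sup>2 + (y\<^sup>2)\<^sup>2" by linarith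
      then show ?thesis unfolding power_mult_distrib by (simp flip: power_mult)
    qed
    from this[of "1 + Zrow j \<omega>" "(1 + Z \<omega>) ^ d"] show ?thesis by (simp add: mult.commute flip: power_mult)
  qed
  show int: "integrable P (\<lambda>\<omega>. (weight d j \<omega>)\<^sup>2)"
    by (rule Bochner_Integration.integrable_bound[OF dom_int]) (auto intro!: AE_I2 order_trans[OF le])
  have "(\<integral>\<omega>. (weight d j \<omega>)\<^sup>2 \<partial>P) \<le> (\<integral>\<omega>. (1 + Zrow j \<omega>) ^ 4 + (1 + Z \<omega>) ^ (4 * d) \<partial>P)"
    by (rule integral_mono[OF int dom_int le])
  also have "\<dots> \<le> lacunary_const b 4 + lacunary_const b (4 * d)"
    using Z_moments(3,4)[of "4 * d"] Zrow_moments(3,4)[of j 4] by simp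
  finally show "(\<integral>\<omega>. (weight d j \<omega>)\<^sup>2 \<partial>P) \<le> lacunary_const b 4 + lacunary_const b (4 * d)" .
qed

section \<open>Functions with polynomially bounded increments\<close>

context
  fixes f :: "'a \<Rightarrow> real" and C :: real and d :: nat
  assumes C: "0 \<le> C"
    and f: "\<And>x h. \<bar>f (x + h) - f x\<bar> \<le> C * norm h * (1 + norm x + norm h) ^ d"
begin

lemma diff_bound_continuous: "continuous_on UNIV f"
  by (rule continuous_on_of_diff_bound[OF f])

lemma diff_bound_measurable: "f \<in> borel_measurable borel"
  by (rule borel_measurable_continuous_onI[OF diff_bound_continuous])

text \<open>\<open>x\<close> collects the rows of \<open>A\<close> other than \<open>j\<close>, and
  \<open>h\<close> is row \<open>j\<close>, which carries the small factor \<open>w j\<close>. The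
  set \<open>A\<close> lets one estimate serve \<open>V\<close> and all its truncations.\<close>

lemma increment_bound:
  assumes "good \<omega>"
  shows "\<bar>f (V (keep A \<omega>)) - f (V (keep (A \<inter> - {j}) \<omega>))\<bar> \<le> C * 5 ^ d * w j * weight d j \<omega>"
proof -
  have nonneg: "0 \<le> Z \<omega>" "0 \<le> Zrow j \<omega>" "0 \<le> w j"
    using Z_nonneg[OF assms] Zrow_nonneg[OF assms] w_nonneg by auto
  show ?thesis
  proof (cases "j \<in> A")
    case True
    then have A: "(A \<inter> - {j}) \<union> {j} = A" by auto
    let ?x = "V (keep (A \<inter> - {j}) \<omega>)" and ?h = "V (keep {j} \<omega>)"
    have "V (keep A \<omega>) = ?x + ?h"
      using V_keep_Un[OF assms, of "A \<inter> - {j}" "{j}"] unfolding A by simp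
    then have "\<bar>f (V (keep A \<omega>)) - f ?x\<bar> \<le> C * norm ?h * (1 + norm ?x + norm ?h) ^ d"
      using f[of ?x ?h] by simp
    also have "\<dots> \<le> C * (w j * (1 + Zrow j \<omega>)) * (5 * (1 + Z \<omega>)) ^ d"
    proof (intro mult_mono mult_left_mono power_mono C)
      have "w j * Zrow j \<omega> \<le> w j * (1 + Zrow j \<omega>)" using nonneg by (intro mult_left_mono) auto
      then show "norm ?h \<le> w j * (1 + Zrow j \<omega>)" using norm_V_row[OF assms, of j] by simp
      show "1 + norm ?x + norm ?h \<le> 5 * (1 + Z \<omega>)"
        using norm_V_keep[OF assms, of "A \<inter> - {j}"] norm_V_keep[OF assms, of "{j}"] nonneg by simp
    qed (use C nonneg in auto)
    also have "\<dots> = C * 5 ^ d * w j * weight d j \<omega>"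
      by (simp only: power_mult_distrib mult.assoc mult.commute mult.left_commute)
    finally show ?thesis .
  next
    case False
    then have "A \<inter> - {j} = A" by auto
    then show ?thesis using nonneg C by simp
  qed
qed

lemma growth_bound:
  assumes "good \<omega>"
  shows "\<bar>f (V (keep A \<omega>))\<bar> \<le> (\<bar>f 0\<bar> + 2 * C * 3 ^ d) * (1 + Z \<omega>) ^ (d + 1)"
proof -
  let ?x = "V (keep A \<omega>)"
  have Z: "0 \<le> Z \<omega>" by (rule Z_nonneg[OF assms])
  have x: "norm ?x \<le> 2 * (1 + Z \<omega>)" "1 + norm ?x \<le> 3 * (1 + Z \<omega>)" using norm_V_keep[OF assms, of A] Z by auto
  have "\<bar>f ?x\<bar> \<le> \<bar>f 0\<bar> + C * norm ?x * (1 + norm ?x) ^ d" using f[of 0 ?x] by simp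
  also have "C * norm ?x * (1 + norm ?x) ^ d \<le> C * (2 * (1 + Z \<omega>)) * (3 * (1 + Z \<omega>)) ^ d"
    using x Z C by (intro mult_mono mult_left_mono power_mono) auto
  also have "\<dots> = 2 * C * 3 ^ d * (1 + Z \<omega>) ^ (d + 1)"
    by (simp only: power_mult_distrib power_add power_one_right mult.assoc mult.commute mult.left_commute)
  also have "\<bar>f 0\<bar> \<le> \<bar>f 0\<bar> * (1 + Z \<omega>) ^ (d + 1)"
    using Z mult_left_mono[of 1 "(1 + Z \<omega>) ^ (d + 1)" "\<bar>f 0\<bar>"] by (simp add: one_le_power del: power_Suc)
  finally show ?thesis by (simp add: distrib_right)
qed

text \<open>The influence bound is the same for every set \<open>A\<close> of rows, which makes the
  comparison of \<open>V\<close> with its truncations uniform.\<close>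

lemma polynomial_observable: "observable p (\<lambda>\<omega>. f (V (keep A \<omega>))) (\<lambda>j. influence C d * w j)"
  unfolding observable_def
proof (intro conjI allI)
  let ?F = "\<lambda>\<omega>. f (V (keep A \<omega>))"
  let ?M = "\<bar>f 0\<bar> + 2 * C * 3 ^ d"
  have M: "0 \<le> ?M" using C by simp
  note [measurable] = diff_bound_measurable
  show F[measurable]: "?F \<in> borel_measurable P" by measurable
  show "integrable P (\<lambda>\<omega>. (?F \<omega>)\<^sup>2)"
  proof (rule Bochner_Integration.integrable_bound)
    show "integrable P (\<lambda>\<omega>. ?M\<^sup>2 * (1 + Z \<omega>) ^ (2 * (d + 1)))"
      by (intro integrable_mult_right Z_moments(3))
    show "AE \<omega> in P. norm ((?F \<omega>)\<^sup>2) \<le> norm (?M\<^sup>2 * (1 + Z \<omega>) ^ (2 * (d + 1)))"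
      using good_AE
    proof eventually_elim
      case (elim \<omega>)
      have "(?F \<omega>)\<^sup>2 \<le> (?M * (1 + Z \<omega>) ^ (d + 1))\<^sup>2"
        using power_mono[OF growth_bound[OF elim, of A] abs_ge_zero, of 2] by (simp only: power2_abs)
      also have "\<dots> = ?M\<^sup>2 * (1 + Z \<omega>) ^ (2 * (d + 1))"
        by (simp only: power_mult_distrib power_mult[symmetric] mult.commute[of 2])
      finally show ?case by simp
    qed
  qed measurable
  show "0 \<le> influence C d * w j" for j using influence_nonneg[OF C] w_nonneg by simp
  have inc: "AE \<omega> in P. (?F \<omega> - ?F (keep (- {j}) \<omega>))\<^sup>2 \<le> (C * 5 ^ d * w j)\<^sup>2 * (weight d j \<omega>)\<^sup>2" for j
    using good_AE
  proof eventually_elim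
    case (elim \<omega>)
    have "\<bar>?F \<omega> - ?F (keep (- {j}) \<omega>)\<bar>\<^sup>2 \<le> (C * 5 ^ d * w j * weight d j \<omega>)\<^sup>2"
      using increment_bound[OF elim, of A j] by (intro power_mono) (auto simp: keep_keep)
    then show ?case by (simp add: power_mult_distrib)
  qed
  have dom: "integrable P (\<lambda>\<omega>. (C * 5 ^ d * w j)\<^sup>2 * (weight d j \<omega>)\<^sup>2)" for j
    by (intro integrable_mult_right weight_bound(1))
  show int: "integrable P (\<lambda>\<omega>. (?F \<omega> - ?F (keep (- {j}) \<omega>))\<^sup>2)" for j
  proof (rule Bochner_Integration.integrable_bound[OF dom[of j]])
    show "AE \<omega> in P. norm ((?F \<omega> - ?F (keep (- {j}) \<omega>))\<^sup>2) \<le> norm ((C * 5 ^ d * w j)\<^sup>2 * (weight d j \<omega>)\<^sup>2)"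
      using inc[of j] by eventually_elim simp
  qed measurable
  show "(\<integral>\<omega>. (?F \<omega> - ?F (keep (- {j}) \<omega>))\<^sup>2 \<partial>P) \<le> (influence C d * w j)\<^sup>2" for j
  proof -
    have "(\<integral>\<omega>. (?F \<omega> - ?F (keep (- {j}) \<omega>))\<^sup>2 \<partial>P) \<le> (\<integral>\<omega>. (C * 5 ^ d * w j)\<^sup>2 * (weight d j \<omega>)\<^sup>2 \<partial>P)"
      by (rule integral_mono_AE[OF int dom inc])
    also have "\<dots> = (C * 5 ^ d * w j)\<^sup>2 * (\<integral>\<omega>. (weight d j \<omega>)\<^sup>2 \<partial>P)" by simp
    also have "\<dots> \<le> (C * 5 ^ d * w j)\<^sup>2 * (lacunary_const b 4 + lacunary_const b (4 * d))"
      by (intro mult_left_mono weight_bound(2)) simp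
    also have "\<dots> = (influence C d * w j)\<^sup>2"
      using lacunary_const_nonneg[of 2] lacunary_const_nonneg[of "2 * d"]
      by (simp add: influence_def power_mult_distrib)
    finally show ?thesis .
  qed
  have good2: "AE \<omega> in double_field p. good (mix {} \<omega>) \<and> good (mix UNIV \<omega>)"
    by (intro AE_conjI measure_preserving_map_AE[OF measure_preserving_mix good_AE])
  \<comment> \<open>For a mixture \<open>1 + Z\<close> is at most twice the larger of the values at
    the two copies. This gives \<open>2 ^ (d + 1)\<close>, and the larger power is at most the sum
    of both.\<close>
  let ?D = "\<lambda>\<omega>. ?M * 2 ^ (d + 1) * (1 + Z \<omega>) ^ (d + 1)"
  show "\<exists>D. D \<in> borel_measurable P \<and> integrable P (\<lambda>\<omega>. (D \<omega>)\<^sup>2) \<and>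
      (\<forall>J. AE \<omega> in double_field p. \<bar>?F (mix J \<omega>)\<bar> \<le> D (mix {} \<omega>) + D (mix UNIV \<omega>))"
  proof (intro exI[of _ ?D] conjI allI)
    show "?D \<in> borel_measurable P" by measurable
    have "(?D \<omega>)\<^sup>2 = (?M * 2 ^ (d + 1))\<^sup>2 * (1 + Z \<omega>) ^ (2 * (d + 1))" for \<omega>
      by (simp only: power_mult_distrib power_mult[symmetric] mult.commute[of 2])
    then show "integrable P (\<lambda>\<omega>. (?D \<omega>)\<^sup>2)"
      using Z_moments(3)[of "2 * (d + 1)"] by (simp only: integrable_mult_right)
    show "AE \<omega> in double_field p. \<bar>?F (mix J \<omega>)\<bar> \<le> ?D (mix {} \<omega>) + ?D (mix UNIV \<omega>)" for J
      using good2
    proof eventually_elim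
      case (elim \<omega>)
      then have g: "good (mix {} \<omega>)" "good (mix UNIV \<omega>)" by auto
      let ?x = "1 + Z (mix {} \<omega>)" and ?y = "1 + Z (mix UNIV \<omega>)"
      have xy: "0 \<le> ?x" "0 \<le> ?y" using Z_nonneg[OF g(1)] Z_nonneg[OF g(2)] by auto
      have "(1 + Z (mix J \<omega>)) ^ (d + 1) \<le> (2 * max ?x ?y) ^ (d + 1)"
        using Z_mix_le[OF g, of J] Z_nonneg[OF good_mix[OF g, of J]]
        by (intro power_mono) (auto simp: max_def)
      also have "\<dots> = 2 ^ (d + 1) * max ?x ?y ^ (d + 1)" by (rule power_mult_distrib)
      also have "max ?x ?y ^ (d + 1) \<le> ?x ^ (d + 1) + ?y ^ (d + 1)"
        using xy by (simp add: max_def del: power_Suc)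
      finally have "(1 + Z (mix J \<omega>)) ^ (d + 1) \<le> 2 ^ (d + 1) * (?x ^ (d + 1) + ?y ^ (d + 1))" by simp
      from order_trans[OF growth_bound[OF good_mix[OF g]] mult_left_mono[OF this M]]
      show ?case by (simp add: algebra_simps)
    qed
  qed
  show "AE \<omega> in double_field p. (\<lambda>n. ?F (mix {- int n..int n} \<omega>)) \<longlonglongrightarrow> ?F (mix UNIV \<omega>)"
    using good2
  proof eventually_elim
    case (elim \<omega>)
    then have "(\<lambda>n. V (keep A (mix {- int n..int n} \<omega>))) \<longlonglongrightarrow> V (keep A (mix UNIV \<omega>))"
      by (intro V_mix_tendsto) auto
    then show ?case by (rule continuous_on_tendsto_compose[OF diff_bound_continuous]) auto
  qed
qed

text \<open>Dominated convergence for a single row, with twice the increment bound as majorant for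
  all \<open>m\<close>. There is no rate in \<open>m\<close>; summability of \<open>w\<close> over
  the rows will compensate for this.\<close>

lemma truncation_influence_tendsto:
  "(\<lambda>m. \<integral>\<omega>. ((f (V \<omega>) - f (V (keep {- int m..int m} \<omega>)))
      - (f (V (keep (- {j}) \<omega>)) - f (V (keep {- int m..int m} (keep (- {j}) \<omega>)))))\<^sup>2 \<partial>P) \<longlonglongrightarrow> 0"
proof -
  let ?I = "\<lambda>m. {- int m..int m}"
  let ?H = "\<lambda>m \<omega>. (f (V \<omega>) - f (V (keep (?I m) \<omega>))) - (f (V (keep (- {j}) \<omega>)) - f (V (keep (?I m) (keep (- {j}) \<omega>))))"
  let ?c = "2 * (C * 5 ^ d * w j)"
  note [measurable] = diff_bound_measurable
  have "(\<lambda>m. \<integral>\<omega>. (?H m \<omega>)\<^sup>2 \<partial>P) \<longlonglongrightarrow> (\<integral>\<omega>. 0 \<partial>P)"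
  proof (rule integral_dominated_convergence[where w = "\<lambda>\<omega>. ?c\<^sup>2 * (weight d j \<omega>)\<^sup>2"])
    show "integrable P (\<lambda>\<omega>. ?c\<^sup>2 * (weight d j \<omega>)\<^sup>2)"
      by (intro integrable_mult_right weight_bound(1))
    show "AE \<omega> in P. (\<lambda>m. (?H m \<omega>)\<^sup>2) \<longlonglongrightarrow> 0"
      using good_AE
    proof eventually_elim
      case (elim \<omega>)
      have lim: "(\<lambda>m. f (V (keep (?I m) \<omega>'))) \<longlonglongrightarrow> f (V \<omega>')" if "good \<omega>'" for \<omega>'
        using V_keep_tendsto[OF that, of UNIV]
        by (intro continuous_on_tendsto_compose[OF diff_bound_continuous]) auto
      have "(\<lambda>m. (?H m \<omega>)\<^sup>2) \<longlonglongrightarrow> ((f (V \<omega>) - f (V \<omega>)) - (f (V (keep (- {j}) \<omega>)) - f (V (keep (- {j}) \<omega>))))\<^sup>2"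
        by (intro tendsto_intros lim good_keep elim)
      then show ?case by simp
    qed
    show "AE \<omega> in P. norm ((?H m \<omega>)\<^sup>2) \<le> ?c\<^sup>2 * (weight d j \<omega>)\<^sup>2" for m
      using good_AE
    proof eventually_elim
      case (elim \<omega>)
      have "\<bar>?H m \<omega>\<bar> \<le> ?c * weight d j \<omega>"
        using increment_bound[OF elim, of UNIV j] increment_bound[OF elim, of "?I m" j] by simp
      then have "\<bar>?H m \<omega>\<bar>\<^sup>2 \<le> (?c * weight d j \<omega>)\<^sup>2" by (intro power_mono) auto
      then show ?case by (simp add: power_mult_distrib)
    qed
  qed measurable
  then show ?thesis by simp
qed

text \<open>The influences of the truncation error tend to 0 row by row and are dominated by
  \<open>4 * influence C d * w j\<close>. As \<open>w\<close> is summable, their total tends to 0,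
  and \<open>observable_variance\<close> turns the total into a bound on Birkhoff sums of every
  length.\<close>

lemma polynomial_clt:
  assumes w: "w summable_on UNIV" and mean: "(\<integral>\<omega>. f (V \<omega>) \<partial>P) = 0"
  shows "\<exists>\<sigma>\<ge>0. weak_conv_m (\<lambda>n. distr P borel (\<lambda>\<omega>. (\<Sum>i<n. f (V (shift (int i) \<omega>))) / sqrt n))
      (distr std_normal_distribution borel (\<lambda>t. \<sigma> * t))"
proof (rule clt_row_field[where F = "\<lambda>\<omega>. f (V \<omega>)"])
  interpret prob_space P by (rule prob_space_P)
  let ?I = "\<lambda>m. {- int m..int m}"
  let ?k = "influence C d" and ?W = "infsum w UNIV"
  have k: "0 \<le> ?k" by (rule influence_nonneg[OF C])
  have obs: "observable p (\<lambda>\<omega>. f (V \<omega>)) (\<lambda>j. ?k * w j)"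
    using polynomial_observable[of UNIV] by simp
  then show "(\<lambda>\<omega>. f (V \<omega>)) \<in> borel_measurable P" "integrable P (\<lambda>\<omega>. (f (V \<omega>))\<^sup>2)"
    by (rule observableD)+
  have sum_w: "sum w J \<le> ?W" if "finite J" for J
    using w that w_nonneg by (intro finite_sum_le_infsum) auto
  define c where "c m = (\<integral>\<omega>. f (V (keep (?I m) \<omega>)) \<partial>P)" for m
  define G where "G m \<omega> = f (V (keep (?I m) \<omega>)) - c m" for m \<omega>
  define H where "H m \<omega> = f (V \<omega>) - G m \<omega>" for m \<omega>
  have G_obs: "observable p (G m) (\<lambda>j. ?k * w j)" for m
    unfolding G_def by (intro observable_centered polynomial_observable)
  have int1: "integrable P F" if "observable p F a" for F a
    using square_integrable_imp_integrable[OF _ observableD(2)[OF that]] observableD(1)[OF that] by simp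
  have G0: "(\<integral>\<omega>. G m \<omega> \<partial>P) = 0" for m
    using int1[OF polynomial_observable[of "?I m"]] prob_space by (simp add: G_def c_def)
  have H0: "(\<integral>\<omega>. H m \<omega> \<partial>P) = 0" for m
    using int1[OF obs] int1[OF G_obs[of m]] by (simp add: H_def mean G0)
  have H_obs: "observable p (H m) (\<lambda>j. 2 * (?k * w j + ?k * w j))" for m
    unfolding H_def by (rule observable_diff[OF obs G_obs])
  \<comment> \<open>The exact influences of the truncation error replace the crude bound for a
    difference of two observables, which does not tend to 0 with growing \<open>m\<close>.\<close>
  define \<eta> where "\<eta> m j = sqrt (\<integral>\<omega>. (H m \<omega> - H m (keep (- {j}) \<omega>))\<^sup>2 \<partial>P)" for m j
  have \<eta>_obs: "observable p (H m) (\<eta> m)" for m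
    by (rule observable_refine[OF H_obs]) (auto simp: \<eta>_def)
  have \<eta>_le: "\<eta> m j \<le> 4 * ?k * w j" for m j
  proof -
    have eq: "2 * (?k * w j + ?k * w j) = 4 * ?k * w j" by simp
    have "(\<integral>\<omega>. (H m \<omega> - H m (keep (- {j}) \<omega>))\<^sup>2 \<partial>P) \<le> (4 * ?k * w j)\<^sup>2"
      using observableD(5)[OF H_obs, of m j] unfolding eq .
    from real_sqrt_le_mono[OF this] show ?thesis
      unfolding \<eta>_def real_sqrt_abs using k w_nonneg[of j] by simp
  qed
  have \<eta>_lim: "(\<lambda>m. \<eta> m j) \<longlonglongrightarrow> 0" for j
    using tendsto_real_sqrt[OF truncation_influence_tendsto[of j]] by (simp add: \<eta>_def H_def G_def algebra_simps)
  fix e :: real assume "0 < e"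
  \<comment> \<open>The variance bound will be \<open>2 * \<epsilon>\<^sup>2\<close> per time, which
    has to be \<open>e\<close>.\<close>
  define \<epsilon> where "\<epsilon> = sqrt (e / 2)"
  have \<epsilon>: "0 < \<epsilon>" "2 * \<epsilon>\<^sup>2 = e" using \<open>0 < e\<close> by (auto simp: \<epsilon>_def)
  \<comment> \<open>Rows outside a finite \<open>J0\<close> are handled by the tail of
    \<open>w\<close>, those inside by a large \<open>m\<close>; each part gets \<epsilon>/2. The
    summands 1 in the denominators avoid division by 0.\<close>
  have "0 < \<epsilon> / (2 * (4 * ?k + 1))" using \<epsilon> k by simp
  then obtain J0 where J0: "finite J0"
    and small: "\<And>J. finite J \<Longrightarrow> J \<inter> J0 = {} \<Longrightarrow> norm (sum w J) \<le> \<epsilon> / (2 * (4 * ?k + 1))"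
    using w unfolding summable_on_iff_small_tails by (metis subset_UNIV)
  have "\<forall>\<^sub>F m in sequentially. \<forall>j\<in>J0. \<eta> m j < \<epsilon> / (2 * (card J0 + 1))"
    using J0 \<epsilon> order_tendstoD(2)[OF \<eta>_lim] by (simp add: eventually_ball_finite)
  then obtain m where m: "\<And>j. j \<in> J0 \<Longrightarrow> \<eta> m j < \<epsilon> / (2 * (card J0 + 1))"
    using eventually_happens by force
  have sum_\<eta>: "sum (\<eta> m) J \<le> \<epsilon>" if J: "finite J" for J
  proof -
    have "sum (\<eta> m) J = sum (\<eta> m) (J \<inter> J0) + sum (\<eta> m) (J - J0)" using J by (rule sum.Int_Diff)
    also have "sum (\<eta> m) (J \<inter> J0) \<le> (\<Sum>j\<in>J0. \<epsilon> / (2 * (card J0 + 1)))"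
    proof (rule order_trans)
      show "sum (\<eta> m) (J \<inter> J0) \<le> (\<Sum>j\<in>J \<inter> J0. \<epsilon> / (2 * (card J0 + 1)))"
        using m by (intro sum_mono) (auto intro: less_imp_le)
      show "(\<Sum>j\<in>J \<inter> J0. \<epsilon> / (2 * (card J0 + 1))) \<le> (\<Sum>j\<in>J0. \<epsilon> / (2 * (card J0 + 1)))"
        using J0 \<epsilon> by (intro sum_mono2) auto
    qed
    also have "\<dots> \<le> \<epsilon> / 2" using \<epsilon> by (simp add: field_simps)
    also have "sum (\<eta> m) (J - J0) \<le> 4 * ?k * sum w (J - J0)"
      unfolding sum_distrib_left by (intro sum_mono \<eta>_le)
    also have "\<dots> \<le> 4 * ?k * (\<epsilon> / (2 * (4 * ?k + 1)))"
      using small[of "J - J0", OF finite_Diff[OF J] Diff_disjoint[THEN trans[OF Int_commute]]] k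
      by (intro mult_left_mono) auto
    also have "\<dots> \<le> \<epsilon> / 2" using \<epsilon> k by (simp add: field_simps)
    finally show ?thesis by simp
  qed
  show "\<exists>G m. G \<in> borel_measurable P \<and> integrable P (\<lambda>\<omega>. (G \<omega>)\<^sup>2) \<and> (\<integral>\<omega>. G \<omega> \<partial>P) = 0 \<and>
      (\<forall>\<omega> \<omega>'. (\<forall>j k. \<bar>j\<bar> \<le> int m \<longrightarrow> \<omega> (j, k) = \<omega>' (j, k)) \<longrightarrow> G \<omega> = G \<omega>') \<and>
      (\<forall>I :: nat set. finite I \<longrightarrow>
        (\<integral>\<omega>. (\<Sum>i\<in>I. G (shift (int i) \<omega>))\<^sup>2 \<partial>P) \<le> 2 * (?k * ?W)\<^sup>2 * card I) \<and>
      (\<forall>I :: nat set. finite I \<longrightarrow>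
        (\<integral>\<omega>. (\<Sum>i\<in>I. f (V (shift (int i) \<omega>)) - G (shift (int i) \<omega>))\<^sup>2 \<partial>P) \<le> e * card I)"
  proof (intro exI[of _ "G m"] exI[of _ m] conjI allI impI)
    show "G m \<in> borel_measurable P" "integrable P (\<lambda>\<omega>. (G m \<omega>)\<^sup>2)" using G_obs by (auto dest: observableD)
    show "(\<integral>\<omega>. G m \<omega> \<partial>P) = 0" by (rule G0)
    show "G m \<omega> = G m \<omega>'" if "\<forall>j k. \<bar>j\<bar> \<le> int m \<longrightarrow> \<omega> (j, k) = \<omega>' (j, k)" for \<omega> \<omega>'
    proof -
      have "keep (?I m) \<omega> = keep (?I m) \<omega>'" using that by (auto simp: keep_def fun_eq_iff abs_le_iff)
      then show ?thesis by (simp add: G_def)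
    qed
    fix I :: "nat set" assume I: "finite I"
    have "sum (\<lambda>j. ?k * w j) J \<le> ?k * ?W" if "finite J" for J
      unfolding sum_distrib_left[symmetric] by (intro mult_left_mono sum_w that k)
    then show "(\<integral>\<omega>. (\<Sum>i\<in>I. G m (shift (int i) \<omega>))\<^sup>2 \<partial>P) \<le> 2 * (?k * ?W)\<^sup>2 * card I"
      by (intro observable_variance[OF G_obs G0] I)
    have "(\<integral>\<omega>. (\<Sum>i\<in>I. H m (shift (int i) \<omega>))\<^sup>2 \<partial>P) \<le> 2 * \<epsilon>\<^sup>2 * card I"
      by (intro observable_variance[OF \<eta>_obs H0] sum_\<eta> I)
    then show "(\<integral>\<omega>. (\<Sum>i\<in>I. f (V (shift (int i) \<omega>)) - G m (shift (int i) \<omega>))\<^sup>2 \<partial>P) \<le> e * card I"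
      unfolding H_def \<epsilon> .
  qed
qed

end

end

section \<open>Support and dynamics\<close>

lemma measure_bernoulli_field_cylinder_pos:
  assumes p: "\<And>i. 0 < p i" "\<And>i. p i < 1" and I: "finite I"
  shows "0 < measure (bernoulli_field p) {\<omega>. \<forall>i\<in>I. \<omega> i = c i}"
proof -
  interpret prob_space "bernoulli_field p" by (rule prob_space_bernoulli_field)
  show ?thesis
  proof (cases "I = {}")
    case True
    then show ?thesis using prob_space by simp
  next
    case False
    have "indep_vars (\<lambda>_. count_space UNIV) (\<lambda>i \<omega>. \<omega> i) I"
      by (rule bernoulli_field_indep_blocks[where K = "\<lambda>i. {i}"]) (auto simp: disjoint_family_on_def)
    from indep_varsD[OF this False I order_refl, of "\<lambda>i. {c i}"]
    have "measure (bernoulli_field p) (\<Inter>i\<in>I. (\<lambda>\<omega>. \<omega> i) -` {c i}) = (\<Prod>i\<in>I. measure (bernoulli_field p) ((\<lambda>\<omega>. \<omega> i) -` {c i}))"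
      by simp
    moreover have "(\<Inter>i\<in>I. (\<lambda>\<omega>. \<omega> i) -` {c i}) = {\<omega>. \<forall>i\<in>I. \<omega> i = c i}" by auto
    moreover have "0 < measure (bernoulli_field p) ((\<lambda>\<omega>. \<omega> i) -` {c i})" for i
    proof -
      have prob_i: "measure (bernoulli_field p) {\<omega>. \<omega> i} = p i"
        using p[of i] by (intro prob_bernoulli_field_coord) auto
      have set_i: "{\<omega>. \<omega> i} \<in> sets (bernoulli_field p)"
      proof -
        have "{\<omega> \<in> space (bernoulli_field p). \<omega> i} \<in> sets (bernoulli_field p)" by measurable
        then show ?thesis by simp
      qed
      show ?thesis
      proof (cases "c i")
        case True
        then have "(\<lambda>\<omega>. \<omega> i) -` {c i} = {\<omega>. \<omega> i}" by auto
        then show ?thesis using prob_i p by simp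
      next
        case False
        then have "(\<lambda>\<omega>. \<omega> i) -` {c i} = space (bernoulli_field p) - {\<omega>. \<omega> i}" by auto
        then show ?thesis using prob_compl[OF set_i] prob_i p by simp
      qed
    qed
    ultimately show ?thesis by (simp add: prod_pos)
  qed
qed

context noise begin

text \<open>The union bound over \<open>k \<ge> K\<close> gives at most \<open>(1/2)^K\<close>,
  which is below 1. The exponent \<open>k + 1\<close> in \<open>p_small\<close> supplies the factor
  1/2 that cancels the geometric sum.\<close>

lemma prob_no_late_hit:
  assumes "1 \<le> K"
  shows "0 < measure P {\<omega>. \<forall>k\<ge>K. \<omega> \<notin> hit k}"
proof -
  interpret prob_space P by (rule prob_space_P)
  have geo: "(\<lambda>k. (1/2 :: real) ^ (k + K + 1)) sums ((1/2) ^ (K + 1) * 2)"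
    using sums_mult[OF geometric_sums[of "1/2 :: real"], of "(1/2) ^ (K + 1)"] by (simp add: power_add mult_ac)
  have le: "measure P (hit (k + K)) \<le> (1/2) ^ (k + K + 1)" for k using prob_hit_le[of "k + K"] by simp
  have summ: "summable (\<lambda>k. measure P (hit (k + K)))"
    by (rule summable_comparison_test'[OF sums_summable[OF geo], of 0]) (use le in auto)
  have "measure P (\<Union>k. hit (k + K)) \<le> (\<Sum>k. measure P (hit (k + K)))"
    by (rule finite_measure_subadditive_countably) (use summ in auto)
  also have "\<dots> \<le> (1/2) ^ (K + 1) * 2"
    using suminf_le[OF le summ sums_summable[OF geo]] sums_unique[OF geo] by simp
  also have "\<dots> = (1/2) ^ K" by simp
  also have "\<dots> \<le> (1/2) ^ 1" using assms by (intro power_decreasing) auto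
  finally have "measure P (\<Union>k. hit (k + K)) < 1" by simp
  moreover have "{\<omega>. \<forall>k\<ge>K. \<omega> \<notin> hit k} = space P - (\<Union>k. hit (k + K))"
    by auto (metis le_add_diff_inverse2)
  moreover have "(\<Union>k. hit (k + K)) \<in> sets P" by measurable
  ultimately show ?thesis using prob_compl[of "\<Union>k. hit (k + K)"] by simp
qed

text \<open>With positive probability \<open>(0, k0)\<close> is the only active site in a large
  finite window and no core site with \<open>k \<ge> K\<close> is active; the rest of the series is
  then small deterministically. The two events concern different values of \<open>k\<close> and so
  are independent.\<close>

lemma V_near_site:
  assumes "0 < \<epsilon>"
  shows "0 < measure P {\<omega>. dist (V \<omega>) (Y (0, k0)) < \<epsilon>}"
proof -
  interpret prob_space P by (rule prob_space_P)
  obtain n where n: "(1/2 :: real) ^ n < \<epsilon> / 4" using real_arch_pow_inv[of "\<epsilon> / 4" "1/2"] assms by auto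
  define K where "K = max n (Suc k0)"
  have K: "1 \<le> K" "k0 < K" "(1/2 :: real) ^ K < \<epsilon> / 4"
  proof -
    have "(1/2 :: real) ^ K \<le> (1/2) ^ n" by (intro power_decreasing) (auto simp: K_def)
    then show "(1/2 :: real) ^ K < \<epsilon> / 4" using n by (rule le_less_trans)
  qed (auto simp: K_def)
  \<comment> \<open>An error \<delta> for each \<open>k < K\<close> costs \<epsilon>/4 in total; the
    \<open>k\<close> from \<open>K\<close> on cost
    \<open>2 * (1/2)^K < \<epsilon>/2\<close>.\<close>
  define \<delta> where "\<delta> = \<epsilon> / (4 * K)"
  have \<delta>: "0 < \<delta>" using assms K by (simp add: \<delta>_def)
  have "\<forall>k. \<exists>F. finite F \<and> (\<forall>G. finite G \<and> G \<inter> F = {} \<longrightarrow> norm (\<Sum>j\<in>G. Y (j, k)) \<le> \<delta>)"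
  proof
    fix k
    from row_summable[of k, unfolded summable_on_iff_small_tails, THEN spec, THEN mp, OF \<delta>]
    show "\<exists>F. finite F \<and> (\<forall>G. finite G \<and> G \<inter> F = {} \<longrightarrow> norm (\<Sum>j\<in>G. Y (j, k)) \<le> \<delta>)" by simp
  qed
  from choice[OF this] obtain F where F: "\<And>k. finite (F k)"
    and F': "\<And>k G. finite G \<Longrightarrow> G \<inter> F k = {} \<Longrightarrow> norm (\<Sum>j\<in>G. Y (j, k)) \<le> \<delta>"
    by auto
  \<comment> \<open>The sites whose state is prescribed. For \<open>k < K\<close> they include
    \<open>F k\<close>, outside of which all finite sums are at most \<delta>; from \<open>K\<close>
    on the core is enough, by the tail bound \<open>(1/2)^k\<close>.\<close>
  define C where "C = {(j, k). k < K \<and> j \<in> core k \<union> F k \<union> {0} \<or> K \<le> k \<and> j \<in> core k}"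
  define e where "e k = (if k < K then \<delta> else (1/2) ^ k)" for k
  have e: "e sums (\<epsilon> / 4 + 2 * (1/2) ^ K)"
  proof -
    have "(\<lambda>k. e (k + K)) sums (2 * (1/2) ^ K)"
      using sums_mult[OF geometric_sums[of "1/2 :: real"], of "(1/2) ^ K"] by (simp add: e_def power_add mult_ac)
    from sums_iff_shift[THEN iffD1, OF this]
    have "e sums (2 * (1/2) ^ K + (\<Sum>i<K. e i))" .
    moreover have "(\<Sum>i<K. e i) = \<epsilon> / 4" using K by (simp add: e_def \<delta>_def)
    ultimately show ?thesis by (simp add: add.commute)
  qed
  have tails: "norm (\<Sum>j\<in>G. Y (j, k)) \<le> e k" if "finite G" "\<And>j. j \<in> G \<Longrightarrow> (j, k) \<notin> C" for k G
  proof (cases "k < K")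
    case True
    then show ?thesis using that by (auto simp: e_def C_def intro!: F')
  next
    case False
    then have "norm (\<Sum>j\<in>G. Y (j, k)) \<le> (1/2) ^ k"
      using that by (intro tail) (force simp: C_def core_def)+
    then show ?thesis using False by (simp add: e_def)
  qed
  define E1 where "E1 = {\<omega>. \<forall>i\<in>{i\<in>C. snd i < K}. \<omega> i = (i = (0, k0))}"
  define E2 where "E2 = {\<omega> :: int \<times> nat \<Rightarrow> bool. \<forall>k\<ge>K. \<omega> \<notin> hit k}"
  have fin: "finite {i\<in>C. snd i < K}"
  proof (rule finite_subset)
    show "{i\<in>C. snd i < K} \<subseteq> (\<lambda>(k, j). (j, k)) ` (SIGMA k : {..<K}. core k \<union> F k \<union> {0})"
      by (force simp: C_def)
    show "finite ((\<lambda>(k, j). (j, k)) ` (SIGMA k : {..<K}. core k \<union> F k \<union> {0}))"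
      using F by (intro finite_imageI finite_SigmaI) auto
  qed
  have E1_sets: "E1 \<in> sets P"
  proof -
    have "{\<omega> \<in> space P. \<forall>i\<in>{i\<in>C. snd i < K}. \<omega> i = (i = (0, k0))} \<in> sets P"
      using fin by measurable
    then show ?thesis by (simp add: E1_def)
  qed
  have E2_sets: "E2 \<in> sets P"
  proof -
    have "E2 = space P - (\<Union>k. hit (k + K))"
      by (auto simp: E2_def) (metis le_add_diff_inverse2)
    moreover have "(\<Union>k. hit (k + K)) \<in> sets P" by measurable
    ultimately show ?thesis using sets.compl_sets by metis
  qed
  have "measure P (E1 \<inter> E2) = measure P E1 * measure P E2"
  proof -
    have "indep_var (count_space UNIV) (\<lambda>\<omega>. \<omega> \<in> E1) (count_space UNIV) (\<lambda>\<omega>. \<omega> \<in> E2)"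
    proof (rule bernoulli_field_indep_pair)
      show "Measurable.pred P (\<lambda>\<omega>. \<omega> \<in> E1)" using E1_sets by measurable
      show "Measurable.pred P (\<lambda>\<omega>. \<omega> \<in> E2)" using E2_sets by measurable
      show "(\<omega> \<in> E1) = (\<omega>' \<in> E1)" if "\<And>i. i \<in> {i. snd i < K} \<Longrightarrow> \<omega> i = \<omega>' i" for \<omega> \<omega>'
        using that by (simp add: E1_def)
      show "(\<omega> \<in> E2) = (\<omega>' \<in> E2)" if "\<And>i. i \<in> {i. K \<le> snd i} \<Longrightarrow> \<omega> i = \<omega>' i" for \<omega> \<omega>'
        using that by (simp add: E2_def hit_def)
    qed auto
    from indep_varD[OF this, of "{True}" "{True}"] show ?thesis by (simp add: vimage_def Int_def)
  qed
  moreover have "0 < measure P E1"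
    unfolding E1_def
  proof (rule measure_bernoulli_field_cylinder_pos[OF _ _ fin])
    show "0 < p (snd i)" for i :: "int \<times> nat" by (rule p_pos)
    show "p (snd i) < 1" for i :: "int \<times> nat" using p_half[of "snd i"] by simp
  qed
  moreover have "0 < measure P E2"
    unfolding E2_def by (rule prob_no_late_hit[OF K(1)])
  ultimately have pos: "0 < measure P (E1 \<inter> E2)" by simp
  have "E1 \<inter> E2 \<subseteq> {\<omega>. dist (V \<omega>) (Y (0, k0)) < \<epsilon>}"
  proof
    fix \<omega> assume \<omega>: "\<omega> \<in> E1 \<inter> E2"
    have on_C: "\<omega> i \<longleftrightarrow> i = (0, k0)" if "i \<in> C" for i
    proof (cases "snd i < K")
      case True
      then show ?thesis using \<omega> that by (cases i) (auto simp: E1_def)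
    next
      case False
      then have "\<not> \<omega> i" using \<omega> that by (cases i) (auto simp: E2_def hit_def C_def)
      then show ?thesis using False K by auto
    qed
    have k0: "(0, k0) \<in> C" using K by (simp add: C_def)
    have g: "good \<omega>"
    proof -
      have "{k. \<omega> \<in> hit k} \<subseteq> {..<K}" using \<omega> by (auto simp: E2_def not_le[symmetric])
      then show ?thesis unfolding good_def by (rule finite_subset) simp
    qed
    let ?W = "{i. \<omega> i} - {(0, k0)}"
    have W: "?W \<inter> C = {}" using on_C by auto
    have rows: "Y summable_on ?W" "norm (infsum Y ?W) \<le> suminf e"
    proof -
      note rows = summable_on_rows[where C = C and e = e, OF row_summable _ sums_summable[OF e] W]
      show "Y summable_on ?W" by (rule rows(1), rule tails)
      show "norm (infsum Y ?W) \<le> suminf e" by (rule rows(2), rule tails)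
    qed
    have "(0, k0) \<in> {i. \<omega> i}" using on_C[OF k0] by simp
    then have "{i. \<omega> i} = {(0, k0)} \<union> ?W" by blast
    then have "V \<omega> = infsum Y ({(0, k0)} \<union> ?W)"
      unfolding V_good[OF g] by (rule arg_cong)
    also have "\<dots> = Y (0, k0) + infsum Y ?W"
      using rows(1) by (subst infsum_Un_disjoint) auto
    finally have "dist (V \<omega>) (Y (0, k0)) \<le> suminf e" using rows(2) by (simp add: dist_norm)
    also have "\<dots> < \<epsilon>" using sums_unique[OF e] K(3) assms by linarith
    finally show "\<omega> \<in> {\<omega>. dist (V \<omega>) (Y (0, k0)) < \<epsilon>}" by simp
  qed
  moreover have "{\<omega> \<in> space P. dist (V \<omega>) (Y (0, k0)) < \<epsilon>} \<in> sets P" by measurable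
  ultimately have "measure P (E1 \<inter> E2) \<le> measure P {\<omega>. dist (V \<omega>) (Y (0, k0)) < \<epsilon>}"
    by (intro finite_measure_mono) auto
  with pos show ?thesis by simp
qed

end

section \<open>The law of the series as an invariant measure\<close>

locale noise_dynamics = noise Y N b p w
  for Y :: "int \<times> nat \<Rightarrow> 'a::{banach,second_countable_topology}" and N b p w +
  fixes T :: "'a \<Rightarrow> 'a"
  assumes T_lin: "bounded_linear T"
    and T_Y: "\<And>j k. T (Y (j, k)) = Y (j - 1, k)"
    and dense: "closure (range (\<lambda>k. Y (0, k))) = UNIV"
begin

definition \<mu> :: "'a measure" where "\<mu> = distr P borel V"

text \<open>\<open>T\<close> passes through the unordered sum by continuity and renames its index
  set. Goodness of both points identifies both values of \<open>V\<close> with unordered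
  sums.\<close>

lemma V_shift_1:
  assumes "good \<omega>" "good (shift 1 \<omega>)"
  shows "V (shift 1 \<omega>) = T (V \<omega>)"
proof -
  let ?h = "\<lambda>(j, k). (j - 1, k) :: int \<times> nat"
  have s: "Y summable_on {i. \<omega> i}" by (rule good_summable(1)[OF assms(1)]) simp
  have TY: "T (Y i) = Y (?h i)" for i by (cases i) (simp add: T_Y)
  have "{i. shift 1 \<omega> i} = ?h ` {i. \<omega> i}"
    by (force simp: shift_def image_iff)
  then have "V (shift 1 \<omega>) = infsum Y (?h ` {i. \<omega> i})" using V_good[OF assms(2)] by simp
  also have "\<dots> = infsum (Y \<circ> ?h) {i. \<omega> i}" by (rule infsum_reindex) (auto simp: inj_on_def)
  also have "\<dots> = infsum (\<lambda>i. T (Y i)) {i. \<omega> i}" by (simp add: TY o_def)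
  also have "\<dots> = T (infsum Y {i. \<omega> i})"
    using infsum_bounded_linear_strong[of T Y "{i. \<omega> i}"] T_lin s summable_on_bounded_linear[OF T_lin s] by simp
  also have "\<dots> = T (V \<omega>)" using V_good[OF assms(1)] by simp
  finally show ?thesis .
qed

text \<open>The shift preserves \<open>P\<close>, so outside one null set all forward shifts of
  \<omega> are good, and induction on \<open>n\<close> applies pathwise.\<close>

lemma V_shift: "AE \<omega> in P. V (shift (int n) \<omega>) = (T ^^ n) (V \<omega>)"
proof -
  have "AE \<omega> in P. \<forall>i :: nat. good (shift (int i) \<omega>)"
    unfolding AE_all_countable
    by (intro allI measure_preserving_map_AE[OF measure_preserving_shift good_AE])
  then show ?thesis
  proof eventually_elim
    case (elim \<omega>)
    show ?case
    proof (induction n)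
      case 0 then show ?case by (simp add: shift_def)
    next
      case (Suc n)
      have "shift (int (Suc n)) \<omega> = shift 1 (shift (int n) \<omega>)" by (simp add: shift_shift)
      moreover have "good (shift 1 (shift (int n) \<omega>))" using elim[rule_format, of "Suc n"] by (simp add: shift_shift)
      ultimately show ?case using V_shift_1[of "shift (int n) \<omega>"] elim Suc by simp
    qed
  qed
qed

lemma measurable_T_power [measurable]: "T ^^ n \<in> borel_measurable borel"
proof -
  have "continuous_on UNIV T" by (rule linear_continuous_on[OF T_lin])
  then have T: "T \<in> borel_measurable borel" by (rule borel_measurable_continuous_onI)
  show ?thesis by (induction n) (auto intro: measurable_compose[OF _ T])
qed

lemma integrable_\<mu>: "f \<in> borel_measurable borel \<Longrightarrow> integrable \<mu> f \<longleftrightarrow> integrable P (\<lambda>\<omega>. f (V \<omega>))" for f :: "'a \<Rightarrow> real"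
  unfolding \<mu>_def by (rule integrable_distr_eq) measurable

lemma integral_\<mu>: "f \<in> borel_measurable borel \<Longrightarrow> integral\<^sup>L \<mu> f = (\<integral>\<omega>. f (V \<omega>) \<partial>P)" for f :: "'a \<Rightarrow> real"
  unfolding \<mu>_def by (rule integral_distr) measurable

lemma good_measure_\<mu>: "good_measure T \<mu>"
  unfolding good_measure_def
proof (intro conjI ballI allI impI)
  interpret prob_space P by (rule prob_space_P)
  interpret \<mu>: prob_space \<mu> unfolding \<mu>_def by (rule prob_space_distr) simp
  show "sets \<mu> = sets borel" by (simp add: \<mu>_def)
  show "prob_space \<mu>" by (rule \<mu>.prob_space_axioms)
  have meas_\<mu>: "measure \<mu> A = measure P (V -` A)" if "A \<in> sets borel" for A
    unfolding \<mu>_def using that by (subst measure_distr) auto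
  have V_vimage[measurable]: "V -` A \<in> sets P" if "A \<in> sets borel" for A
    using measurable_sets[OF V_measurable that] by simp
  have T_vimage: "(T ^^ n) -` A \<in> sets borel" if "A \<in> sets borel" for A n
    using measurable_sets[OF measurable_T_power that, of n] by simp
  \<comment> \<open>Transfers the dynamics of \<open>T\<close> under \<open>\<mu>\<close> to the
    shift on the field, up to null sets. Invariance is the case \<open>A = UNIV\<close>,
    \<open>n = 1\<close>; mixing is inherited from the shift.\<close>
  have shifted: "measure \<mu> (A \<inter> (T ^^ n) -` B) = measure P (V -` A \<inter> shift (int n) -` (V -` B))"
    if A: "A \<in> sets borel" and B: "B \<in> sets borel" for A B n
  proof -
    have "A \<inter> (T ^^ n) -` B \<in> sets borel" using A T_vimage[OF B] by blast
    then have "measure \<mu> (A \<inter> (T ^^ n) -` B) = measure P (V -` (A \<inter> (T ^^ n) -` B))" by (rule meas_\<mu>)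
    also have "\<dots> = measure P (V -` A \<inter> shift (int n) -` (V -` B))"
    proof (rule finite_measure_eq_AE)
      show "AE \<omega> in P. \<omega> \<in> V -` (A \<inter> (T ^^ n) -` B) \<longleftrightarrow> \<omega> \<in> V -` A \<inter> shift (int n) -` (V -` B)"
        using V_shift[of n] by eventually_elim auto
      show "V -` (A \<inter> (T ^^ n) -` B) \<in> sets P" using A T_vimage[OF B] by (intro V_vimage) blast
      have "shift (int n) -` (V -` B) \<in> sets P"
        using measurable_sets[OF measurable_shift V_vimage[OF B], of "int n"] by simp
      then show "V -` A \<inter> shift (int n) -` (V -` B) \<in> sets P" using V_vimage[OF A] by blast
    qed
    finally show ?thesis .
  qed
  show "emeasure \<mu> (T -` A) = emeasure \<mu> A" if A: "A \<in> sets borel" for A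
  proof -
    have "measure \<mu> (T -` A) = measure P (shift 1 -` (V -` A))" using shifted[of UNIV A 1] A by simp
    also have "\<dots> = measure P (V -` A)"
      using measure_preserving_map_measure[OF measure_preserving_shift V_vimage[OF A]] by simp
    also have "\<dots> = measure \<mu> A" using meas_\<mu>[OF A] by simp
    finally show ?thesis by (simp add: \<mu>.emeasure_eq_measure)
  qed
  show "(\<lambda>n. measure \<mu> (A \<inter> (T ^^ n) -` B)) \<longlonglongrightarrow> measure \<mu> A * measure \<mu> B"
    if A: "A \<in> sets borel" and B: "B \<in> sets borel" for A B
    unfolding shifted[OF A B] meas_\<mu>[OF A] meas_\<mu>[OF B]
    by (rule shift_mixing[OF V_vimage[OF A] V_vimage[OF B]])
  show "0 < emeasure \<mu> U" if U: "open U \<and> U \<noteq> {}" for U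
  proof -
    have "U \<inter> closure (range (\<lambda>k. Y (0, k))) \<noteq> {}" using U dense by simp
    then have "U \<inter> range (\<lambda>k. Y (0, k)) \<noteq> {}"
      using U by (simp add: open_Int_closure_eq_empty)
    then obtain k where k: "Y (0, k) \<in> U" by auto
    then obtain \<epsilon> where \<epsilon>: "0 < \<epsilon>" "ball (Y (0, k)) \<epsilon> \<subseteq> U" using U open_contains_ball by blast
    have "{\<omega>. dist (V \<omega>) (Y (0, k)) < \<epsilon>} \<subseteq> V -` U" using \<epsilon>(2) by (auto simp: dist_commute mem_ball)
    moreover have Ub: "U \<in> sets borel" using U by (simp add: borel_open)
    ultimately have "measure P {\<omega>. dist (V \<omega>) (Y (0, k)) < \<epsilon>} \<le> measure P (V -` U)"
      by (intro finite_measure_mono V_vimage)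
    then have "0 < measure \<mu> U" using V_near_site[OF \<epsilon>(1), of k] meas_\<mu>[OF Ub] by simp
    then show ?thesis by (simp add: \<mu>.emeasure_eq_measure)
  qed
  fix f :: "'a \<Rightarrow> real" assume f: "polynomial_on f \<and> continuous_on UNIV f"
  then obtain C d where "0 \<le> C" "\<And>x h. \<bar>f (x + h) - f x\<bar> \<le> C * norm h * (1 + norm x + norm h) ^ d"
    using polynomial_on_diff_bound by blast
  from observableD(2)[OF polynomial_observable[OF this, of UNIV]]
  have "integrable P (\<lambda>\<omega>. (f (V \<omega>))\<^sup>2)" by simp
  moreover have f_meas: "f \<in> borel_measurable borel" using f by (intro borel_measurable_continuous_onI) simp
  ultimately show "integrable \<mu> (\<lambda>x. (f x)\<^sup>2)" by (subst integrable_\<mu>) auto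
  show "f \<in> borel_measurable \<mu>" using f_meas by (simp add: \<mu>_def)
qed

text \<open>The factor \<open>M\<close> is independent of \<open>n\<close> and of the bound
  \<open>B\<close> on the weights, so all decay rates reduce to estimates of one
  convolution.\<close>

lemma polynomial_covariance:
  assumes "polynomial_on f" "polynomial_on g"
  shows "\<exists>M\<ge>0. \<forall>n B. (\<forall>m. (\<Sum>j\<in>{- int m..int m}. w (j - int n) * w j) \<le> B) \<longrightarrow> \<bar>Cov \<mu> (f \<circ> T ^^ n) g\<bar> \<le> M * B"
proof -
  obtain C d where f: "0 \<le> C" "\<And>x h. \<bar>f (x + h) - f x\<bar> \<le> C * norm h * (1 + norm x + norm h) ^ d"
    using polynomial_on_diff_bound[OF assms(1)] by blast
  obtain C' d' where g: "0 \<le> C'" "\<And>x h. \<bar>g (x + h) - g x\<bar> \<le> C' * norm h * (1 + norm x + norm h) ^ d'"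
    using polynomial_on_diff_bound[OF assms(2)] by blast
  have fo: "observable p (\<lambda>\<omega>. f (V \<omega>)) (\<lambda>j. influence C d * w j)"
    using polynomial_observable[OF f, of UNIV] by simp
  have go: "observable p (\<lambda>\<omega>. g (V \<omega>)) (\<lambda>j. influence C' d' * w j)"
    using polynomial_observable[OF g, of UNIV] by simp
  let ?M = "influence C d * influence C' d'"
  have M: "0 \<le> ?M" using influence_nonneg[OF f(1)] influence_nonneg[OF g(1)] by simp
  have [measurable]: "f \<in> borel_measurable borel" "g \<in> borel_measurable borel"
    using diff_bound_measurable[OF f] diff_bound_measurable[OF g] .
  have "\<bar>Cov \<mu> (f \<circ> T ^^ n) g\<bar> \<le> 2 * ?M * B"
    if B: "\<And>m. (\<Sum>j\<in>{- int m..int m}. w (j - int n) * w j) \<le> B" for n B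
  proof (rule field_le_epsilon)
    have T_n: "(\<lambda>x. f ((T ^^ n) x)) \<in> borel_measurable borel" by measurable
    have eq1: "(\<integral>\<omega>. f ((T ^^ n) (V \<omega>)) * g (V \<omega>) \<partial>P) = (\<integral>\<omega>. f (V (shift (int n) \<omega>)) * g (V \<omega>) \<partial>P)"
    proof (rule integral_cong_AE)
      show "AE \<omega> in P. f ((T ^^ n) (V \<omega>)) * g (V \<omega>) = f (V (shift (int n) \<omega>)) * g (V \<omega>)"
        using V_shift[of n] by eventually_elim simp
    qed measurable
    have eq2: "(\<integral>\<omega>. f ((T ^^ n) (V \<omega>)) \<partial>P) = (\<integral>\<omega>. f (V (shift (int n) \<omega>)) \<partial>P)"
    proof (rule integral_cong_AE)
      show "AE \<omega> in P. f ((T ^^ n) (V \<omega>)) = f (V (shift (int n) \<omega>))"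
        using V_shift[of n] by eventually_elim simp
    qed measurable
    have cov: "Cov \<mu> (f \<circ> T ^^ n) g = Cov P (\<lambda>\<omega>. f (V (shift (int n) \<omega>))) (\<lambda>\<omega>. g (V \<omega>))"
      unfolding Cov_def o_def using T_n by (simp add: integral_\<mu> eq1 eq2)
    fix e :: real assume "0 < e"
    obtain m where m: "\<bar>Cov P (\<lambda>\<omega>. f (V (shift (int n) \<omega>))) (\<lambda>\<omega>. g (V \<omega>))\<bar>
        \<le> 2 * (\<Sum>j\<in>{- int m..int m}. influence C d * w (j - int n) * (influence C' d' * w j)) + e"
      using eventually_happens[OF observable_covariance[OF fo go \<open>0 < e\<close>, of "int n"]] by auto
    also have "(\<Sum>j\<in>{- int m..int m}. influence C d * w (j - int n) * (influence C' d' * w j))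
        = ?M * (\<Sum>j\<in>{- int m..int m}. w (j - int n) * w j)"
      by (simp add: sum_distrib_left mult_ac)
    also have "\<dots> \<le> ?M * B" by (rule mult_left_mono[OF B M])
    finally show "\<bar>Cov \<mu> (f \<circ> T ^^ n) g\<bar> \<le> 2 * ?M * B + e" unfolding cov by simp
  qed
  then show ?thesis using M by (intro exI[of _ "2 * ?M"]) auto
qed

lemma polynomial_clt_\<mu>:
  assumes f: "polynomial_on f" and w: "w summable_on UNIV" and mean: "(\<integral>x. f x \<partial>\<mu>) = 0"
  shows "\<exists>\<sigma>\<ge>0. weak_conv_m (\<lambda>n. distr \<mu> borel (\<lambda>x. (\<Sum>i<n. f ((T ^^ i) x)) / sqrt n))
      (distr std_normal_distribution borel (\<lambda>t. \<sigma> * t))"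
proof -
  obtain C d where fb: "0 \<le> C" "\<And>x h. \<bar>f (x + h) - f x\<bar> \<le> C * norm h * (1 + norm x + norm h) ^ d"
    using polynomial_on_diff_bound[OF f] by blast
  note [measurable] = diff_bound_measurable[OF fb]
  have "distr \<mu> borel (\<lambda>x. (\<Sum>i<n. f ((T ^^ i) x)) / sqrt n)
      = distr P borel (\<lambda>\<omega>. (\<Sum>i<n. f (V (shift (int i) \<omega>))) / sqrt n)" for n
  proof -
    have "distr \<mu> borel (\<lambda>x. (\<Sum>i<n. f ((T ^^ i) x)) / sqrt n)
        = distr P borel (\<lambda>\<omega>. (\<Sum>i<n. f ((T ^^ i) (V \<omega>))) / sqrt n)"
      unfolding \<mu>_def by (subst distr_distr) (auto simp: o_def)
    also have "\<dots> = distr P borel (\<lambda>\<omega>. (\<Sum>i<n. f (V (shift (int i) \<omega>))) / sqrt n)"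
    proof (rule distr_cong_AE)
      have "AE \<omega> in P. \<forall>i. V (shift (int i) \<omega>) = (T ^^ i) (V \<omega>)"
        unfolding AE_all_countable by (intro allI V_shift)
      then show "AE \<omega> in P. (\<Sum>i<n. f ((T ^^ i) (V \<omega>))) / sqrt n = (\<Sum>i<n. f (V (shift (int i) \<omega>))) / sqrt n"
        by eventually_elim simp
    qed auto
    finally show ?thesis .
  qed
  moreover have "(\<integral>\<omega>. f (V \<omega>) \<partial>P) = 0" using mean integral_\<mu>[of f] by simp
  ultimately show ?thesis using polynomial_clt[OF fb w] by simp
qed

end

section \<open>Choice of the parameters and rates\<close>

lemma summable_on_int:
  fixes f :: "int \<Rightarrow> 'a::banach"
  assumes "(\<lambda>n. f (int n)) summable_on UNIV" "(\<lambda>n. f (- int n)) summable_on UNIV"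
  shows "f summable_on UNIV"
proof -
  have "f summable_on range int"
    using assms(1) by (subst summable_on_reindex) (auto simp: o_def)
  \<comment> \<open>Starting at 1 keeps 0 from being counted twice.\<close>
  moreover have "f summable_on (\<lambda>n. - int n) ` {1..}"
    using summable_on_subset_banach[OF assms(2), of "{1..}"]
    by (subst summable_on_reindex) (auto simp: o_def inj_on_def)
  ultimately have "f summable_on (range int \<union> (\<lambda>n. - int n) ` {1..})"
    by (rule summable_on_Un_disjoint) force
  moreover have "range int \<union> (\<lambda>n. - int n) ` {1..} = UNIV"
  proof (intro equalityI subset_UNIV subsetI)
    fix j :: int
    show "j \<in> range int \<union> (\<lambda>n. - int n) ` {1..}"
    proof (cases "0 \<le> j")
      case True
      then have "j = int (nat j)" by simp
      then show ?thesis by blast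
    next
      case False
      then have "j = - int (nat (- j))" "nat (- j) \<in> {1..}" by auto
      then show ?thesis by blast
    qed
  qed
  ultimately show ?thesis by simp
qed

lemma summable_on_imp_bounded:
  fixes f :: "'i \<Rightarrow> 'a::banach"
  assumes "f summable_on UNIV"
  shows "\<exists>A. \<forall>i. norm (f i) \<le> A"
proof -
  obtain F where F: "finite F" "\<And>G. finite G \<Longrightarrow> G \<inter> F = {} \<Longrightarrow> norm (sum f G) \<le> 1"
    using assms[unfolded summable_on_iff_small_tails, THEN spec, THEN mp, OF zero_less_one] by auto
  have "norm (f i) \<le> 1 + (\<Sum>i\<in>F. norm (f i))" for i
  proof (cases "i \<in> F")
    case True
    then have "norm (f i) \<le> (\<Sum>i\<in>F. norm (f i))" using F(1) by (intro member_le_sum) auto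
    then show ?thesis by simp
  next
    case False
    then have "norm (f i) \<le> 1" using F(2)[of "{i}"] by simp
    moreover have "0 \<le> (\<Sum>i\<in>F. norm (f i))" by (simp add: sum_nonneg)
    ultimately show ?thesis by linarith
  qed
  then show ?thesis by blast
qed

text \<open>The members must lie in \<open>D\<close>, where the orbit series are known to converge;
  one point of \<open>D\<close> is picked in each nonempty set of a countable basis.\<close>

lemma dense_sequence:
  fixes D :: "'a::second_countable_topology set"
  assumes "closure D = UNIV"
  shows "\<exists>x :: nat \<Rightarrow> 'a. range x \<subseteq> D \<and> closure (range x) = UNIV"
proof -
  obtain B :: "'a set set" where B: "countable B" "topological_basis B"
    using ex_countable_basis by blast
  have "\<forall>U. \<exists>x. U \<in> B - {{}} \<longrightarrow> x \<in> U \<inter> D"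
  proof
    fix U
    show "\<exists>x. U \<in> B - {{}} \<longrightarrow> x \<in> U \<inter> D"
    proof (cases "U \<in> B - {{}}")
      case True
      then have "open U" "U \<inter> closure D \<noteq> {}" using B(2) assms topological_basis_open by auto
      then show ?thesis by (auto simp: open_Int_closure_eq_empty)
    qed auto
  qed
  from choice[OF this] obtain g where g: "\<And>U. U \<in> B - {{}} \<Longrightarrow> g U \<in> U \<inter> D" by auto
  let ?X = "g ` (B - {{}})"
  have meets: "\<exists>U\<in>B - {{}}. U \<subseteq> W" if W: "open W" "W \<noteq> {}" for W
  proof -
    obtain y where "y \<in> W" using W(2) by blast
    then obtain U where "U \<in> B" "y \<in> U" "U \<subseteq> W" using topological_basisE[OF B(2) W(1)] by blast
    then show ?thesis by blast
  qed
  have "?X \<noteq> {}" using meets[of UNIV] by auto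
  moreover have "countable ?X" using B(1) by blast
  ultimately have range: "range (from_nat_into ?X) = ?X" by (rule range_from_nat_into)
  have "closure ?X = UNIV"
  proof (rule ccontr)
    assume "closure ?X \<noteq> UNIV"
    then obtain U where "U \<in> B - {{}}" "U \<subseteq> - closure ?X"
      using meets[of "- closure ?X"] by auto
    then show False using g[of U] closure_subset[of ?X] by blast
  qed
  then show ?thesis using range g by (intro exI[of _ "from_nat_into ?X"]) auto
qed

text \<open>A biinfinite orbit along which \<open>T\<close> lowers the index by 1. For
  \<open>x\<close> in the dense set the halves fit at 0, since condition (iii) with
  \<open>n = 0\<close> gives \<open>S 0 x = x\<close>.\<close>

definition two_sided_orbit :: "('a \<Rightarrow> 'a) \<Rightarrow> (nat \<Rightarrow> 'a \<Rightarrow> 'a) \<Rightarrow> 'a \<Rightarrow> int \<Rightarrow> 'a" where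
  "two_sided_orbit T S x j = (if 0 \<le> j then S (nat j) x else (T ^^ nat (- j)) x)"

text \<open>\<open>N k\<close> comes from the convergence of the k-th orbit series,
  \<open>b k\<close> from the core so determined and from the decay constant, and \<open>p k\<close>
  is chosen last because it has to be small compared with all of these. The weight \<open>w\<close>
  stays open: constant for bare existence, a power for the rates.\<close>

lemma noise_dynamics_exists:
  fixes T :: "'a::{banach,second_countable_topology} \<Rightarrow> 'a"
  assumes T_lin: "bounded_linear T"
    and D_dense: "closure D = UNIV"
    and sumT: "\<forall>x\<in>D. (\<lambda>n. (T ^^ n) x) summable_on UNIV"
    and sumS: "\<forall>x\<in>D. (\<lambda>n. S n x) summable_on UNIV"
    and TS: "\<forall>x\<in>D. \<forall>n. (T ^^ n) (S n x) = x"
    and TS2: "\<forall>x\<in>D. \<forall>n m. m < n \<longrightarrow> (T ^^ m) (S n x) = S (n - m) x"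
    and w: "\<And>j. 0 \<le> w j"
    and decay: "\<And>x. x \<in> D \<Longrightarrow> \<exists>A. \<forall>j. norm (two_sided_orbit T S x j) \<le> A * w j"
  shows "\<exists>Y N b p. noise_dynamics Y N b p w T"
proof -
  obtain x :: "nat \<Rightarrow> 'a" where x: "range x \<subseteq> D" "closure (range x) = UNIV"
    using dense_sequence[OF D_dense] by blast
  have xD: "x k \<in> D" for k using x(1) by auto
  have S0: "S 0 (x k) = x k" for k using TS xD[of k] by (metis funpow_0)
  define Y where "Y = (\<lambda>(j, k). two_sided_orbit T S (x k) j)"
  have row: "(\<lambda>j. Y (j, k)) summable_on UNIV" for k
  proof (rule summable_on_int)
    show "(\<lambda>n. Y (int n, k)) summable_on UNIV"
      using sumS xD[of k] by (simp add: Y_def two_sided_orbit_def)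
    have "(\<lambda>n. Y (- int n, k)) = (\<lambda>n. (T ^^ n) (x k))"
      by (auto simp: Y_def two_sided_orbit_def fun_eq_iff S0)
    then show "(\<lambda>n. Y (- int n, k)) summable_on UNIV" using sumT xD[of k] by simp
  qed
  have "\<forall>k. \<exists>n. k \<le> n \<and> (\<forall>G. finite G \<longrightarrow> (\<forall>j\<in>G. int n < \<bar>j\<bar>) \<longrightarrow> norm (\<Sum>j\<in>G. Y (j, k)) \<le> (1/2) ^ k)"
  proof
    fix k
    have "0 < (1/2 :: real) ^ k" by simp
    from row[of k, unfolded summable_on_iff_small_tails, THEN spec, THEN mp, OF this]
    obtain F where F: "finite F" "\<And>G. finite G \<Longrightarrow> G \<inter> F = {} \<Longrightarrow> norm (\<Sum>j\<in>G. Y (j, k)) \<le> (1/2) ^ k" by auto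
    define n where "n = Max (insert k ((\<lambda>j. nat \<bar>j\<bar>) ` F))"
    have "k \<le> n" unfolding n_def using F(1) by (intro Max_ge) auto
    moreover have "nat \<bar>j\<bar> \<le> n" if "j \<in> F" for j unfolding n_def using F(1) that by (intro Max_ge) auto
    then have "G \<inter> F = {}" if "\<forall>j\<in>G. int n < \<bar>j\<bar>" for G using that by fastforce
    ultimately show "\<exists>n. k \<le> n \<and> (\<forall>G. finite G \<longrightarrow> (\<forall>j\<in>G. int n < \<bar>j\<bar>) \<longrightarrow> norm (\<Sum>j\<in>G. Y (j, k)) \<le> (1/2) ^ k)"
      using F(2) by (intro exI[of _ n]) auto
  qed
  from choice[OF this] obtain N where N': "\<forall>k. k \<le> N k \<and>
      (\<forall>G. finite G \<longrightarrow> (\<forall>j\<in>G. int (N k) < \<bar>j\<bar>) \<longrightarrow> norm (\<Sum>j\<in>G. Y (j, k)) \<le> (1/2) ^ k)" ..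
  have N: "k \<le> N k" for k using N' by simp
  have tail: "norm (\<Sum>j\<in>G. Y (j, k)) \<le> (1/2) ^ k" if "finite G" "\<And>j. j \<in> G \<Longrightarrow> int (N k) < \<bar>j\<bar>" for k G
    using N' that by simp
  have "\<forall>k. \<exists>A. \<forall>j. norm (Y (j, k)) \<le> A * w j"
    using decay[OF xD] by (simp add: Y_def)
  from choice[OF this] obtain A where A: "\<And>k j. norm (Y (j, k)) \<le> A k * w j" by blast
  define s where "s k = (\<Sum>j\<in>{- int (N k)..int (N k)}. norm (Y (j, k)))" for k
  \<comment> \<open>\<open>b\<close> has two duties: it bounds the sum over the core, and it is the
    constant in front of \<open>w\<close>.\<close>
  define b where "b k = s k + \<bar>A k\<bar>" for k
  have s: "0 \<le> s k" for k by (simp add: s_def sum_nonneg)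
  have b: "0 \<le> b k" "s k \<le> b k" "A k \<le> b k" for k using s[of k] by (auto simp: b_def)
  define q where "q k = (2 * real (N k) + 1) * (1 + (\<Sum>i\<le>k. b i)) ^ k" for k
  have q: "1 \<le> q k" for k
  proof -
    have "1 \<le> (1 + (\<Sum>i\<le>k. b i)) ^ k" using b by (intro one_le_power) (simp add: sum_nonneg)
    then show ?thesis unfolding q_def using mult_mono[of 1 "2 * real (N k) + 1" 1] by simp
  qed
  define p where "p k = (1/2) ^ (k + 1) / q k" for k
  have "noise_dynamics Y N b p w T"
  proof (intro noise_dynamics.intro noise.intro noise_dynamics_axioms.intro)
    show "(\<lambda>j. Y (j, k)) summable_on UNIV" for k by (rule row)
    show "norm (\<Sum>j\<in>G. Y (j, k)) \<le> (1/2) ^ k" if "finite G" "\<And>j. j \<in> G \<Longrightarrow> int (N k) < \<bar>j\<bar>" for k G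
      using that by (rule tail)
    show "(\<Sum>j\<in>{- int (N k)..int (N k)}. norm (Y (j, k))) \<le> b k" for k using b(2)[of k] by (simp add: s_def)
    show "k \<le> N k" for k by (rule N)
    have q0: "0 < q k" for k using q[of k] by simp
    then show "0 < p k" for k by (simp add: p_def)
    show "p k \<le> 1/2" for k
    proof -
      have "p k \<le> (1/2) ^ (k + 1)" using q[of k] q0[of k] by (simp add: p_def divide_le_eq)
      also have "\<dots> \<le> (1/2) ^ 1" by (intro power_decreasing) auto
      finally show ?thesis by simp
    qed
    show "(2 * real (N k) + 1) * p k * (1 + (\<Sum>i\<le>k. b i)) ^ k \<le> (1/2) ^ (k + 1)" for k
    proof -
      have "(2 * real (N k) + 1) * p k * (1 + (\<Sum>i\<le>k. b i)) ^ k = q k * p k" by (simp add: q_def)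
      also have "\<dots> = (1/2) ^ (k + 1)" using q0[of k] by (simp add: p_def)
      finally show ?thesis by simp
    qed
    show "0 \<le> w j" for j by (rule w)
    show "norm (Y (j, k)) \<le> b k * w j" for j k
      by (rule order_trans[OF A mult_right_mono[OF b(3) w]])
    show "bounded_linear T" by (rule T_lin)
    show "T (Y (j, k)) = Y (j - 1, k)" for j k
    proof -
      \<comment> \<open>\<open>j = 1\<close> is separate because the relation between the maps
        \<open>S\<close> is given for \<open>m < n\<close> only; there \<open>T\<close> applied to
        \<open>S 1 x\<close> gives \<open>x\<close>.\<close>
      consider "2 \<le> j" | "j = 1" | "j = 0" | "j < 0" by linarith
      then show ?thesis
      proof cases
        case 1
        then have "1 < nat j" by simp
        then have "(T ^^ 1) (S (nat j) (x k)) = S (nat j - 1) (x k)" using TS2 xD[of k] by blast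
        moreover have "nat j - 1 = nat (j - 1)" using 1 by simp
        ultimately show ?thesis using 1 by (simp add: Y_def two_sided_orbit_def)
      next
        case 2
        have "(T ^^ 1) (S 1 (x k)) = x k" using TS xD[of k] by blast
        then show ?thesis using 2 by (simp add: Y_def two_sided_orbit_def S0)
      next
        case 3
        then show ?thesis by (simp add: Y_def two_sided_orbit_def S0)
      next
        case 4
        then have "nat (- (j - 1)) = Suc (nat (- j))" by simp
        then show ?thesis using 4 by (simp add: Y_def two_sided_orbit_def)
      qed
    qed
    show "closure (range (\<lambda>k. Y (0, k))) = UNIV" using x(2) by (simp add: Y_def two_sided_orbit_def S0)
  qed
  then show ?thesis by blast
qed

section \<open>Power weights and their convolution\<close>

definition decay_weight :: "real \<Rightarrow> int \<Rightarrow> real" where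
  "decay_weight \<alpha> j = (1 + real_of_int \<bar>j\<bar>) powr (- \<alpha>)"

lemma decay_weight_nonneg: "0 \<le> decay_weight \<alpha> j"
  by (simp add: decay_weight_def)

text \<open>Turns an asymptotic bound into one for all \<open>n\<close>. The base is
  \<open>1 + n\<close> because \<open>0 powr (- \<alpha>)\<close> is 0 and would force the value at
  \<open>n = 0\<close> to vanish.\<close>

lemma bigo_powr_bound:
  fixes g :: "nat \<Rightarrow> real"
  assumes "g \<in> O(\<lambda>n. real n powr (- \<alpha>))" "0 < \<alpha>"
  shows "\<exists>A\<ge>0. \<forall>n. \<bar>g n\<bar> \<le> A * (1 + real n) powr (- \<alpha>)"
proof -
  obtain c where c: "0 < c" "\<forall>\<^sub>F n in sequentially. norm (g n) \<le> c * norm (real n powr (- \<alpha>))"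
    using assms(1) by (elim landau_o.bigE)
  then obtain n0 where n0: "\<And>n. n \<ge> n0 \<Longrightarrow> \<bar>g n\<bar> \<le> c * real n powr (- \<alpha>)"
    by (auto simp: eventually_sequentially)
  \<comment> \<open>\<open>M\<close> takes care of the finitely many \<open>n \<le> n0\<close>;
    beyond them \<open>1 + n \<le> 2 * n\<close> costs the factor
    \<open>2 powr \<alpha>\<close>.\<close>
  define M where "M = (\<Sum>n\<le>n0. \<bar>g n\<bar> / (1 + real n) powr (- \<alpha>))"
  have M0: "0 \<le> M" by (simp add: M_def sum_nonneg)
  have "\<bar>g n\<bar> \<le> (c * 2 powr \<alpha> + M) * (1 + real n) powr (- \<alpha>)" for n
  proof (cases "n \<le> n0")
    case True
    then have "\<bar>g n\<bar> / (1 + real n) powr (- \<alpha>) \<le> M" unfolding M_def by (intro member_le_sum) auto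
    then have "\<bar>g n\<bar> \<le> M * (1 + real n) powr (- \<alpha>)" by (simp add: pos_divide_le_eq)
    also have "\<dots> \<le> (c * 2 powr \<alpha> + M) * (1 + real n) powr (- \<alpha>)"
      using c(1) by (intro mult_right_mono) auto
    finally show ?thesis .
  next
    case False
    then have n: "1 \<le> real n" by simp
    have "\<bar>g n\<bar> \<le> c * real n powr (- \<alpha>)" using n0 False by simp
    also have "real n powr (- \<alpha>) = 2 powr \<alpha> * (2 * real n) powr (- \<alpha>)"
      using n by (simp add: powr_mult powr_minus)
    also have "(2 * real n) powr (- \<alpha>) \<le> (1 + real n) powr (- \<alpha>)"
      using n assms(2) by (intro powr_mono2') auto
    also have "c * (2 powr \<alpha> * (1 + real n) powr (- \<alpha>)) \<le> (c * 2 powr \<alpha> + M) * (1 + real n) powr (- \<alpha>)"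
      using M0 by (simp add: distrib_right)
    finally show ?thesis using c(1) by simp
  qed
  then show ?thesis using c(1) M0 by (intro exI[of _ "c * 2 powr \<alpha> + M"]) auto
qed

lemma decay_weight_summable:
  assumes "1 < \<alpha>"
  shows "decay_weight \<alpha> summable_on UNIV"
proof -
  have "summable (\<lambda>n. real n powr (- \<alpha>))" using assms by (simp add: summable_real_powr_iff)
  then have "summable (\<lambda>n. real (Suc n) powr (- \<alpha>))" by (subst summable_Suc_iff)
  then have "summable (\<lambda>n. norm ((1 + real n) powr (- \<alpha>)))" by (simp add: add.commute)
  then have "(\<lambda>n. (1 + real n) powr (- \<alpha>)) summable_on UNIV" by (rule norm_summable_imp_summable_on)
  then show ?thesis by (intro summable_on_int) (simp_all add: decay_weight_def)
qed

text \<open>The distances of \<open>j\<close> from 0 and from \<open>n\<close> add up to at least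
  \<open>n\<close>, so one base is at least \<open>n / 2\<close>. Its weight becomes the constant
  and the other one is kept; adding both avoids a case distinction in later sums.\<close>

lemma decay_weight_product_le:
  assumes "0 < \<alpha>" "1 \<le> n"
  shows "decay_weight \<alpha> (j - int n) * decay_weight \<alpha> j
    \<le> 2 powr \<alpha> * real n powr (- \<alpha>) * (decay_weight \<alpha> (j - int n) + decay_weight \<alpha> j)"
proof -
  let ?u = "1 + real_of_int \<bar>j - int n\<bar>" and ?v = "1 + real_of_int \<bar>j\<bar>"
  let ?c = "2 powr \<alpha> * real n powr (- \<alpha>)"
  have c: "(real n / 2) powr (- \<alpha>) = ?c" using assms by (simp add: powr_divide powr_minus field_simps)
  have small: "x powr (- \<alpha>) \<le> ?c" if "real n / 2 \<le> x" for x
    unfolding c[symmetric] using that assms by (intro powr_mono2') auto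
  have "real n / 2 \<le> ?u \<or> real n / 2 \<le> ?v" by linarith
  then show ?thesis
  proof
    assume "real n / 2 \<le> ?u"
    from mult_right_mono[OF small[OF this], of "decay_weight \<alpha> j"]
    have "decay_weight \<alpha> (j - int n) * decay_weight \<alpha> j \<le> ?c * decay_weight \<alpha> j"
      by (simp add: decay_weight_def)
    then show ?thesis using decay_weight_nonneg[of \<alpha> "j - int n"] by (simp add: distrib_left add_increasing)
  next
    assume "real n / 2 \<le> ?v"
    from mult_left_mono[OF small[OF this], of "decay_weight \<alpha> (j - int n)"]
    have "decay_weight \<alpha> (j - int n) * decay_weight \<alpha> j \<le> ?c * decay_weight \<alpha> (j - int n)"
      by (simp add: decay_weight_def mult.commute)
    then show ?thesis using decay_weight_nonneg[of \<alpha> j] by (simp add: distrib_left add_increasing2)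
  qed
qed

lemma sum_int_le:
  fixes h :: "nat \<Rightarrow> real"
  assumes "finite J" "\<And>i. 0 \<le> h i" "(\<lambda>j. nat \<bar>j\<bar>) ` J \<subseteq> I" "finite I"
  shows "(\<Sum>j\<in>J. h (nat \<bar>j\<bar>)) \<le> 2 * (\<Sum>i\<in>I. h i)"
proof -
  have "(\<Sum>j\<in>J. h (nat \<bar>j\<bar>)) = (\<Sum>i\<in>(\<lambda>j. nat \<bar>j\<bar>) ` J. \<Sum>j\<in>{j\<in>J. nat \<bar>j\<bar> = i}. h (nat \<bar>j\<bar>))"
    by (rule sum.image_gen[OF assms(1)])
  also have "\<dots> = (\<Sum>i\<in>(\<lambda>j. nat \<bar>j\<bar>) ` J. card {j\<in>J. nat \<bar>j\<bar> = i} * h i)"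
    by (intro sum.cong) auto
  also have "\<dots> \<le> (\<Sum>i\<in>(\<lambda>j. nat \<bar>j\<bar>) ` J. 2 * h i)"
  proof (intro sum_mono mult_right_mono assms(2))
    fix i
    have "card {j\<in>J. nat \<bar>j\<bar> = i} \<le> card {int i, - int i}" by (rule card_mono) auto
    also have "\<dots> \<le> 2" by (cases "int i = - int i") auto
    finally show "real (card {j\<in>J. nat \<bar>j\<bar> = i}) \<le> 2" by simp
  qed
  also have "\<dots> \<le> (\<Sum>i\<in>I. 2 * h i)" using assms by (intro sum_mono2) auto
  finally show ?thesis by (simp add: sum_distrib_left)
qed

text \<open>Comparison with the integral of \<open>z powr (- \<beta>)\<close>, in the form of the
  mean value theorem for an antiderivative; the resulting differences telescope.\<close>

lemma sum_decay_tail_le: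
  assumes "1 < \<beta>" "1 \<le> k"
  shows "(\<Sum>i\<in>{k..<m}. (1 + real i) powr (- \<beta>)) \<le> real k powr (1 - \<beta>) / (\<beta> - 1)"
proof -
  have step: "(\<beta> - 1) * (1 + real i) powr (- \<beta>) \<le> real i powr (1 - \<beta>) - real (Suc i) powr (1 - \<beta>)" if "1 \<le> i" for i
  proof -
    have "\<exists>z. real i < z \<and> z < real (Suc i) \<and>
        real (Suc i) powr (1 - \<beta>) - real i powr (1 - \<beta>) = (real (Suc i) - real i) * ((1 - \<beta>) * z powr (1 - \<beta> - 1))"
      using that by (intro MVT2 has_real_derivative_powr) auto
    then obtain z where z: "real i < z" "z < real (Suc i)"
      "real (Suc i) powr (1 - \<beta>) - real i powr (1 - \<beta>) = (1 - \<beta>) * z powr (- \<beta>)" by auto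
    have "(1 + real i) powr (- \<beta>) \<le> z powr (- \<beta>)" using z that assms by (intro powr_mono2') auto
    then have "(\<beta> - 1) * (1 + real i) powr (- \<beta>) \<le> (\<beta> - 1) * z powr (- \<beta>)"
      using assms by (intro mult_left_mono) auto
    then show ?thesis using z(3) by (simp add: left_diff_distrib)
  qed
  show ?thesis
  proof (cases "k \<le> m")
    case True
    have "(\<beta> - 1) * (\<Sum>i\<in>{k..<m}. (1 + real i) powr (- \<beta>)) \<le> (\<Sum>i\<in>{k..<m}. real i powr (1 - \<beta>) - real (Suc i) powr (1 - \<beta>))"
      unfolding sum_distrib_left using assms by (intro sum_mono step) auto
    also have "\<dots> = real k powr (1 - \<beta>) - real m powr (1 - \<beta>)"
      using sum_Suc_diff'[OF True, of "\<lambda>i. - (real i powr (1 - \<beta>))"] by simp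
    also have "\<dots> \<le> real k powr (1 - \<beta>)" by simp
    finally show ?thesis using assms by (simp add: field_simps)
  qed (use assms in auto)
qed

lemma sum_decay_head_le:
  assumes "0 < \<alpha>" "\<alpha> < 1"
  shows "(\<Sum>i<k. (1 + real i) powr (- \<alpha>)) \<le> real k powr (1 - \<alpha>) / (1 - \<alpha>)"
proof (induction k)
  case (Suc k)
  have "(1 - \<alpha>) * (1 + real k) powr (- \<alpha>) \<le> real (Suc k) powr (1 - \<alpha>) - real k powr (1 - \<alpha>)"
  proof (cases "k = 0")
    case False
    have "\<exists>z. real k < z \<and> z < real (Suc k) \<and>
        real (Suc k) powr (1 - \<alpha>) - real k powr (1 - \<alpha>) = (real (Suc k) - real k) * ((1 - \<alpha>) * z powr (1 - \<alpha> - 1))"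
      using False by (intro MVT2 has_real_derivative_powr) auto
    then obtain z where z: "real k < z" "z < real (Suc k)"
      "real (Suc k) powr (1 - \<alpha>) - real k powr (1 - \<alpha>) = (1 - \<alpha>) * z powr (- \<alpha>)" by auto
    have "(1 + real k) powr (- \<alpha>) \<le> z powr (- \<alpha>)" using z False assms by (intro powr_mono2') auto
    then show ?thesis unfolding z(3) using assms by (intro mult_left_mono) auto
  qed (use assms in auto)
  with Suc show ?case using assms by (simp add: field_simps)
qed simp

lemma sum_harmonic_le: "1 \<le> k \<Longrightarrow> (\<Sum>i<k. (1 + real i) powr (- 1)) \<le> 1 + ln (real k)"
proof (induction k rule: nat_induct_at_least)
  case (Suc k)
  have "ln (real k) - ln (real (Suc k)) \<le> (real k - real (Suc k)) / real (Suc k)"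
    using Suc.hyps by (intro ln_diff_le) auto
  then have "1 / (1 + real k) \<le> ln (real (Suc k)) - ln (real k)" by (simp add: add.commute)
  with Suc.IH show ?case by (simp add: powr_minus divide_inverse)
qed simp

text \<open>For \<open>\<bar>j\<bar> \<le> 2n\<close> one of the two factors is at most \<open>(n/2)\<^sup>-\<^sup>\<alpha>\<close>; for \<open>\<bar>j\<bar> > 2n\<close> both factors
  are comparable.\<close>
lemma decay_convolution_le:
  assumes "1/2 < \<alpha>" "1 \<le> n"
  shows "(\<Sum>j\<in>{- int m..int m}. decay_weight \<alpha> (j - int n) * decay_weight \<alpha> j)
    \<le> 2 powr \<alpha> * (4 * (real n powr (- \<alpha>) * (\<Sum>i<3 * n + 1. (1 + real i) powr (- \<alpha>)))
      + 2 * (real n powr (1 - 2 * \<alpha>) / (2 * \<alpha> - 1)))"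
proof -
  let ?w = "decay_weight \<alpha>" and ?c = "2 powr \<alpha> :: real"
  let ?J = "{- int m..int m}" and ?I = "{- (2 * int n)..2 * int n}"
  \<comment> \<open>For \<open>|j| \<le> 2 * n\<close> also \<open>|j - n| \<le> 3 * n\<close>, so
    this range covers both weights.\<close>
  define H where "H = (\<Sum>i<3 * n + 1. (1 + real i) powr (- \<alpha>))"
  have w: "?w j = (1 + real (nat \<bar>j\<bar>)) powr (- \<alpha>)" for j by (simp add: decay_weight_def)
  have part: "(\<Sum>j\<in>J. ?w j) \<le> 2 * H" if "finite J" "\<And>j. j \<in> J \<Longrightarrow> \<bar>j\<bar> \<le> 3 * int n" for J
    unfolding w H_def
  proof (rule sum_int_le[OF that(1)])
    show "(\<lambda>j. nat \<bar>j\<bar>) ` J \<subseteq> {..<3 * n + 1}" using that(2) by fastforce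
  qed auto
  have "(\<Sum>j\<in>?J \<inter> ?I. ?w (j - int n) * ?w j) \<le> (\<Sum>j\<in>?J \<inter> ?I. ?c * real n powr (- \<alpha>) * (?w (j - int n) + ?w j))"
    using assms by (intro sum_mono decay_weight_product_le) auto
  also have "\<dots> = ?c * real n powr (- \<alpha>) * ((\<Sum>j\<in>?J \<inter> ?I. ?w (j - int n)) + (\<Sum>j\<in>?J \<inter> ?I. ?w j))"
    by (simp only: sum_distrib_left[symmetric] sum.distrib)
  also have "\<dots> \<le> ?c * real n powr (- \<alpha>) * (2 * H + 2 * H)"
  proof (intro mult_left_mono add_mono)
    have "(\<Sum>j\<in>?J \<inter> ?I. ?w (j - int n)) = (\<Sum>j\<in>(\<lambda>j. j - int n) ` (?J \<inter> ?I). ?w j)"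
      by (subst sum.reindex) (auto simp: inj_on_def)
    also have "\<dots> \<le> 2 * H" by (rule part) auto
    finally show "(\<Sum>j\<in>?J \<inter> ?I. ?w (j - int n)) \<le> 2 * H" .
    show "(\<Sum>j\<in>?J \<inter> ?I. ?w j) \<le> 2 * H" by (rule part) auto
  qed auto
  finally have near: "(\<Sum>j\<in>?J \<inter> ?I. ?w (j - int n) * ?w j) \<le> ?c * (4 * (real n powr (- \<alpha>) * H))" by simp
  have "(\<Sum>j\<in>?J - ?I. ?w (j - int n) * ?w j) \<le> (\<Sum>j\<in>?J - ?I. ?c * (1 + real (nat \<bar>j\<bar>)) powr (- (2 * \<alpha>)))"
  proof (rule sum_mono)
    fix j assume "j \<in> ?J - ?I"
    \<comment> \<open>Here \<open>|j| > 2 * n\<close>, so \<open>|j - n| \<ge> |j| / 2\<close>, and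
      the product of the weights is comparable to one weight of the summable exponent
      \<open>2 * \<alpha>\<close>.\<close>
    then have "(1 + real_of_int \<bar>j\<bar>) / 2 \<le> 1 + real_of_int \<bar>j - int n\<bar>" by auto
    then have "?w (j - int n) \<le> ((1 + real_of_int \<bar>j\<bar>) / 2) powr (- \<alpha>)"
      unfolding decay_weight_def using assms by (intro powr_mono2') auto
    also have "\<dots> = ?c * ?w j"
      by (simp add: decay_weight_def powr_divide powr_minus field_simps)
    finally have "?w (j - int n) * ?w j \<le> ?c * ?w j * ?w j"
      by (intro mult_right_mono decay_weight_nonneg)
    also have "\<dots> = ?c * (1 + real (nat \<bar>j\<bar>)) powr (- (2 * \<alpha>))"
      by (simp add: w mult.assoc flip: powr_add)
    finally show "?w (j - int n) * ?w j \<le> ?c * (1 + real (nat \<bar>j\<bar>)) powr (- (2 * \<alpha>))" .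
  qed
  also have "\<dots> = ?c * (\<Sum>j\<in>?J - ?I. (1 + real (nat \<bar>j\<bar>)) powr (- (2 * \<alpha>)))" by (simp add: sum_distrib_left)
  also have "\<dots> \<le> ?c * (2 * (\<Sum>i\<in>{n..<m + 1}. (1 + real i) powr (- (2 * \<alpha>))))"
    by (intro mult_left_mono sum_int_le) auto
  also have "\<dots> \<le> ?c * (2 * (real n powr (1 - 2 * \<alpha>) / (2 * \<alpha> - 1)))"
    using assms by (intro mult_left_mono sum_decay_tail_le) auto
  finally have far: "(\<Sum>j\<in>?J - ?I. ?w (j - int n) * ?w j) \<le> ?c * (2 * (real n powr (1 - 2 * \<alpha>) / (2 * \<alpha> - 1)))" .
  have "(\<Sum>j\<in>?J. ?w (j - int n) * ?w j) = (\<Sum>j\<in>?J \<inter> ?I. ?w (j - int n) * ?w j) + (\<Sum>j\<in>?J - ?I. ?w (j - int n) * ?w j)"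
    by (rule sum.Int_Diff) simp
  also have "\<dots> \<le> ?c * (4 * (real n powr (- \<alpha>) * H)) + ?c * (2 * (real n powr (1 - 2 * \<alpha>) / (2 * \<alpha> - 1)))"
    using near far by (rule add_mono)
  finally show ?thesis by (simp add: H_def distrib_left)
qed

text \<open>The head sum has order \<open>n powr (1 - \<alpha>)\<close>, so near and distant sites
  give the same order.\<close>

lemma decay_convolution_lt_1:
  assumes "1/2 < \<alpha>" "\<alpha> < 1"
  shows "\<exists>C. \<forall>n\<ge>1. \<forall>m. (\<Sum>j\<in>{- int m..int m}. decay_weight \<alpha> (j - int n) * decay_weight \<alpha> j)
    \<le> C * real n powr (1 - 2 * \<alpha>)"
proof (intro exI allI impI)
  fix n m :: nat assume n: "1 \<le> n"
  let ?r = "real n powr (1 - 2 * \<alpha>)"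
  have "(\<Sum>i<3 * n + 1. (1 + real i) powr (- \<alpha>)) \<le> real (3 * n + 1) powr (1 - \<alpha>) / (1 - \<alpha>)"
    using assms by (intro sum_decay_head_le) auto
  also have "\<dots> \<le> (4 * real n) powr (1 - \<alpha>) / (1 - \<alpha>)"
    using assms n by (intro divide_right_mono powr_mono2) auto
  finally have "real n powr (- \<alpha>) * (\<Sum>i<3 * n + 1. (1 + real i) powr (- \<alpha>))
      \<le> real n powr (- \<alpha>) * ((4 * real n) powr (1 - \<alpha>) / (1 - \<alpha>))" by (rule mult_left_mono) simp
  also have "\<dots> = 4 powr (1 - \<alpha>) / (1 - \<alpha>) * ?r"
  proof -
    have "real n powr (- \<alpha>) * real n powr (1 - \<alpha>) = ?r" by (simp flip: powr_add)
    then show ?thesis by (simp add: powr_mult field_simps)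
  qed
  finally have "2 powr \<alpha> * (4 * (real n powr (- \<alpha>) * (\<Sum>i<3 * n + 1. (1 + real i) powr (- \<alpha>)))
      + 2 * (?r / (2 * \<alpha> - 1))) \<le> 2 powr \<alpha> * (4 * (4 powr (1 - \<alpha>) / (1 - \<alpha>) * ?r) + 2 * (?r / (2 * \<alpha> - 1)))"
    by (intro mult_left_mono add_mono) auto
  moreover have "c * (4 * (x * r) + 2 * (r / y)) = c * (4 * x + 2 / y) * r" for c x r y :: real
    by (simp add: algebra_simps)
  ultimately show "(\<Sum>j\<in>{- int m..int m}. decay_weight \<alpha> (j - int n) * decay_weight \<alpha> j)
      \<le> 2 powr \<alpha> * (4 * (4 powr (1 - \<alpha>) / (1 - \<alpha>)) + 2 / (2 * \<alpha> - 1)) * ?r"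
    using order_trans[OF decay_convolution_le[OF assms(1) n, of m]] by (simp only:)
qed

lemma decay_convolution_eq_1:
  "\<exists>C. \<forall>n\<ge>1. \<forall>m. (\<Sum>j\<in>{- int m..int m}. decay_weight 1 (j - int n) * decay_weight 1 j)
    \<le> C * (ln (real n + 1) / real n)"
proof (intro exI allI impI)
  fix n m :: nat assume n: "1 \<le> n"
  let ?l = "ln (real n + 1)"
  have ln2: "0 < ln (2 :: real)" by simp
  have "ln 2 \<le> ?l" using n by simp
  \<comment> \<open>Since \<open>n \<ge> 1\<close>, the logarithm is at least \<open>ln 2\<close>;
    it absorbs the constant of the harmonic sum and the tail of order \<open>1 / n\<close>.\<close>
  then have one: "1 \<le> ?l / ln 2" using ln2 by (simp add: le_divide_eq)
  have "ln (real (3 * n + 1)) \<le> ln ((real n + 1) ^ 3)"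
  proof (rule ln_mono)
    show "real (3 * n + 1) \<le> (real n + 1) ^ 3" by (simp add: power3_eq_cube algebra_simps)
  qed auto
  also have "\<dots> = 3 * ?l" by (simp add: ln_realpow)
  finally have ln3: "ln (real (3 * n + 1)) \<le> 3 * ?l" .
  have "(1 / ln 2 + 3) * ?l = ?l / ln 2 + 3 * ?l" by (simp add: distrib_right)
  then have H: "(\<Sum>i<3 * n + 1. (1 + real i) powr (- 1)) \<le> (1 / ln 2 + 3) * ?l"
    using sum_harmonic_le[of "3 * n + 1"] one ln3 by linarith
  have inv: "real n powr (- 1) = 1 / real n" using n by (simp add: powr_minus divide_inverse)
  have "2 powr 1 * (4 * (real n powr (- 1) * (\<Sum>i<3 * n + 1. (1 + real i) powr (- 1))) + 2 * (real n powr (1 - 2 * 1) / (2 * 1 - 1)))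
      \<le> 2 powr 1 * (4 * (real n powr (- 1) * ((1 / ln 2 + 3) * ?l)) + 2 * (real n powr (- 1) * (?l / ln 2)))"
    using H mult_left_mono[OF one, of "real n powr (- 1)"] by (intro mult_left_mono add_mono) auto
  also have "\<dots> = (8 * (1 / ln 2 + 3) + 4 / ln 2) * (?l / real n)"
  proof -
    have "2 * (4 * (1 / N * ((1 / L + 3) * l)) + 2 * (1 / N * (l / L))) = (8 * (1 / L + 3) + 4 / L) * (l / N)"
      for N L l :: real
      by (simp add: algebra_simps add_divide_distrib)
    then show ?thesis unfolding inv by simp
  qed
  finally have bound: "2 powr 1 * (4 * (real n powr (- 1) * (\<Sum>i<3 * n + 1. (1 + real i) powr (- 1)))
      + 2 * (real n powr (1 - 2 * 1) / (2 * 1 - 1))) \<le> (8 * (1 / ln 2 + 3) + 4 / ln 2) * (?l / real n)" .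
  have "1/2 < (1 :: real)" by simp
  from order_trans[OF decay_convolution_le[OF this n] bound]
  show "(\<Sum>j\<in>{- int m..int m}. decay_weight 1 (j - int n) * decay_weight 1 j)
      \<le> (8 * (1 / ln 2 + 3) + 4 / ln 2) * (?l / real n)" .
qed

text \<open>Now the weight itself is summable: the product estimate is summed over all
  \<open>j\<close> at once, and the total mass of the weight enters the constant.\<close>

lemma decay_convolution_gt_1:
  assumes "1 < \<alpha>"
  shows "\<exists>C. \<forall>n\<ge>1. \<forall>m. (\<Sum>j\<in>{- int m..int m}. decay_weight \<alpha> (j - int n) * decay_weight \<alpha> j)
    \<le> C * real n powr (- \<alpha>)"
proof (intro exI allI impI)
  fix n m :: nat assume n: "1 \<le> n"
  let ?w = "decay_weight \<alpha>" and ?J = "{- int m..int m}"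
  let ?W = "infsum ?w UNIV"
  have W: "sum ?w J \<le> ?W" if "finite J" for J
    using decay_weight_summable[OF assms] that decay_weight_nonneg by (intro finite_sum_le_infsum) auto
  have "(\<Sum>j\<in>?J. ?w (j - int n) * ?w j) \<le> (\<Sum>j\<in>?J. 2 powr \<alpha> * real n powr (- \<alpha>) * (?w (j - int n) + ?w j))"
    using assms n by (intro sum_mono decay_weight_product_le) auto
  also have "\<dots> = 2 powr \<alpha> * real n powr (- \<alpha>) * ((\<Sum>j\<in>?J. ?w (j - int n)) + sum ?w ?J)"
    by (simp only: sum_distrib_left[symmetric] sum.distrib)
  also have "(\<Sum>j\<in>?J. ?w (j - int n)) = sum ?w ((\<lambda>j. j - int n) ` ?J)"
    by (subst sum.reindex) (auto simp: inj_on_def)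
  also have "2 powr \<alpha> * real n powr (- \<alpha>) * (sum ?w ((\<lambda>j. j - int n) ` ?J) + sum ?w ?J)
      \<le> 2 powr \<alpha> * real n powr (- \<alpha>) * (?W + ?W)"
    by (intro mult_left_mono add_mono W) auto
  finally show "(\<Sum>j\<in>?J. ?w (j - int n) * ?w j) \<le> 2 powr \<alpha> * (?W + ?W) * real n powr (- \<alpha>)"
    by (simp add: mult_ac)
qed

theorem theorem4p1:
  fixes T :: "'a::{banach,second_countable_topology} \<Rightarrow> 'a"
    and D :: "'a set"
    and S :: "nat \<Rightarrow> 'a \<Rightarrow> 'a"
  assumes T_lin: "bounded_linear T"
    and D_dense: "closure D = UNIV"
    and sumT: "\<forall>x\<in>D. (\<lambda>n. (T ^^ n) x) summable_on UNIV"
    and sumS: "\<forall>x\<in>D. (\<lambda>n. S n x) summable_on UNIV"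
    and TS: "\<forall>x\<in>D. \<forall>n. (T ^^ n) (S n x) = x"
    and TS2: "\<forall>x\<in>D. \<forall>n m. m < n \<longrightarrow> (T ^^ m) (S n x) = S (n - m) x"
  shows "(\<exists>\<mu>. good_measure T \<mu>) \<and>
    (\<forall>\<alpha>::real. \<alpha> > 1/2 \<and>
        (\<forall>x\<in>D. (\<lambda>n. norm ((T ^^ n) x)) \<in> O(\<lambda>n. real n powr (-\<alpha>)) \<and>
                (\<lambda>n. norm (S n x)) \<in> O(\<lambda>n. real n powr (-\<alpha>)))
      \<longrightarrow> (\<exists>\<mu>. good_measure T \<mu> \<and>
            (\<forall>f g. polynomial_on f \<and> polynomial_on g \<longrightarrow>
               (\<exists>C. \<forall>n::nat. n \<ge> 1 \<longrightarrow>
                  (\<alpha> < 1 \<longrightarrow> \<bar>Cov \<mu> (f \<circ> (T ^^ n)) g\<bar> \<le> C * real n powr (1 - 2 * \<alpha>)) \<and>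
                  (\<alpha> = 1 \<longrightarrow> \<bar>Cov \<mu> (f \<circ> (T ^^ n)) g\<bar> \<le> C * ln (real n + 1) / real n) \<and>
                  (\<alpha> > 1 \<longrightarrow> \<bar>Cov \<mu> (f \<circ> (T ^^ n)) g\<bar> \<le> C * real n powr (-\<alpha>)))) \<and>
            (\<alpha> > 1 \<longrightarrow>
               (\<forall>f. polynomial_on f \<and> (\<integral>x. f x \<partial>\<mu>) = 0 \<longrightarrow>
                  (\<exists>\<sigma>::real. \<sigma> \<ge> 0 \<and>
                     weak_conv_m
                       (\<lambda>n. distr \<mu> borel (\<lambda>x. (\<Sum>i<n. f ((T ^^ i) x)) / sqrt (real n)))
                       (distr std_normal_distribution borel (\<lambda>t. \<sigma> * t)))))))"
proof (intro conjI allI impI)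
  note exists = noise_dynamics_exists[OF T_lin D_dense sumT sumS TS TS2]
  \<comment> \<open>For the first claim a constant weight is enough: the terms of summable series
    are bounded, and moments, mixing and support rest on the rare events rather than on decay of the
    influences.\<close>
  have "\<exists>A. \<forall>j. norm (two_sided_orbit T S x j) \<le> A * 1" if x: "x \<in> D" for x
  proof -
    obtain A where A: "\<And>n. norm ((T ^^ n) x) \<le> A" using summable_on_imp_bounded sumT x by blast
    obtain A' where A': "\<And>n. norm (S n x) \<le> A'" using summable_on_imp_bounded sumS x by blast
    have "norm (two_sided_orbit T S x j) \<le> max A A' * 1" for j
      using A[of "nat (- j)"] A'[of "nat j"] by (auto simp: two_sided_orbit_def)
    then show ?thesis by blast
  qed
  then obtain Y N b p where "noise_dynamics Y N b p (\<lambda>_. 1) T" using exists[of "\<lambda>_. 1"] by auto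
  then show "\<exists>\<mu>. good_measure T \<mu>" using noise_dynamics.good_measure_\<mu> by blast
  fix \<alpha> :: real
  assume \<alpha>: "\<alpha> > 1/2 \<and>
    (\<forall>x\<in>D. (\<lambda>n. norm ((T ^^ n) x)) \<in> O(\<lambda>n. real n powr (-\<alpha>)) \<and>
      (\<lambda>n. norm (S n x)) \<in> O(\<lambda>n. real n powr (-\<alpha>)))"
  let ?w = "decay_weight \<alpha>"
  have "\<exists>A. \<forall>j. norm (two_sided_orbit T S x j) \<le> A * ?w j" if x: "x \<in> D" for x
  proof -
    obtain A where A: "0 \<le> A" "\<And>n. norm ((T ^^ n) x) \<le> A * (1 + real n) powr (- \<alpha>)"
      using bigo_powr_bound[of "\<lambda>n. norm ((T ^^ n) x)" \<alpha>] \<alpha> x by auto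
    obtain A' where A': "0 \<le> A'" "\<And>n. norm (S n x) \<le> A' * (1 + real n) powr (- \<alpha>)"
      using bigo_powr_bound[of "\<lambda>n. norm (S n x)" \<alpha>] \<alpha> x by auto
    have "norm (two_sided_orbit T S x j) \<le> (A + A') * ?w j" for j
    proof (cases "0 \<le> j")
      case True
      then have "norm (two_sided_orbit T S x j) \<le> A' * ?w j"
        using A'(2)[of "nat j"] by (simp add: two_sided_orbit_def decay_weight_def)
      also have "\<dots> \<le> (A + A') * ?w j" using A(1) by (intro mult_right_mono decay_weight_nonneg) simp
      finally show ?thesis .
    next
      case False
      then have "norm (two_sided_orbit T S x j) \<le> A * ?w j"
        using A(2)[of "nat (- j)"] by (simp add: two_sided_orbit_def decay_weight_def)
      also have "\<dots> \<le> (A + A') * ?w j" using A'(1) by (intro mult_right_mono decay_weight_nonneg) simp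
      finally show ?thesis .
    qed
    then show ?thesis by blast
  qed
  \<comment> \<open>The field is chosen before any polynomial, so one measure serves all covariances
    and the limit theorem.\<close>
  then obtain Y N b p where "noise_dynamics Y N b p ?w T"
    using exists[of ?w] decay_weight_nonneg by auto
  then interpret noise_dynamics Y N b p ?w T .
  have cov: "\<exists>C. \<forall>n\<ge>1. \<bar>Cov \<mu> (f \<circ> (T ^^ n)) g\<bar> \<le> C * r n"
    if pol: "polynomial_on f" "polynomial_on g"
      and r: "\<exists>C. \<forall>n\<ge>1. \<forall>m. (\<Sum>j\<in>{- int m..int m}. ?w (j - int n) * ?w j) \<le> C * r n" for f g r
  proof -
    obtain M where M: "\<And>n B. (\<forall>m. (\<Sum>j\<in>{- int m..int m}. ?w (j - int n) * ?w j) \<le> B) \<Longrightarrow>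
        \<bar>Cov \<mu> (f \<circ> T ^^ n) g\<bar> \<le> M * B"
      using polynomial_covariance[OF pol] by auto
    obtain C where C: "\<And>n m. 1 \<le> n \<Longrightarrow> (\<Sum>j\<in>{- int m..int m}. ?w (j - int n) * ?w j) \<le> C * r n"
      using r by auto
    have "\<bar>Cov \<mu> (f \<circ> (T ^^ n)) g\<bar> \<le> (M * C) * r n" if "1 \<le> n" for n
      using M[of n "C * r n"] C[OF that] by (simp add: mult.assoc)
    then show ?thesis by blast
  qed
  show "\<exists>\<mu>. good_measure T \<mu> \<and>
      (\<forall>f g. polynomial_on f \<and> polynomial_on g \<longrightarrow>
         (\<exists>C. \<forall>n::nat. n \<ge> 1 \<longrightarrow>
            (\<alpha> < 1 \<longrightarrow> \<bar>Cov \<mu> (f \<circ> (T ^^ n)) g\<bar> \<le> C * real n powr (1 - 2 * \<alpha>)) \<and>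
            (\<alpha> = 1 \<longrightarrow> \<bar>Cov \<mu> (f \<circ> (T ^^ n)) g\<bar> \<le> C * ln (real n + 1) / real n) \<and>
            (\<alpha> > 1 \<longrightarrow> \<bar>Cov \<mu> (f \<circ> (T ^^ n)) g\<bar> \<le> C * real n powr (-\<alpha>)))) \<and>
      (\<alpha> > 1 \<longrightarrow>
         (\<forall>f. polynomial_on f \<and> (\<integral>x. f x \<partial>\<mu>) = 0 \<longrightarrow>
            (\<exists>\<sigma>::real. \<sigma> \<ge> 0 \<and>
               weak_conv_m
                 (\<lambda>n. distr \<mu> borel (\<lambda>x. (\<Sum>i<n. f ((T ^^ i) x)) / sqrt (real n)))
                 (distr std_normal_distribution borel (\<lambda>t. \<sigma> * t)))))"
  proof (intro exI[of _ \<mu>] conjI allI impI good_measure_\<mu>)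
    fix f g :: "'a \<Rightarrow> real" assume fg: "polynomial_on f \<and> polynomial_on g"
    consider "\<alpha> < 1" | "\<alpha> = 1" | "1 < \<alpha>" by linarith
    then show "\<exists>C. \<forall>n::nat. n \<ge> 1 \<longrightarrow>
        (\<alpha> < 1 \<longrightarrow> \<bar>Cov \<mu> (f \<circ> (T ^^ n)) g\<bar> \<le> C * real n powr (1 - 2 * \<alpha>)) \<and>
        (\<alpha> = 1 \<longrightarrow> \<bar>Cov \<mu> (f \<circ> (T ^^ n)) g\<bar> \<le> C * ln (real n + 1) / real n) \<and>
        (\<alpha> > 1 \<longrightarrow> \<bar>Cov \<mu> (f \<circ> (T ^^ n)) g\<bar> \<le> C * real n powr (-\<alpha>))"
    proof cases
      case 1
      then show ?thesis
        using cov[of f g "\<lambda>n. real n powr (1 - 2 * \<alpha>)"] decay_convolution_lt_1[of \<alpha>] fg \<alpha> by auto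
    next
      case 2
      then show ?thesis
        using cov[of f g "\<lambda>n. ln (real n + 1) / real n"] decay_convolution_eq_1 fg by auto
    next
      case 3
      then show ?thesis
        using cov[of f g "\<lambda>n. real n powr (- \<alpha>)"] decay_convolution_gt_1[of \<alpha>] fg by auto
    qed
  next
    fix f :: "'a \<Rightarrow> real" assume "1 < \<alpha>" "polynomial_on f \<and> (\<integral>x. f x \<partial>\<mu>) = 0"
    then show "\<exists>\<sigma>\<ge>0. weak_conv_m
        (\<lambda>n. distr \<mu> borel (\<lambda>x. (\<Sum>i<n. f ((T ^^ i) x)) / sqrt (real n)))
        (distr std_normal_distribution borel (\<lambda>t. \<sigma> * t))"
      using polynomial_clt_\<mu> decay_weight_summable by blast
  qed
qed

end
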